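(* Let $R$ be a ring, let $G$ be a group, let $\phi\colon G\to\mathbb{R}$ be a homomorphism, and let $n\geqslant 0$ be an integer. If $H_i(G;\widehat{RG}^{\phi})=0$ for all $i\leqslant n$, then $H^i(G;\widehat{RG}^{-\phi})=0$ for all $i\leqslant n$.
   Context: Rings are associative, unital and non-zero. The Novikov ring $\widehat{RG}^{\phi}$ is the set of functions $x\colon G\to R$ such that $\{g\in G: x(g)\neq 0,\ \phi(g)\leqslant\kappa\}$ is finite for every $\kappa\in\mathbb{R}$, with pointwise addition and convolution as multiplication. It contains $RG$ and is an $RG$-bimodule. Conventions: coefficients in both homology and cohomology are left modules. For a left $RG$-module $M$, $H_i(G;M)=H_i(M^*\otimes_{RG}C_\bullet)$, where $C_\bullet\to R$ is a resolution of the trivial module $R$ by projective left $RG$-modules and $M^*$ is the right module obtained from $M$ by twisting the action of $G$ by $g\mapsto g^{-1}$; and $H^i(G;M)=H^i(\mathrm{Hom}_{RG}(C_\bullet,M))$. With this convention, $(\widehat{RG}^{\phi})^*$ is isomorphic to $\widehat{RG}^{-\phi}$ as a right $RG$-module, which accounts for the sign change. *)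

theory Defs
  imports Complex_Main "HOL-Algebra.Module" "HOL-Algebra.Free_Abelian_Groups"
begin

section \<open>Modules over a ring that need not be commutative\<close>

text \<open>
  The library locale \<open>module\<close> requires a commutative ring of scalars; the record \<open>module\<close>
  does not, and is reused here. In every module record the ring fields \<open>mult\<close> and \<open>one\<close>
  are irrelevant.
\<close>

locale left_module = A?: ring A + M?: abelian_group M
  for A :: "('a, 'k) ring_scheme" (structure) and M :: "('a, 'b, 'l) module_scheme" (structure) +
  assumes lsmult_closed: "\<lbrakk>a \<in> carrier A; x \<in> carrier M\<rbrakk> \<Longrightarrow> a \<odot>\<^bsub>M\<^esub> x \<in> carrier M"
    and lsmult_l_distr: "\<lbrakk>a \<in> carrier A; b \<in> carrier A; x \<in> carrier M\<rbrakk> \<Longrightarrow>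
      (a \<oplus>\<^bsub>A\<^esub> b) \<odot>\<^bsub>M\<^esub> x = a \<odot>\<^bsub>M\<^esub> x \<oplus>\<^bsub>M\<^esub> b \<odot>\<^bsub>M\<^esub> x"
    and lsmult_r_distr: "\<lbrakk>a \<in> carrier A; x \<in> carrier M; y \<in> carrier M\<rbrakk> \<Longrightarrow>
      a \<odot>\<^bsub>M\<^esub> (x \<oplus>\<^bsub>M\<^esub> y) = a \<odot>\<^bsub>M\<^esub> x \<oplus>\<^bsub>M\<^esub> a \<odot>\<^bsub>M\<^esub> y"
    and lsmult_assoc: "\<lbrakk>a \<in> carrier A; b \<in> carrier A; x \<in> carrier M\<rbrakk> \<Longrightarrow>
      (a \<otimes>\<^bsub>A\<^esub> b) \<odot>\<^bsub>M\<^esub> x = a \<odot>\<^bsub>M\<^esub> (b \<odot>\<^bsub>M\<^esub> x)"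
    and lsmult_one: "x \<in> carrier M \<Longrightarrow> \<one>\<^bsub>A\<^esub> \<odot>\<^bsub>M\<^esub> x = x"

record ('a, 'b) right_module = "'b ring" +
  rsmult :: "'b \<Rightarrow> 'a \<Rightarrow> 'b"

text \<open>A bimodule record is a left module record with an additional right action, so that a
  bimodule can be used wherever a left module is expected.\<close>

record ('a, 'b) bimodule = "('a, 'b) module" +
  bi_rsmult :: "'b \<Rightarrow> 'a \<Rightarrow> 'b"

definition linear_maps ::
  "('a, 'k) ring_scheme \<Rightarrow> ('a, 'b, 'l) module_scheme \<Rightarrow> ('a, 'c, 'm) module_scheme \<Rightarrow> ('b \<Rightarrow> 'c) set"
  where "linear_maps A M N =
    {f \<in> carrier M \<rightarrow> carrier N.
      (\<forall>x \<in> carrier M. \<forall>y \<in> carrier M. f (x \<oplus>\<^bsub>M\<^esub> y) = f x \<oplus>\<^bsub>N\<^esub> f y) \<and>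
      (\<forall>a \<in> carrier A. \<forall>x \<in> carrier M. f (a \<odot>\<^bsub>M\<^esub> x) = a \<odot>\<^bsub>N\<^esub> f x)}"

definition free_module :: "('a, 'k) ring_scheme \<Rightarrow> 'x set \<Rightarrow> ('a, 'x \<Rightarrow> 'a) module"
  where "free_module A X =
    \<lparr>carrier = {f \<in> X \<rightarrow>\<^sub>E carrier A. finite {x \<in> X. f x \<noteq> \<zero>\<^bsub>A\<^esub>}},
     monoid.mult = (\<lambda>_ _. undefined), one = undefined,
     ring.zero = (\<lambda>x\<in>X. \<zero>\<^bsub>A\<^esub>),
     add = (\<lambda>f g. \<lambda>x\<in>X. f x \<oplus>\<^bsub>A\<^esub> g x),
     smult = (\<lambda>a f. \<lambda>x\<in>X. a \<otimes>\<^bsub>A\<^esub> f x)\<rparr>"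

text \<open>
  Projective means direct summand of a free module. Taking the basis \<open>X\<close> inside the type of
  elements of \<open>P\<close> is no restriction: a projective \<open>P\<close> is a direct summand of the free module
  on \<open>carrier P\<close>.
\<close>

definition projective_module :: "('a, 'k) ring_scheme \<Rightarrow> ('a, 'b) module \<Rightarrow> bool"
  where "projective_module A P \<longleftrightarrow> left_module A P \<and>
    (\<exists>(X :: 'b set) s r.
      s \<in> linear_maps A P (free_module A X) \<and> r \<in> linear_maps A (free_module A X) P \<and>
      (\<forall>p \<in> carrier P. r (s p) = p))"

text \<open>The differential \<open>d i\<close> goes from degree \<open>Suc i\<close> to degree \<open>i\<close>.\<close>

definition projective_resolution ::
  "('a, 'k) ring_scheme \<Rightarrow> ('a, 'b, 'l) module_scheme \<Rightarrow>
   (nat \<Rightarrow> ('a, 'c) module) \<Rightarrow> (nat \<Rightarrow> 'c \<Rightarrow> 'c) \<Rightarrow> ('c \<Rightarrow> 'b) \<Rightarrow> bool"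
  where "projective_resolution A B C d \<epsilon> \<longleftrightarrow>
    (\<forall>i. projective_module A (C i)) \<and>
    (\<forall>i. d i \<in> linear_maps A (C (Suc i)) (C i)) \<and>
    \<epsilon> \<in> linear_maps A (C 0) B \<and>
    \<epsilon> ` carrier (C 0) = carrier B \<and>
    d 0 ` carrier (C (Suc 0)) = {c \<in> carrier (C 0). \<epsilon> c = \<zero>\<^bsub>B\<^esub>} \<and>
    (\<forall>i. d (Suc i) ` carrier (C (Suc (Suc i))) = {c \<in> carrier (C (Suc i)). d i c = \<zero>\<^bsub>C i\<^esub>})"


section \<open>Tensor products and groups of homomorphisms\<close>

definition tensor_relators ::
  "('a, 'k) ring_scheme \<Rightarrow> ('a, 'b, 'l) right_module_scheme \<Rightarrow> ('a, 'c, 'm) module_scheme \<Rightarrow>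
   ('b \<times> 'c \<Rightarrow>\<^sub>0 int) set"
  where "tensor_relators A M N =
    {frag_of (x \<oplus>\<^bsub>M\<^esub> x', y) - frag_of (x, y) - frag_of (x', y) | x x' y.
       x \<in> carrier M \<and> x' \<in> carrier M \<and> y \<in> carrier N} \<union>
    {frag_of (x, y \<oplus>\<^bsub>N\<^esub> y') - frag_of (x, y) - frag_of (x, y') | x y y'.
       x \<in> carrier M \<and> y \<in> carrier N \<and> y' \<in> carrier N} \<union>
    {frag_of (rsmult M x a, y) - frag_of (x, a \<odot>\<^bsub>N\<^esub> y) | x a y.
       x \<in> carrier M \<and> a \<in> carrier A \<and> y \<in> carrier N}"

definition tensor_subgroup ::
  "('a, 'k) ring_scheme \<Rightarrow> ('a, 'b, 'l) right_module_scheme \<Rightarrow> ('a, 'c, 'm) module_scheme \<Rightarrow>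
   ('b \<times> 'c \<Rightarrow>\<^sub>0 int) set"
  where "tensor_subgroup A M N =
    generate (free_Abelian_group (carrier M \<times> carrier N)) (tensor_relators A M N)"

definition tensor_product ::
  "('a, 'k) ring_scheme \<Rightarrow> ('a, 'b, 'l) right_module_scheme \<Rightarrow> ('a, 'c, 'm) module_scheme \<Rightarrow>
   ('b \<times> 'c \<Rightarrow>\<^sub>0 int) set monoid"
  where "tensor_product A M N =
    free_Abelian_group (carrier M \<times> carrier N) Mod tensor_subgroup A M N"

text \<open>
  The map \<open>id \<otimes> f\<close> from \<open>M \<otimes> N\<close> to \<open>M \<otimes> N'\<close>, where \<open>f\<close> is a linear map from \<open>N\<close> to \<open>N'\<close>:
  all members of a coset in the source determine the same coset in the target. Neither \<open>N\<close>
  nor the source tensor product is needed as an argument.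
\<close>

definition tensor_map ::
  "('a, 'k) ring_scheme \<Rightarrow> ('a, 'b, 'l) right_module_scheme \<Rightarrow> ('a, 'd, 'm) module_scheme \<Rightarrow>
   ('c \<Rightarrow> 'd) \<Rightarrow> ('b \<times> 'c \<Rightarrow>\<^sub>0 int) set \<Rightarrow> ('b \<times> 'd \<Rightarrow>\<^sub>0 int) set"
  where "tensor_map A M N' f Z =
    the_elem ((\<lambda>p. tensor_subgroup A M N' #>\<^bsub>free_Abelian_group (carrier M \<times> carrier N')\<^esub>
                    frag_extend (\<lambda>(x, y). frag_of (x, f y)) p) ` Z)"

definition Hom_group ::
  "('a, 'k) ring_scheme \<Rightarrow> ('a, 'b, 'l) module_scheme \<Rightarrow> ('a, 'c, 'm) module_scheme \<Rightarrow> ('b \<Rightarrow> 'c) monoid"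
  where "Hom_group A M N =
    \<lparr>carrier = linear_maps A M N \<inter> extensional (carrier M),
     monoid.mult = (\<lambda>f g. \<lambda>x\<in>carrier M. f x \<oplus>\<^bsub>N\<^esub> g x),
     one = (\<lambda>x\<in>carrier M. \<zero>\<^bsub>N\<^esub>)\<rparr>"


section \<open>Homology of complexes of abelian groups\<close>

text \<open>Complexes are concentrated in degrees \<open>\<ge> 0\<close>. For chain complexes \<open>d i\<close> maps \<open>T (Suc i)\<close>
  to \<open>T i\<close>; for cochain complexes \<open>d i\<close> maps \<open>T i\<close> to \<open>T (Suc i)\<close>.\<close>

definition chain_homology :: "(nat \<Rightarrow> 't monoid) \<Rightarrow> (nat \<Rightarrow> 't \<Rightarrow> 't) \<Rightarrow> nat \<Rightarrow> 't set monoid"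
  where "chain_homology T d i =
    (T i)\<lparr>carrier := (case i of 0 \<Rightarrow> carrier (T 0) | Suc j \<Rightarrow> kernel (T (Suc j)) (T j) (d j))\<rparr>
      Mod (d i ` carrier (T (Suc i)))"

definition cochain_cohomology :: "(nat \<Rightarrow> 't monoid) \<Rightarrow> (nat \<Rightarrow> 't \<Rightarrow> 't) \<Rightarrow> nat \<Rightarrow> 't set monoid"
  where "cochain_cohomology T d i =
    (T i)\<lparr>carrier := kernel (T i) (T (Suc i)) (d i)\<rparr>
      Mod (case i of 0 \<Rightarrow> {\<one>\<^bsub>T 0\<^esub>} | Suc j \<Rightarrow> d j ` carrier (T j))"


section \<open>Group rings and Novikov rings\<close>

definition real_group :: "real monoid"
  where "real_group = \<lparr>carrier = UNIV, monoid.mult = (+), one = 0\<rparr>"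

definition supp :: "('r, 'k) ring_scheme \<Rightarrow> ('g, 'l) monoid_scheme \<Rightarrow> ('g \<Rightarrow> 'r) \<Rightarrow> 'g set"
  where "supp R G x = {g \<in> carrier G. x g \<noteq> \<zero>\<^bsub>R\<^esub>}"

definition monomial ::
  "('r, 'k) ring_scheme \<Rightarrow> ('g, 'l) monoid_scheme \<Rightarrow> 'g \<Rightarrow> 'r \<Rightarrow> 'g \<Rightarrow> 'r"
  where "monomial R G g r = (\<lambda>h\<in>carrier G. if h = g then r else \<zero>\<^bsub>R\<^esub>)"

text \<open>The index set of the sum is finite for any two elements of a Novikov ring.\<close>

definition convolution ::
  "('r, 'k) ring_scheme \<Rightarrow> ('g, 'l) monoid_scheme \<Rightarrow> ('g \<Rightarrow> 'r) \<Rightarrow> ('g \<Rightarrow> 'r) \<Rightarrow> 'g \<Rightarrow> 'r"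
  where "convolution R G x y =
    (\<lambda>g\<in>carrier G.
      \<Oplus>\<^bsub>R\<^esub>h\<in>{h \<in> supp R G x. inv\<^bsub>G\<^esub> h \<otimes>\<^bsub>G\<^esub> g \<in> supp R G y}. x h \<otimes>\<^bsub>R\<^esub> y (inv\<^bsub>G\<^esub> h \<otimes>\<^bsub>G\<^esub> g))"

definition group_ring ::
  "('r, 'k) ring_scheme \<Rightarrow> ('g, 'l) monoid_scheme \<Rightarrow> ('g \<Rightarrow> 'r) ring"
  where "group_ring R G =
    \<lparr>carrier = {x \<in> carrier G \<rightarrow>\<^sub>E carrier R. finite (supp R G x)},
     monoid.mult = convolution R G,
     one = monomial R G \<one>\<^bsub>G\<^esub> \<one>\<^bsub>R\<^esub>,
     ring.zero = (\<lambda>g\<in>carrier G. \<zero>\<^bsub>R\<^esub>),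
     add = (\<lambda>x y. \<lambda>g\<in>carrier G. x g \<oplus>\<^bsub>R\<^esub> y g)\<rparr>"

definition novikov_ring ::
  "('r, 'k) ring_scheme \<Rightarrow> ('g, 'l) monoid_scheme \<Rightarrow> ('g \<Rightarrow> real) \<Rightarrow> ('g \<Rightarrow> 'r) ring"
  where "novikov_ring R G \<phi> = (group_ring R G)
    \<lparr>carrier := {x \<in> carrier G \<rightarrow>\<^sub>E carrier R. \<forall>\<kappa>. finite {g \<in> carrier G. x g \<noteq> \<zero>\<^bsub>R\<^esub> \<and> \<phi> g \<le> \<kappa>}}\<rparr>"

text \<open>The group ring is a subset of the Novikov ring and acts on it by multiplication from
  both sides.\<close>

definition novikov_bimodule ::
  "('r, 'k) ring_scheme \<Rightarrow> ('g, 'l) monoid_scheme \<Rightarrow> ('g \<Rightarrow> real) \<Rightarrow> ('g \<Rightarrow> 'r, 'g \<Rightarrow> 'r) bimodule"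
  where "novikov_bimodule R G \<phi> = (let N = novikov_ring R G \<phi> in
    \<lparr>carrier = carrier N, monoid.mult = monoid.mult N, one = one N, ring.zero = ring.zero N, add = add N,
     smult = monoid.mult N, bi_rsmult = monoid.mult N\<rparr>)"

text \<open>The ring \<open>R\<close> as a left module over the group ring, with \<open>G\<close> acting trivially.\<close>

definition trivial_module ::
  "('r, 'k) ring_scheme \<Rightarrow> ('g, 'l) monoid_scheme \<Rightarrow> ('g \<Rightarrow> 'r, 'r) module"
  where "trivial_module R G =
    \<lparr>carrier = carrier R, monoid.mult = monoid.mult R, one = one R, ring.zero = ring.zero R, add = add R,
     smult = (\<lambda>x r. \<Oplus>\<^bsub>R\<^esub>g\<in>supp R G x. x g \<otimes>\<^bsub>R\<^esub> r)\<rparr>"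


section \<open>Homology and cohomology of groups\<close>

text \<open>
  The right module \<open>M\<^sup>*\<close>. The right action of a group element \<open>g\<close> is the left action of its
  inverse; an element \<open>r\<close> of \<open>R\<close> keeps acting from the right, as the left action of \<open>R\<close>
  gives no right action unless \<open>R\<close> is commutative. Hence
  \<open>m \<cdot> (\<Sum>g. x g g) = (\<Sum>g. g\<^sup>-\<^sup>1 m (x g))\<close>.
\<close>

definition twist ::
  "('r, 'k) ring_scheme \<Rightarrow> ('g, 'l) monoid_scheme \<Rightarrow> ('g \<Rightarrow> 'r, 'm) bimodule \<Rightarrow>
   ('g \<Rightarrow> 'r, 'm) right_module"
  where "twist R G M =
    \<lparr>carrier = carrier M, monoid.mult = monoid.mult M, one = one M, ring.zero = ring.zero M, add = add M,
     rsmult = (\<lambda>m x. \<Oplus>\<^bsub>M\<^esub>g\<in>supp R G x.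
       monomial R G (inv\<^bsub>G\<^esub> g) \<one>\<^bsub>R\<^esub> \<odot>\<^bsub>M\<^esub> bi_rsmult M m (monomial R G \<one>\<^bsub>G\<^esub> (x g)))\<rparr>"

text \<open>In the following two definitions \<open>C\<close> with differential \<open>d\<close> is meant to be a projective
  resolution of the trivial module.\<close>

definition group_homology ::
  "('r, 'k) ring_scheme \<Rightarrow> ('g, 'l) monoid_scheme \<Rightarrow>
   (nat \<Rightarrow> ('g \<Rightarrow> 'r, 'c) module) \<Rightarrow> (nat \<Rightarrow> 'c \<Rightarrow> 'c) \<Rightarrow>
   ('g \<Rightarrow> 'r, 'm) bimodule \<Rightarrow> nat \<Rightarrow> ('m \<times> 'c \<Rightarrow>\<^sub>0 int) set set monoid"
  where "group_homology R G C d M i =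
    chain_homology
      (\<lambda>j. tensor_product (group_ring R G) (twist R G M) (C j))
      (\<lambda>j. tensor_map (group_ring R G) (twist R G M) (C j) (d j)) i"

definition group_cohomology ::
  "('r, 'k) ring_scheme \<Rightarrow> ('g, 'l) monoid_scheme \<Rightarrow>
   (nat \<Rightarrow> ('g \<Rightarrow> 'r, 'c) module) \<Rightarrow> (nat \<Rightarrow> 'c \<Rightarrow> 'c) \<Rightarrow>
   ('g \<Rightarrow> 'r, 'm, 'z) module_scheme \<Rightarrow> nat \<Rightarrow> ('c \<Rightarrow> 'm) set monoid"
  where "group_cohomology R G C d M i =
    cochain_cohomology
      (\<lambda>j. Hom_group (group_ring R G) (C j) M)
      (\<lambda>j f. \<lambda>c\<in>carrier (C (Suc j)). f (d j c)) i"

end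

theory Submission
  imports Defs
begin

text \<open>
  Write \<open>A\<close> for the group ring, and \<open>N\<close> and \<open>S\<close> for the Novikov rings of \<open>\<phi>\<close> and \<open>-\<phi>\<close>.
  Inverting group elements identifies \<open>N\<^sup>*\<close> with \<open>S\<close> as a right \<open>A\<close>-module, so the hypothesis
  says that \<open>S \<otimes> C\<close> is exact in degrees \<open>\<le> n\<close>. As the modules \<open>C i\<close> are projective over \<open>A\<close>
  and \<open>S \<otimes> C i\<close> is a left \<open>A\<close>-module, the chain map \<open>c \<mapsto> 1 \<otimes> c\<close> from \<open>C\<close> to \<open>S \<otimes> C\<close>
  is null homotopic in these degrees: \<open>1 \<otimes> c = d (h' c) + h (d c)\<close>. A cocycle \<open>f\<close> from \<open>C i\<close>
  to \<open>S\<close> induces \<open>F (s \<otimes> c) = s f(c)\<close>, which vanishes on boundaries, so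
  \<open>f c = F (1 \<otimes> c) = F (h (d c))\<close> is a coboundary. The comparison of projective resolutions
  transfers this from \<open>C\<close> to \<open>D\<close>.
\<close>

section \<open>Linear maps and projective modules\<close>

text \<open>Projectivity of \<open>C i\<close> lifts \<open>A\<close>-linear maps only, so the
  homotopy has to run between left \<open>A\<close>-modules. Left multiplication on S survives
  tensoring on the right over \<open>A\<close> and makes S \<otimes> C i such a module, and a (1
  \<otimes> c) = a \<otimes> c = 1 \<otimes> a c makes c \<mapsto> 1 \<otimes> c linear. A cocycle
  in degree i uses the homotopy up to the map from C i to S \<otimes> C (i+1), whose construction
  takes exactness in degrees up to i; so the same bound n appears on both sides.

  As R need not be commutative, inverting group elements need not reverse products; it is an
  additive bijection that turns the twisted right action into right multiplication, because the
  twist keeps R acting from the right. The complexes are not transported to S: the twisted module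
  stays in the tensor products, and the multiplication of S is pulled back to it as a left action of
  \<open>A\<close> and as a pairing with values in S.

  Homology is formed with C and cohomology with D, over possibly different types, so a comparison of
  resolutions is part of the claim.\<close>

lemma linear_mapsD:
  assumes "f \<in> linear_maps A M N"
  shows "x \<in> carrier M \<Longrightarrow> f x \<in> carrier N"
    and "\<lbrakk>x \<in> carrier M; y \<in> carrier M\<rbrakk> \<Longrightarrow> f (x \<oplus>\<^bsub>M\<^esub> y) = f x \<oplus>\<^bsub>N\<^esub> f y"
    and "\<lbrakk>a \<in> carrier A; x \<in> carrier M\<rbrakk> \<Longrightarrow> f (a \<odot>\<^bsub>M\<^esub> x) = a \<odot>\<^bsub>N\<^esub> f x"
  using assms by (auto simp: linear_maps_def)

lemma linear_mapsI:
  assumes "\<And>x. x \<in> carrier M \<Longrightarrow> f x \<in> carrier N"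
    and "\<And>x y. \<lbrakk>x \<in> carrier M; y \<in> carrier M\<rbrakk> \<Longrightarrow> f (x \<oplus>\<^bsub>M\<^esub> y) = f x \<oplus>\<^bsub>N\<^esub> f y"
    and "\<And>a x. \<lbrakk>a \<in> carrier A; x \<in> carrier M\<rbrakk> \<Longrightarrow> f (a \<odot>\<^bsub>M\<^esub> x) = a \<odot>\<^bsub>N\<^esub> f x"
  shows "f \<in> linear_maps A M N"
  using assms by (auto simp: linear_maps_def)

lemma linear_maps_comp:
  assumes "f \<in> linear_maps A M N" "g \<in> linear_maps A N P"
  shows "(\<lambda>x. g (f x)) \<in> linear_maps A M P"
  using assms by (intro linear_mapsI) (simp_all add: linear_mapsD)

context left_module
begin

lemma lsmult_zero_right:
  assumes "a \<in> carrier A" shows "a \<odot>\<^bsub>M\<^esub> \<zero>\<^bsub>M\<^esub> = \<zero>\<^bsub>M\<^esub>"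
proof -
  have "a \<odot>\<^bsub>M\<^esub> \<zero>\<^bsub>M\<^esub> \<oplus>\<^bsub>M\<^esub> a \<odot>\<^bsub>M\<^esub> \<zero>\<^bsub>M\<^esub> = a \<odot>\<^bsub>M\<^esub> \<zero>\<^bsub>M\<^esub>"
    using lsmult_r_distr[of a "\<zero>\<^bsub>M\<^esub>" "\<zero>\<^bsub>M\<^esub>"] assms by simp
  then show ?thesis
    using M.add.l_cancel_one[of "a \<odot>\<^bsub>M\<^esub> \<zero>\<^bsub>M\<^esub>" "a \<odot>\<^bsub>M\<^esub> \<zero>\<^bsub>M\<^esub>"] assms lsmult_closed by simp
qed

lemma lsmult_zero_left:
  assumes "x \<in> carrier M" shows "\<zero>\<^bsub>A\<^esub> \<odot>\<^bsub>M\<^esub> x = \<zero>\<^bsub>M\<^esub>"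
proof -
  have "\<zero>\<^bsub>A\<^esub> \<odot>\<^bsub>M\<^esub> x \<oplus>\<^bsub>M\<^esub> \<zero>\<^bsub>A\<^esub> \<odot>\<^bsub>M\<^esub> x = \<zero>\<^bsub>A\<^esub> \<odot>\<^bsub>M\<^esub> x"
    using lsmult_l_distr[of "\<zero>\<^bsub>A\<^esub>" "\<zero>\<^bsub>A\<^esub>" x] assms by simp
  then show ?thesis
    using M.add.l_cancel_one[of "\<zero>\<^bsub>A\<^esub> \<odot>\<^bsub>M\<^esub> x" "\<zero>\<^bsub>A\<^esub> \<odot>\<^bsub>M\<^esub> x"] assms lsmult_closed by simp
qed

lemma lsmult_minus:
  assumes "a \<in> carrier A" "x \<in> carrier M" shows "a \<odot>\<^bsub>M\<^esub> (\<ominus>\<^bsub>M\<^esub> x) = \<ominus>\<^bsub>M\<^esub> (a \<odot>\<^bsub>M\<^esub> x)"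
proof -
  have "a \<odot>\<^bsub>M\<^esub> (\<ominus>\<^bsub>M\<^esub> x) \<oplus>\<^bsub>M\<^esub> a \<odot>\<^bsub>M\<^esub> x = \<zero>\<^bsub>M\<^esub>"
    using lsmult_r_distr[of a "\<ominus>\<^bsub>M\<^esub> x" x] assms by (simp add: M.l_neg lsmult_zero_right)
  then show ?thesis
    using M.minus_equality assms lsmult_closed by simp
qed

end

context
  fixes A :: "('a, 'k) ring_scheme" and M :: "('a, 'b, 'l) module_scheme"
    and N :: "('a, 'c, 'm) module_scheme"
  assumes MN: "left_module A M" "left_module A N"
begin

interpretation M: left_module A M by (fact MN)
interpretation N: left_module A N by (fact MN)

lemma linear_maps_zero:
  assumes "f \<in> linear_maps A M N" shows "f \<zero>\<^bsub>M\<^esub> = \<zero>\<^bsub>N\<^esub>"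
  using linear_mapsD(3)[OF assms, of "\<zero>\<^bsub>A\<^esub>" "\<zero>\<^bsub>M\<^esub>"] linear_mapsD(1)[OF assms, of "\<zero>\<^bsub>M\<^esub>"]
  by (simp add: M.lsmult_zero_left N.lsmult_zero_left)

lemma linear_maps_minus:
  assumes "f \<in> linear_maps A M N" "x \<in> carrier M" shows "f (\<ominus>\<^bsub>M\<^esub> x) = \<ominus>\<^bsub>N\<^esub> f x"
proof -
  have "f (\<ominus>\<^bsub>M\<^esub> x) \<oplus>\<^bsub>N\<^esub> f x = \<zero>\<^bsub>N\<^esub>"
    using linear_mapsD(2)[OF assms(1), of "\<ominus>\<^bsub>M\<^esub> x" x] assms(2) linear_maps_zero[OF assms(1)]
    by (simp add: M.l_neg)
  then show ?thesis
    using N.minus_equality assms(2) linear_mapsD(1)[OF assms(1)] by simp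
qed

lemma linear_maps_diff:
  assumes "f \<in> linear_maps A M N" "x \<in> carrier M" "y \<in> carrier M"
  shows "f (x \<ominus>\<^bsub>M\<^esub> y) = f x \<ominus>\<^bsub>N\<^esub> f y"
  using assms by (simp add: M.minus_eq N.minus_eq linear_mapsD linear_maps_minus)

lemma linear_maps_add_fun:
  assumes "f \<in> linear_maps A M N" "g \<in> linear_maps A M N"
  shows "(\<lambda>x. f x \<oplus>\<^bsub>N\<^esub> g x) \<in> linear_maps A M N"
  using assms
  by (intro linear_mapsI) (simp_all add: linear_mapsD N.lsmult_r_distr N.a_ac)

lemma linear_maps_diff_fun:
  assumes "f \<in> linear_maps A M N" "g \<in> linear_maps A M N"
  shows "(\<lambda>x. f x \<ominus>\<^bsub>N\<^esub> g x) \<in> linear_maps A M N"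
  using assms
  by (intro linear_mapsI)
    (simp_all add: linear_mapsD N.lsmult_r_distr N.lsmult_minus N.minus_eq N.minus_add N.a_ac)

end

text \<open>Surjectivity writes every element of \<open>N\<close> as a value of \<open>f\<close>,
  and linearity then carries each module axiom over from \<open>M\<close>.\<close>

lemma left_module_linear_image:
  assumes M: "left_module A M" and N: "abelian_group N" and f: "f \<in> linear_maps A M N"
    and surj: "f ` carrier M = carrier N"
  shows "left_module A N"
proof -
  interpret M: left_module A M by (rule M)
  have E: "\<exists>y \<in> carrier M. x = f y" if "x \<in> carrier N" for x
    using that surj by blast
  show ?thesis
  proof (intro left_module.intro left_module_axioms.intro M.A.ring_axioms N)
    show "a \<odot>\<^bsub>N\<^esub> x \<in> carrier N" if "a \<in> carrier A" "x \<in> carrier N" for a x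
      using E[OF that(2)] that(1) linear_mapsD(3)[OF f] linear_mapsD(1)[OF f] M.lsmult_closed by metis
    show "(a \<oplus>\<^bsub>A\<^esub> b) \<odot>\<^bsub>N\<^esub> x = a \<odot>\<^bsub>N\<^esub> x \<oplus>\<^bsub>N\<^esub> b \<odot>\<^bsub>N\<^esub> x"
      if ab: "a \<in> carrier A" "b \<in> carrier A" and x: "x \<in> carrier N" for a b x
    proof -
      obtain y where y: "y \<in> carrier M" "x = f y" using E[OF x] by blast
      show ?thesis
        using linear_mapsD(2)[OF f, of "a \<odot>\<^bsub>M\<^esub> y" "b \<odot>\<^bsub>M\<^esub> y"] linear_mapsD(3)[OF f _ y(1)] ab y
        by (simp add: M.lsmult_closed flip: M.lsmult_l_distr)
    qed
    show "a \<odot>\<^bsub>N\<^esub> (x \<oplus>\<^bsub>N\<^esub> x') = a \<odot>\<^bsub>N\<^esub> x \<oplus>\<^bsub>N\<^esub> a \<odot>\<^bsub>N\<^esub> x'"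
      if a: "a \<in> carrier A" and x: "x \<in> carrier N" "x' \<in> carrier N" for a x x'
    proof -
      obtain y y' where y: "y \<in> carrier M" "x = f y" "y' \<in> carrier M" "x' = f y'"
        using E[OF x(1)] E[OF x(2)] by blast
      have "a \<odot>\<^bsub>N\<^esub> (x \<oplus>\<^bsub>N\<^esub> x') = f (a \<odot>\<^bsub>M\<^esub> (y \<oplus>\<^bsub>M\<^esub> y'))"
        using a y by (simp add: linear_mapsD[OF f])
      also have "\<dots> = a \<odot>\<^bsub>N\<^esub> x \<oplus>\<^bsub>N\<^esub> a \<odot>\<^bsub>N\<^esub> x'"
        using a y by (simp add: M.lsmult_r_distr M.lsmult_closed linear_mapsD[OF f])
      finally show ?thesis .
    qed
    show "(a \<otimes>\<^bsub>A\<^esub> b) \<odot>\<^bsub>N\<^esub> x = a \<odot>\<^bsub>N\<^esub> (b \<odot>\<^bsub>N\<^esub> x)"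
      if ab: "a \<in> carrier A" "b \<in> carrier A" and x: "x \<in> carrier N" for a b x
    proof -
      obtain y where y: "y \<in> carrier M" "x = f y" using E[OF x] by blast
      have "(a \<otimes>\<^bsub>A\<^esub> b) \<odot>\<^bsub>N\<^esub> x = f ((a \<otimes>\<^bsub>A\<^esub> b) \<odot>\<^bsub>M\<^esub> y)"
        using ab y by (simp add: linear_mapsD[OF f])
      also have "\<dots> = a \<odot>\<^bsub>N\<^esub> (b \<odot>\<^bsub>N\<^esub> x)"
        using ab y by (simp add: M.lsmult_assoc M.lsmult_closed linear_mapsD[OF f])
      finally show ?thesis .
    qed
    show "\<one>\<^bsub>A\<^esub> \<odot>\<^bsub>N\<^esub> x = x" if x: "x \<in> carrier N" for x
    proof -
      obtain y where y: "y \<in> carrier M" "x = f y" using E[OF x] by blast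
      then show ?thesis using linear_mapsD(3)[OF f M.A.one_closed y(1)] by (simp add: M.lsmult_one)
    qed
  qed
qed

section \<open>Free modules and the lifting property of projective modules\<close>

definition free_basis :: "('a, 'k) ring_scheme \<Rightarrow> 'x set \<Rightarrow> 'x \<Rightarrow> 'x \<Rightarrow> 'a"
  where "free_basis A X x = (\<lambda>y\<in>X. if y = x then \<one>\<^bsub>A\<^esub> else \<zero>\<^bsub>A\<^esub>)"

lemma free_basis_closed:
  assumes "ring A" "x \<in> X" shows "free_basis A X x \<in> carrier (free_module A X)"
proof -
  interpret ring A by fact
  have "finite {y \<in> X. free_basis A X x y \<noteq> \<zero>\<^bsub>A\<^esub>}"
    by (rule finite_subset[of _ "{x}"]) (auto simp: free_basis_def)
  then show ?thesis by (auto simp: free_module_def free_basis_def)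
qed

text \<open>Elements of the free module have finite support, so induction on a finite set containing
  the support suffices: one coordinate is split off as a multiple of a basis element, and the
  induction hypothesis covers the rest.\<close>

lemma free_module_maps_eq:
  assumes "left_module A N"
    and f: "f \<in> linear_maps A (free_module A X) N" and g: "g \<in> linear_maps A (free_module A X) N"
    and fg: "\<And>x. x \<in> X \<Longrightarrow> f (free_basis A X x) = g (free_basis A X x)"
    and u: "u \<in> carrier (free_module A X)"
  shows "f u = g u"
proof -
  interpret N: left_module A N by fact
  let ?F = "free_module A X"
  have "\<forall>u\<in>carrier ?F. {x \<in> X. u x \<noteq> \<zero>\<^bsub>A\<^esub>} \<subseteq> Y \<longrightarrow> f u = g u" if "finite Y" for Y
    using that
  proof (induction Y)
    case empty
    show ?case
    proof (intro ballI impI)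
      fix u assume u: "u \<in> carrier ?F" "{x \<in> X. u x \<noteq> \<zero>\<^bsub>A\<^esub>} \<subseteq> {}"
      \<comment> \<open>Writing the zero vector as a multiple by the scalar zero shows that both
        maps send it to zero, without first proving that \<open>free_module A X\<close> is a
        module.\<close>
      then have "u = \<zero>\<^bsub>A\<^esub> \<odot>\<^bsub>?F\<^esub> u"
        by (auto simp: free_module_def PiE_iff fun_eq_iff extensional_def restrict_def)
      then show "f u = g u"
        using linear_mapsD(3)[OF f, of "\<zero>\<^bsub>A\<^esub>" u] linear_mapsD(3)[OF g, of "\<zero>\<^bsub>A\<^esub>" u] u(1)
          linear_mapsD(1)[OF f u(1)] linear_mapsD(1)[OF g u(1)] by (simp add: N.lsmult_zero_left)
    qed
  next
    case (insert x Y)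
    show ?case
    proof (intro ballI impI)
      fix u assume u: "u \<in> carrier ?F" "{x \<in> X. u x \<noteq> \<zero>\<^bsub>A\<^esub>} \<subseteq> insert x Y"
      show "f u = g u"
      proof (cases "x \<in> X")
        case False
        then show ?thesis using insert.IH u by blast
      next
        case True
        define v where "v = (\<lambda>y\<in>X. if y = x then \<zero>\<^bsub>A\<^esub> else u y)"
        have "finite {y \<in> X. v y \<noteq> \<zero>\<^bsub>A\<^esub>}"
          by (rule finite_subset[of _ "{y \<in> X. u y \<noteq> \<zero>\<^bsub>A\<^esub>}"])
            (use u in \<open>auto simp: v_def free_module_def\<close>)
        then have v: "v \<in> carrier ?F" using u by (auto simp: v_def free_module_def)
        have b: "free_basis A X x \<in> carrier ?F" by (rule free_basis_closed[OF N.A.ring_axioms True])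
        have ux: "u x \<in> carrier A" using u True by (auto simp: free_module_def)
        have uv: "u = v \<oplus>\<^bsub>?F\<^esub> (u x \<odot>\<^bsub>?F\<^esub> free_basis A X x)"
          using u ux by (auto simp: free_module_def v_def free_basis_def fun_eq_iff PiE_iff
              extensional_def Pi_iff)
        have "u x \<odot>\<^bsub>?F\<^esub> free_basis A X x \<in> carrier ?F"
        proof -
          have "finite {y \<in> X. (u x \<odot>\<^bsub>?F\<^esub> free_basis A X x) y \<noteq> \<zero>\<^bsub>A\<^esub>}"
            by (rule finite_subset[of _ "{x}"]) (use ux in \<open>auto simp: free_basis_def free_module_def\<close>)
          then show ?thesis using ux by (auto simp: free_module_def free_basis_def)
        qed
        moreover have "f v = g v"
        proof -
          have "{y \<in> X. v y \<noteq> \<zero>\<^bsub>A\<^esub>} \<subseteq> Y" using u by (auto simp: v_def)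
          then show ?thesis using v insert.IH by blast
        qed
        ultimately have "f (v \<oplus>\<^bsub>?F\<^esub> (u x \<odot>\<^bsub>?F\<^esub> free_basis A X x)) =
            g (v \<oplus>\<^bsub>?F\<^esub> (u x \<odot>\<^bsub>?F\<^esub> free_basis A X x))"
          using v b ux fg[OF True] by (simp add: linear_mapsD[OF f] linear_mapsD[OF g])
        then show ?thesis using uv by simp
      qed
    qed
  qed
  then show ?thesis using u by (auto simp: free_module_def)
qed

lemma (in left_module) finsum_superset:
  assumes "finite Y" "Z \<subseteq> Y" "m \<in> Y \<rightarrow> carrier M" "\<And>x. x \<in> Y - Z \<Longrightarrow> m x = \<zero>\<^bsub>M\<^esub>"
  shows "finsum M m Z = finsum M m Y"
  using assms by (intro M.add.finprod_mono_neutral_cong_left) auto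

lemma (in left_module) lsmult_finsum:
  assumes "finite Y" "m \<in> Y \<rightarrow> carrier M" "a \<in> carrier A"
  shows "a \<odot>\<^bsub>M\<^esub> finsum M m Y = (\<Oplus>\<^bsub>M\<^esub>x\<in>Y. a \<odot>\<^bsub>M\<^esub> m x)"
  using assms
proof (induction Y)
  case (insert x Y)
  then have "m \<in> Y \<rightarrow> carrier M" by auto
  then show ?case
    using insert by (subst M.finsum_insert; (subst M.finsum_insert)?)
      (auto simp: lsmult_closed lsmult_r_distr Pi_iff)
qed (simp add: lsmult_zero_right)

lemma free_module_lift:
  assumes "left_module A N" and m: "m \<in> X \<rightarrow> carrier N"
  obtains H where "H \<in> linear_maps A (free_module A X) N"
    and "\<And>x. x \<in> X \<Longrightarrow> H (free_basis A X x) = m x"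
proof -
  interpret N: left_module A N by fact
  let ?F = "free_module A X"
  define S where "S u = {x \<in> X. u x \<noteq> \<zero>\<^bsub>A\<^esub>}" for u
  define H where "H u = (\<Oplus>\<^bsub>N\<^esub>x\<in>S u. u x \<odot>\<^bsub>N\<^esub> m x)" for u
  have mem: "u x \<in> carrier A" if "u \<in> carrier ?F" "x \<in> X" for u x
    using that by (auto simp: free_module_def)
  have trm: "u x \<odot>\<^bsub>N\<^esub> m x \<in> carrier N" if "u \<in> carrier ?F" "x \<in> X" for u x
    using that m by (auto intro!: N.lsmult_closed mem)
  have fin: "finite (S u)" if "u \<in> carrier ?F" for u
    using that by (auto simp: free_module_def S_def)
  \<comment> \<open>Supports change under addition and scaling; sums over a common finite superset
    of the supports can be compared.\<close>
  have H: "H u = (\<Oplus>\<^bsub>N\<^esub>x\<in>Y. u x \<odot>\<^bsub>N\<^esub> m x)"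
    if u: "u \<in> carrier ?F" and Y: "finite Y" "S u \<subseteq> Y" "Y \<subseteq> X" for u Y
    unfolding H_def
  proof (rule N.finsum_superset)
    show "u x \<odot>\<^bsub>N\<^esub> m x = \<zero>\<^bsub>N\<^esub>" if x: "x \<in> Y - S u" for x
    proof -
      have "x \<in> X" "u x = \<zero>\<^bsub>A\<^esub>" using x Y by (auto simp: S_def)
      then show ?thesis using m N.lsmult_zero_left by auto
    qed
  qed (use u Y in \<open>auto intro!: trm\<close>)
  have "H \<in> linear_maps A ?F N"
  proof (rule linear_mapsI)
    fix u assume u: "u \<in> carrier ?F"
    show "H u \<in> carrier N"
      unfolding H_def by (intro N.M.finsum_closed) (use u in \<open>auto simp: S_def intro!: trm\<close>)
  next
    fix u v assume u: "u \<in> carrier ?F" and v: "v \<in> carrier ?F"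
    let ?Y = "S u \<union> S v"
    have Y: "finite ?Y" "?Y \<subseteq> X" using fin u v by (auto simp: S_def)
    have w: "(u \<oplus>\<^bsub>?F\<^esub> v) x = u x \<oplus>\<^bsub>A\<^esub> v x" if "x \<in> X" for x
      using that by (simp add: free_module_def)
    have SY: "S (u \<oplus>\<^bsub>?F\<^esub> v) \<subseteq> ?Y"
      using mem[OF u] mem[OF v] by (auto simp: S_def w)
    have uv: "u \<oplus>\<^bsub>?F\<^esub> v \<in> carrier ?F"
      using mem[OF u] mem[OF v] finite_subset[OF SY Y(1)] unfolding S_def
      by (auto simp: free_module_def)
    have "H (u \<oplus>\<^bsub>?F\<^esub> v) = (\<Oplus>\<^bsub>N\<^esub>x\<in>?Y. (u \<oplus>\<^bsub>?F\<^esub> v) x \<odot>\<^bsub>N\<^esub> m x)"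
      by (rule H[OF uv Y(1) SY Y(2)])
    also have "\<dots> = (\<Oplus>\<^bsub>N\<^esub>x\<in>?Y. u x \<odot>\<^bsub>N\<^esub> m x \<oplus>\<^bsub>N\<^esub> v x \<odot>\<^bsub>N\<^esub> m x)"
    proof (rule N.M.finsum_cong')
      fix x assume "x \<in> ?Y"
      then have "x \<in> X" using Y by auto
      then show "(u \<oplus>\<^bsub>?F\<^esub> v) x \<odot>\<^bsub>N\<^esub> m x = u x \<odot>\<^bsub>N\<^esub> m x \<oplus>\<^bsub>N\<^esub> v x \<odot>\<^bsub>N\<^esub> m x"
        using N.lsmult_l_distr[of "u x" "v x" "m x"] m mem[OF u] mem[OF v] by (auto simp: w)
    qed (use trm[OF u] trm[OF v] Y in auto)
    also have "\<dots> = (\<Oplus>\<^bsub>N\<^esub>x\<in>?Y. u x \<odot>\<^bsub>N\<^esub> m x) \<oplus>\<^bsub>N\<^esub> (\<Oplus>\<^bsub>N\<^esub>x\<in>?Y. v x \<odot>\<^bsub>N\<^esub> m x)"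
      by (rule N.M.finsum_addf) (use trm[OF u] trm[OF v] Y in auto)
    finally show "H (u \<oplus>\<^bsub>?F\<^esub> v) = H u \<oplus>\<^bsub>N\<^esub> H v"
      using H[OF u Y(1) _ Y(2)] H[OF v Y(1) _ Y(2)] by auto
  next
    fix a u assume a: "a \<in> carrier A" and u: "u \<in> carrier ?F"
    have w: "(a \<odot>\<^bsub>?F\<^esub> u) x = a \<otimes>\<^bsub>A\<^esub> u x" if "x \<in> X" for x
      using that by (simp add: free_module_def)
    have SY: "S (a \<odot>\<^bsub>?F\<^esub> u) \<subseteq> S u"
      using a by (auto simp: S_def w)
    have au: "a \<odot>\<^bsub>?F\<^esub> u \<in> carrier ?F"
      using mem[OF u] finite_subset[OF SY fin[OF u]] a unfolding S_def
      by (auto simp: free_module_def)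
    have "H (a \<odot>\<^bsub>?F\<^esub> u) = (\<Oplus>\<^bsub>N\<^esub>x\<in>S u. (a \<odot>\<^bsub>?F\<^esub> u) x \<odot>\<^bsub>N\<^esub> m x)"
      by (rule H[OF au fin[OF u] SY]) (auto simp: S_def)
    also have "\<dots> = (\<Oplus>\<^bsub>N\<^esub>x\<in>S u. a \<odot>\<^bsub>N\<^esub> (u x \<odot>\<^bsub>N\<^esub> m x))"
    proof (rule N.M.finsum_cong')
      fix x assume "x \<in> S u"
      then have "x \<in> X" by (auto simp: S_def)
      then show "(a \<odot>\<^bsub>?F\<^esub> u) x \<odot>\<^bsub>N\<^esub> m x = a \<odot>\<^bsub>N\<^esub> (u x \<odot>\<^bsub>N\<^esub> m x)"
        using N.lsmult_assoc[of a "u x" "m x"] m mem[OF u] a by (auto simp: w)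
    qed (use trm[OF u] a in \<open>auto simp: S_def N.lsmult_closed\<close>)
    also have "\<dots> = a \<odot>\<^bsub>N\<^esub> H u"
      unfolding H_def
      by (rule N.lsmult_finsum[symmetric]) (use trm[OF u] fin[OF u] a in \<open>auto simp: S_def\<close>)
    finally show "H (a \<odot>\<^bsub>?F\<^esub> u) = a \<odot>\<^bsub>N\<^esub> H u" .
  qed
  moreover have "H (free_basis A X x) = m x" if x: "x \<in> X" for x
  proof -
    have mx: "m x \<in> carrier N" using m x by auto
    have "H (free_basis A X x) = (\<Oplus>\<^bsub>N\<^esub>y\<in>{x}. free_basis A X x y \<odot>\<^bsub>N\<^esub> m y)"
      using x by (intro H free_basis_closed N.A.ring_axioms) (auto simp: S_def free_basis_def)
    also have "\<dots> = m x"
      using x N.lsmult_one[OF mx] mx by (subst N.M.finsum_insert) (auto simp: free_basis_def)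
    finally show ?thesis .
  qed
  ultimately show thesis by (rule that)
qed

text \<open>For each basis element a preimage under \<open>q\<close> is chosen, the choice is
  extended linearly to the free module, and the result is restricted along the section
  \<open>s\<close>. The condition on images stands in for surjectivity of \<open>q\<close>, so that
  maps can be lifted along a differential of a complex.\<close>

lemma projective_lift:
  fixes P :: "('a, 'b) module"
  assumes P: "projective_module A P" and M: "left_module A M" and N: "left_module A N"
    and q: "q \<in> linear_maps A M N" and f: "f \<in> linear_maps A P N"
    and fq: "f ` carrier P \<subseteq> q ` carrier M"
  obtains h where "h \<in> linear_maps A P M" and "\<And>p. p \<in> carrier P \<Longrightarrow> q (h p) = f p"
proof -
  interpret P: left_module A P using P by (simp add: projective_module_def)
  obtain X :: "'b set" and s r where s: "s \<in> linear_maps A P (free_module A X)"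
    and r: "r \<in> linear_maps A (free_module A X) P" and rs: "\<And>p. p \<in> carrier P \<Longrightarrow> r (s p) = p"
    using P unfolding projective_module_def by (elim conjE exE) blast
  have b: "free_basis A X x \<in> carrier (free_module A X)" if "x \<in> X" for x
    by (rule free_basis_closed[OF P.A.ring_axioms that])
  have "\<forall>x\<in>X. \<exists>m\<in>carrier M. q m = f (r (free_basis A X x))"
    using fq linear_mapsD(1)[OF r b] by (metis image_iff image_subset_iff)
  then obtain m where m: "\<And>x. x \<in> X \<Longrightarrow> m x \<in> carrier M \<and> q (m x) = f (r (free_basis A X x))"
    by metis
  then have "m \<in> X \<rightarrow> carrier M" by auto
  then obtain H where H: "H \<in> linear_maps A (free_module A X) M"
      "\<And>x. x \<in> X \<Longrightarrow> H (free_basis A X x) = m x"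
    using free_module_lift[OF M] by blast
  have "q (H (s p)) = f p" if p: "p \<in> carrier P" for p
  proof -
    have "q (H (s p)) = f (r (s p))"
      by (rule free_module_maps_eq[OF N linear_maps_comp[OF H(1) q] linear_maps_comp[OF r f]])
        (use H m p linear_mapsD(1)[OF s] in auto)
    then show ?thesis using rs p by simp
  qed
  then show thesis using that[OF linear_maps_comp[OF s H(1)]] by blast
qed

section \<open>Comparison of complexes\<close>

text \<open>On boundaries, a null homotopy \<open>h\<close> of \<open>t\<close> satisfies \<open>e (h (d c)) = t (d c)\<close>; the
  inductive step needs no more than this, so the homotopy is not built by dependent choice.\<close>

locale homotopy_setup =
  fixes A :: "('a, 'k) ring_scheme" and P :: "nat \<Rightarrow> ('a, 'c) module" and d :: "nat \<Rightarrow> 'c \<Rightarrow> 'c"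
    and Q :: "nat \<Rightarrow> ('a, 't) module" and e :: "nat \<Rightarrow> 't \<Rightarrow> 't" and t :: "nat \<Rightarrow> 'c \<Rightarrow> 't" and n :: nat
  assumes P: "projective_module A (P i)"
    and d: "d i \<in> linear_maps A (P (Suc i)) (P i)"
    and dd: "c \<in> carrier (P (Suc (Suc i))) \<Longrightarrow> d i (d (Suc i) c) = \<zero>\<^bsub>P i\<^esub>"
    and Q: "left_module A (Q i)"
    and e: "e i \<in> linear_maps A (Q (Suc i)) (Q i)"
    and t: "t i \<in> linear_maps A (P i) (Q i)"
    and et: "c \<in> carrier (P (Suc i)) \<Longrightarrow> e i (t (Suc i) c) = t i (d i c)"
    and t0: "t 0 ` carrier (P 0) \<subseteq> e 0 ` carrier (Q (Suc 0))"
    and exact: "\<lbrakk>Suc i \<le> n; x \<in> carrier (Q (Suc i)); e i x = \<zero>\<^bsub>Q i\<^esub>\<rbrakk> \<Longrightarrow>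
      x \<in> e (Suc i) ` carrier (Q (Suc (Suc i)))"
begin

text \<open>By \<open>et\<close> and \<open>hd\<close> the difference of \<open>t (Suc i) c\<close>
  and \<open>h (d i c)\<close> is a cycle, hence a boundary by exactness, and projectivity of
  \<open>P (Suc i)\<close> lifts the difference along \<open>e (Suc i)\<close>.\<close>

lemma homotopy_step:
  assumes i: "Suc i \<le> n" and h: "h \<in> linear_maps A (P i) (Q (Suc i))"
    and hd: "\<And>c. c \<in> carrier (P (Suc i)) \<Longrightarrow> e i (h (d i c)) = t i (d i c)"
  obtains h' where "h' \<in> linear_maps A (P (Suc i)) (Q (Suc (Suc i)))"
    and "\<And>c. c \<in> carrier (P (Suc i)) \<Longrightarrow> e (Suc i) (h' c) = t (Suc i) c \<ominus>\<^bsub>Q (Suc i)\<^esub> h (d i c)"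
proof -
  have lmP: "left_module A (P j)" for j using P by (simp add: projective_module_def)
  interpret Qi: left_module A "Q i" by (rule Q)
  let ?f = "\<lambda>c. t (Suc i) c \<ominus>\<^bsub>Q (Suc i)\<^esub> h (d i c)"
  have f: "?f \<in> linear_maps A (P (Suc i)) (Q (Suc i))"
    by (rule linear_maps_diff_fun[OF lmP Q t linear_maps_comp[OF d h]])
  have "?f c \<in> e (Suc i) ` carrier (Q (Suc (Suc i)))" if c: "c \<in> carrier (P (Suc i))" for c
  proof (rule exact[OF i])
    show "?f c \<in> carrier (Q (Suc i))" using linear_mapsD(1)[OF f c] .
    have "e i (?f c) = e i (t (Suc i) c) \<ominus>\<^bsub>Q i\<^esub> e i (h (d i c))"
      using c linear_mapsD(1)[OF t] linear_mapsD(1)[OF h] linear_mapsD(1)[OF d]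
      by (intro linear_maps_diff[OF Q Q e]) auto
    also have "\<dots> = \<zero>\<^bsub>Q i\<^esub>"
      using c linear_mapsD(1)[OF t] linear_mapsD(1)[OF d] by (simp add: et hd Qi.M.r_neg Qi.minus_eq)
    finally show "e i (?f c) = \<zero>\<^bsub>Q i\<^esub>" .
  qed
  then show thesis
    using projective_lift[OF P Q Q e f] that by blast
qed

text \<open>In degree zero there is no correction term, so \<open>t 0\<close> itself is lifted along
  \<open>e 0\<close>.\<close>

lemma homotopy_zero:
  obtains h where "h \<in> linear_maps A (P 0) (Q (Suc 0))"
    and "\<And>c. c \<in> carrier (P 0) \<Longrightarrow> e 0 (h c) = t 0 c"
  using projective_lift[OF P Q Q e t t0] by blast

lemma homotopy_ex:
  assumes "i \<le> n"
  shows "\<exists>h \<in> linear_maps A (P i) (Q (Suc i)). \<forall>c \<in> carrier (P (Suc i)). e i (h (d i c)) = t i (d i c)"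
  using assms
proof (induction i)
  case 0
  then show ?case using homotopy_zero linear_mapsD(1)[OF d] by metis
next
  case (Suc i)
  interpret Qi: left_module A "Q (Suc i)" by (rule Q)
  from Suc obtain h where h: "h \<in> linear_maps A (P i) (Q (Suc i))"
    "\<And>c. c \<in> carrier (P (Suc i)) \<Longrightarrow> e i (h (d i c)) = t i (d i c)" by auto
  obtain h' where h': "h' \<in> linear_maps A (P (Suc i)) (Q (Suc (Suc i)))"
    "\<And>c. c \<in> carrier (P (Suc i)) \<Longrightarrow> e (Suc i) (h' c) = t (Suc i) c \<ominus>\<^bsub>Q (Suc i)\<^esub> h (d i c)"
    using homotopy_step[OF Suc.prems h] by blast
  have "left_module A (P i)" using P by (simp add: projective_module_def)
  \<comment> \<open>On a boundary the correction term is \<open>h (d i (d (Suc i) c))\<close>, which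
    vanishes because consecutive differentials compose to zero.\<close>
  from linear_maps_zero[OF this Q h(1)]
  have "e (Suc i) (h' (d (Suc i) c)) = t (Suc i) (d (Suc i) c)" if "c \<in> carrier (P (Suc (Suc i)))" for c
    using that linear_mapsD(1)[OF d] linear_mapsD(1)[OF t]
    by (simp add: h'(2) dd Qi.minus_eq)
  then show ?case using h'(1) by blast
qed

text \<open>The full homotopy identity, on all of \<open>P (Suc i)\<close> and not just on
  boundaries; two consecutive maps of the homotopy enter.\<close>

lemma homotopy_Suc:
  assumes "Suc i \<le> n"
  obtains h h' where "h \<in> linear_maps A (P i) (Q (Suc i))"
    and "h' \<in> linear_maps A (P (Suc i)) (Q (Suc (Suc i)))"
    and "\<And>c. c \<in> carrier (P (Suc i)) \<Longrightarrow> t (Suc i) c = e (Suc i) (h' c) \<oplus>\<^bsub>Q (Suc i)\<^esub> h (d i c)"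
proof -
  interpret Qi: left_module A "Q (Suc i)" by (rule Q)
  from assms homotopy_ex[of i] obtain h where h: "h \<in> linear_maps A (P i) (Q (Suc i))"
    "\<And>c. c \<in> carrier (P (Suc i)) \<Longrightarrow> e i (h (d i c)) = t i (d i c)" by auto
  obtain h' where h': "h' \<in> linear_maps A (P (Suc i)) (Q (Suc (Suc i)))"
    "\<And>c. c \<in> carrier (P (Suc i)) \<Longrightarrow> e (Suc i) (h' c) = t (Suc i) c \<ominus>\<^bsub>Q (Suc i)\<^esub> h (d i c)"
    using homotopy_step[OF assms h] by blast
  have "t (Suc i) c = e (Suc i) (h' c) \<oplus>\<^bsub>Q (Suc i)\<^esub> h (d i c)" if c: "c \<in> carrier (P (Suc i))" for c
    using h'(2)[OF c] linear_mapsD(1)[OF t c] linear_mapsD(1)[OF h(1)] linear_mapsD(1)[OF d c]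
    by (simp add: Qi.minus_eq Qi.a_assoc Qi.l_neg)
  then show thesis using that h h' by blast
qed

end

section \<open>Projective resolutions and chain maps between them\<close>

lemma projective_resolutionD:
  assumes "projective_resolution A B C d \<epsilon>"
  shows "projective_module A (C i)" "left_module A (C i)"
    "d i \<in> linear_maps A (C (Suc i)) (C i)" "\<epsilon> \<in> linear_maps A (C 0) B"
    "\<epsilon> ` carrier (C 0) = carrier B"
    "d 0 ` carrier (C (Suc 0)) = {c \<in> carrier (C 0). \<epsilon> c = \<zero>\<^bsub>B\<^esub>}"
    "d (Suc i) ` carrier (C (Suc (Suc i))) = {c \<in> carrier (C (Suc i)). d i c = \<zero>\<^bsub>C i\<^esub>}"
    "c \<in> carrier (C (Suc (Suc i))) \<Longrightarrow> d i (d (Suc i) c) = \<zero>\<^bsub>C i\<^esub>"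
    "b \<in> carrier (C (Suc 0)) \<Longrightarrow> \<epsilon> (d 0 b) = \<zero>\<^bsub>B\<^esub>"
proof -
  note * = assms[unfolded projective_resolution_def]
  show "projective_module A (C i)" "d i \<in> linear_maps A (C (Suc i)) (C i)"
    "\<epsilon> \<in> linear_maps A (C 0) B" "\<epsilon> ` carrier (C 0) = carrier B"
    and 6: "d 0 ` carrier (C (Suc 0)) = {c \<in> carrier (C 0). \<epsilon> c = \<zero>\<^bsub>B\<^esub>}"
    and ex: "d (Suc i) ` carrier (C (Suc (Suc i))) = {c \<in> carrier (C (Suc i)). d i c = \<zero>\<^bsub>C i\<^esub>}"
    using * by simp_all
  then show "left_module A (C i)" by (simp add: projective_module_def)
  show "d i (d (Suc i) c) = \<zero>\<^bsub>C i\<^esub>" if "c \<in> carrier (C (Suc (Suc i)))"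
    using ex that by blast
  show "\<epsilon> (d 0 b) = \<zero>\<^bsub>B\<^esub>" if "b \<in> carrier (C (Suc 0))"
    using 6 that by blast
qed

text \<open>The second conjunct of the predicate passed to the dependent choice says that the map
  sends boundaries to boundaries, so that the next one can be lifted.\<close>

lemma resolution_chain_map:
  assumes C: "projective_resolution A B C dC \<epsilon>C" and D: "projective_resolution A B D dD \<epsilon>D"
    and B: "left_module A B"
  obtains u where "\<And>i. u i \<in> linear_maps A (C i) (D i)"
    and "\<And>i c. c \<in> carrier (C (Suc i)) \<Longrightarrow> dD i (u (Suc i) c) = u i (dC i c)"
    and "\<And>c. c \<in> carrier (C 0) \<Longrightarrow> \<epsilon>D (u 0 c) = \<epsilon>C c"
proof -
  note C' = projective_resolutionD[OF C] and D' = projective_resolutionD[OF D]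
  define L where "L i x \<longleftrightarrow> x \<in> linear_maps A (C i) (D i) \<and>
    (\<forall>c\<in>carrier (C (Suc i)). x (dC i c) \<in> dD i ` carrier (D (Suc i))) \<and>
    (i = 0 \<longrightarrow> (\<forall>c\<in>carrier (C 0). \<epsilon>D (x c) = \<epsilon>C c))" for i x
  have "\<exists>u. \<forall>i. L i (u i) \<and> (\<forall>c \<in> carrier (C (Suc i)). dD i (u (Suc i) c) = u i (dC i c))"
  proof (rule dependent_nat_choice)
    have "\<epsilon>C ` carrier (C 0) \<subseteq> \<epsilon>D ` carrier (D 0)" using C'(5) D'(5) by simp
    then obtain x where x: "x \<in> linear_maps A (C 0) (D 0)"
      "\<And>c. c \<in> carrier (C 0) \<Longrightarrow> \<epsilon>D (x c) = \<epsilon>C c"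
      using projective_lift[OF C'(1) D'(2) B D'(4) C'(4)] by blast
    \<comment> \<open>Since \<open>\<epsilon>D (x (dC 0 c)) = \<epsilon>C (dC 0 c) = 0\<close>,
      exactness of \<open>D\<close> in degree zero applies.\<close>
    have "x (dC 0 c) \<in> dD 0 ` carrier (D (Suc 0))" if "c \<in> carrier (C (Suc 0))" for c
      unfolding D'(6) using x that linear_mapsD(1)[OF C'(3)] linear_mapsD(1)[OF x(1)] C'(9) by simp
    then show "\<exists>x. L 0 x" using x unfolding L_def by blast
  next
    fix x i assume "L i x"
    then have x: "x \<in> linear_maps A (C i) (D i)"
      "\<And>c. c \<in> carrier (C (Suc i)) \<Longrightarrow> x (dC i c) \<in> dD i ` carrier (D (Suc i))" by (auto simp: L_def)
    have "(\<lambda>c. x (dC i c)) ` carrier (C (Suc i)) \<subseteq> dD i ` carrier (D (Suc i))" using x(2) by auto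
    then obtain y where y: "y \<in> linear_maps A (C (Suc i)) (D (Suc i))"
      "\<And>c. c \<in> carrier (C (Suc i)) \<Longrightarrow> dD i (y c) = x (dC i c)"
      using projective_lift[OF C'(1) D'(2) D'(2) D'(3) linear_maps_comp[OF C'(3) x(1)]] by blast
    \<comment> \<open>Here
      \<open>dD i (y (dC (Suc i) c)) = x (dC i (dC (Suc i) c)) = x 0 = 0\<close>, so exactness of
      \<open>D\<close> in degree \<open>Suc i\<close> applies.\<close>
    have "y (dC (Suc i) c) \<in> dD (Suc i) ` carrier (D (Suc (Suc i)))"
      if "c \<in> carrier (C (Suc (Suc i)))" for c
      unfolding D'(7)
      using y that linear_mapsD(1)[OF C'(3)] linear_mapsD(1)[OF y(1)] C'(8)
        linear_maps_zero[OF C'(2) D'(2) x(1)] by simp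
    then show "\<exists>y. L (Suc i) y \<and> (\<forall>c\<in>carrier (C (Suc i)). dD i (y c) = x (dC i c))"
      using y unfolding L_def by blast
  qed
  then obtain u where L: "\<And>i. L i (u i)"
    and u: "\<And>i c. c \<in> carrier (C (Suc i)) \<Longrightarrow> dD i (u (Suc i) c) = u i (dC i c)" by blast
  show thesis
  proof (rule that[OF _ u])
    show "u i \<in> linear_maps A (C i) (D i)" for i using L[of i] by (simp add: L_def)
    show "\<epsilon>D (u 0 c) = \<epsilon>C c" if "c \<in> carrier (C 0)" for c
      using L[of 0] that by (simp add: L_def)
  qed
qed

section \<open>Tensor products\<close>

definition tensor_elem ::
  "('a, 'k) ring_scheme \<Rightarrow> ('a, 'b, 'l) right_module_scheme \<Rightarrow> ('a, 'c, 'm) module_scheme \<Rightarrow>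
   'b \<Rightarrow> 'c \<Rightarrow> ('b \<times> 'c \<Rightarrow>\<^sub>0 int) set"
  where "tensor_elem A M N x y =
    tensor_subgroup A M N #>\<^bsub>free_Abelian_group (carrier M \<times> carrier N)\<^esub> frag_of (x, y)"

text \<open>\<open>frag_induction\<close> builds every element from generators by taking
  differences, and homomorphisms respect these.\<close>

lemma free_Abelian_group_hom_eq:
  assumes "group H" "h \<in> hom (free_Abelian_group S) H" "h' \<in> hom (free_Abelian_group S) H"
    and eq: "\<And>s. s \<in> S \<Longrightarrow> h (frag_of s) = h' (frag_of s)" and p: "Poly_Mapping.keys p \<subseteq> S"
  shows "h p = h' p"
proof -
  interpret h: group_hom "free_Abelian_group S" H h
    using assms by (simp add: group_hom_def group_hom_axioms_def)
  interpret h': group_hom "free_Abelian_group S" H h'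
    using assms by (simp add: group_hom_def group_hom_axioms_def)
  \<comment> \<open>The bound on the keys is carried through the induction because the homomorphism
    laws apply only inside the carrier.\<close>
  have "Poly_Mapping.keys p \<subseteq> S \<and> h p = h' p"
    using p
  proof (induction p rule: frag_induction)
    case zero
    then show ?case using h.hom_one h'.hom_one by simp
  next
    case (one x)
    then show ?case using eq by simp
  next
    case (diff a b)
    then have "h (a + - b) = h' (a + - b)"
      using h.hom_mult[of a "- b"] h'.hom_mult[of a "- b"] h.hom_inv[of b] h'.hom_inv[of b] by simp
    moreover have "Poly_Mapping.keys (a - b) \<subseteq> S" using diff keys_diff[of a b] by blast
    ultimately show ?case by simp
  qed
  then show ?thesis ..
qed

text \<open>Closure under both operations is what places the relators in the free abelian group;
  bilinearity and balancing then hold in the quotient by construction.\<close>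

locale right_action =
  fixes A :: "('a, 'k) ring_scheme" and M :: "('a, 'b, 'l) right_module_scheme"
  assumes add_closed: "\<lbrakk>x \<in> carrier M; x' \<in> carrier M\<rbrakk> \<Longrightarrow> x \<oplus>\<^bsub>M\<^esub> x' \<in> carrier M"
    and rsmult_closed: "\<lbrakk>x \<in> carrier M; a \<in> carrier A\<rbrakk> \<Longrightarrow> rsmult M x a \<in> carrier M"

locale right_action_left_module = right_action A M + N: left_module A N
  for A :: "('a, 'k) ring_scheme" and M :: "('a, 'b, 'l) right_module_scheme"
    and N :: "('a, 'c, 'm) module_scheme"
begin

abbreviation "F \<equiv> free_Abelian_group (carrier M \<times> carrier N)"
abbreviation "K \<equiv> tensor_subgroup A M N"
abbreviation "T \<equiv> tensor_product A M N"
abbreviation "\<tau> \<equiv> tensor_elem A M N"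

lemma tensor_relators_subset: "tensor_relators A M N \<subseteq> carrier F"
proof -
  have "Poly_Mapping.keys (frag_of p - frag_of q - frag_of r) \<subseteq> carrier M \<times> carrier N"
    if "p \<in> carrier M \<times> carrier N" "q \<in> carrier M \<times> carrier N" "r \<in> carrier M \<times> carrier N" for p q r
  proof -
    have "Poly_Mapping.keys (frag_of p - frag_of q - frag_of r) \<subseteq>
        Poly_Mapping.keys (frag_of p - frag_of q) \<union> Poly_Mapping.keys (frag_of r)" by (rule keys_diff)
    also have "\<dots> \<subseteq> Poly_Mapping.keys (frag_of p) \<union> Poly_Mapping.keys (frag_of q) \<union>
        Poly_Mapping.keys (frag_of r)" using keys_diff[of "frag_of p" "frag_of q"] by blast
    finally show ?thesis using that by auto
  qed
  moreover have "Poly_Mapping.keys (frag_of p - frag_of q) \<subseteq> carrier M \<times> carrier N"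
    if "p \<in> carrier M \<times> carrier N" "q \<in> carrier M \<times> carrier N" for p q
    using that keys_diff[of "frag_of p" "frag_of q"] by auto
  ultimately show ?thesis
    by (auto simp: tensor_relators_def add_closed rsmult_closed N.lsmult_closed)
qed

lemma tensor_subgroup_subgroup: "subgroup K F"
  unfolding tensor_subgroup_def
  by (rule group.generate_is_subgroup[OF group_free_Abelian_group tensor_relators_subset])

lemma tensor_subgroup_normal: "K \<lhd> F"
  by (simp add: comm_group.normal_iff_subgroup[OF abelian_free_Abelian_group] tensor_subgroup_subgroup)

lemma comm_group_tensor_product: "comm_group T"
  unfolding tensor_product_def
  by (rule comm_group.abelian_FactGroup[OF abelian_free_Abelian_group tensor_subgroup_subgroup])

lemma group_tensor_product: "group T"
  using comm_group_tensor_product by (rule comm_group.axioms)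

lemma coset_hom: "(\<lambda>p. K #>\<^bsub>F\<^esub> p) \<in> hom F T"
  unfolding tensor_product_def by (rule normal.r_coset_hom_Mod[OF tensor_subgroup_normal])

lemma tensor_product_carrierE:
  assumes "Z \<in> carrier T"
  obtains p where "Poly_Mapping.keys p \<subseteq> carrier M \<times> carrier N" "Z = K #>\<^bsub>F\<^esub> p"
  using assms by (auto simp: tensor_product_def carrier_FactGroup)

lemma tensor_elem_closed: "\<lbrakk>x \<in> carrier M; y \<in> carrier N\<rbrakk> \<Longrightarrow> \<tau> x y \<in> carrier T"
  unfolding tensor_elem_def by (rule hom_in_carrier[OF coset_hom]) simp

text \<open>Composed with the coset map, both homomorphisms live on the free abelian group, where
  generators decide. Identities between maps out of the tensor product are reduced to pure tensors
  in this way.\<close>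

lemma tensor_hom_eq:
  assumes "group H" "h \<in> hom T H" "h' \<in> hom T H"
    and eq: "\<And>x y. \<lbrakk>x \<in> carrier M; y \<in> carrier N\<rbrakk> \<Longrightarrow> h (\<tau> x y) = h' (\<tau> x y)"
    and Z: "Z \<in> carrier T"
  shows "h Z = h' Z"
proof -
  obtain p where p: "Poly_Mapping.keys p \<subseteq> carrier M \<times> carrier N" "Z = K #>\<^bsub>F\<^esub> p"
    using Z by (rule tensor_product_carrierE)
  have "(h \<circ> (\<lambda>p. K #>\<^bsub>F\<^esub> p)) p = (h' \<circ> (\<lambda>p. K #>\<^bsub>F\<^esub> p)) p"
  proof (rule free_Abelian_group_hom_eq[OF assms(1) hom_compose[OF coset_hom assms(2)]
        hom_compose[OF coset_hom assms(3)] _ p(1)])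
    fix s assume "s \<in> carrier M \<times> carrier N"
    then show "(h \<circ> (\<lambda>p. K #>\<^bsub>F\<^esub> p)) (frag_of s) = (h' \<circ> (\<lambda>p. K #>\<^bsub>F\<^esub> p)) (frag_of s)"
      using eq[of "fst s" "snd s"] by (simp add: tensor_elem_def mem_Times_iff)
  qed
  then show ?thesis using p(2) by simp
qed

lemma tensor_subgroup_kernel:
  assumes "group H" "h \<in> hom F H" "\<And>r. r \<in> tensor_relators A M N \<Longrightarrow> h r = \<one>\<^bsub>H\<^esub>" "k \<in> K"
  shows "h k = \<one>\<^bsub>H\<^esub>"
proof -
  interpret h: group_hom F H h using assms by (simp add: group_hom_def group_hom_axioms_def)
  have "generate F (tensor_relators A M N) \<subseteq> kernel F H h"
    by (rule group.generate_subgroup_incl[OF group_free_Abelian_group _ h.subgroup_kernel])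
      (use tensor_relators_subset assms(3) in \<open>unfold kernel_def, blast\<close>)
  then show ?thesis using assms(4) by (auto simp: tensor_subgroup_def kernel_def)
qed

lemma coset_eqI:
  assumes p: "p \<in> carrier F" and q: "q \<in> carrier F" and pq: "p - q \<in> K"
  shows "K #>\<^bsub>F\<^esub> p = K #>\<^bsub>F\<^esub> q"
proof (rule group.repr_independence[OF group_free_Abelian_group _ q tensor_subgroup_subgroup, symmetric])
  show "p \<in> K #>\<^bsub>F\<^esub> q"
    unfolding r_coset_def using pq by (auto intro!: bexI[of _ "p - q"])
qed

lemma relator_coset:
  assumes "r \<in> tensor_relators A M N"
  shows "r \<in> K"
  using assms unfolding tensor_subgroup_def by (rule generate.incl)

lemma tensor_elem_add_left:
  assumes "x \<in> carrier M" "x' \<in> carrier M" "y \<in> carrier N"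
  shows "\<tau> (x \<oplus>\<^bsub>M\<^esub> x') y = \<tau> x y \<otimes>\<^bsub>T\<^esub> \<tau> x' y"
proof -
  let ?p = "frag_of (x, y) + frag_of (x', y)"
  have "frag_of (x \<oplus>\<^bsub>M\<^esub> x', y) - ?p \<in> K"
    by (rule relator_coset) (use assms in \<open>force simp: tensor_relators_def diff_diff_eq[symmetric]\<close>)
  then have "\<tau> (x \<oplus>\<^bsub>M\<^esub> x') y = K #>\<^bsub>F\<^esub> ?p"
    unfolding tensor_elem_def using keys_add[of "frag_of (x, y)" "frag_of (x', y)"] assms
    by (intro coset_eqI) (auto simp: add_closed)
  then show ?thesis
    using hom_mult[OF coset_hom, of "frag_of (x, y)" "frag_of (x', y)"] assms
    by (simp add: tensor_elem_def)
qed

lemma tensor_elem_add_right: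
  assumes "x \<in> carrier M" "y \<in> carrier N" "y' \<in> carrier N"
  shows "\<tau> x (y \<oplus>\<^bsub>N\<^esub> y') = \<tau> x y \<otimes>\<^bsub>T\<^esub> \<tau> x y'"
proof -
  let ?p = "frag_of (x, y) + frag_of (x, y')"
  have "frag_of (x, y \<oplus>\<^bsub>N\<^esub> y') - ?p \<in> K"
    by (rule relator_coset) (use assms in \<open>force simp: tensor_relators_def diff_diff_eq[symmetric]\<close>)
  then have "\<tau> x (y \<oplus>\<^bsub>N\<^esub> y') = K #>\<^bsub>F\<^esub> ?p"
    unfolding tensor_elem_def using keys_add[of "frag_of (x, y)" "frag_of (x, y')"] assms
    by (intro coset_eqI) auto
  then show ?thesis
    using hom_mult[OF coset_hom, of "frag_of (x, y)" "frag_of (x, y')"] assms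
    by (simp add: tensor_elem_def)
qed

lemma tensor_elem_balanced:
  assumes "x \<in> carrier M" "a \<in> carrier A" "y \<in> carrier N"
  shows "\<tau> (rsmult M x a) y = \<tau> x (a \<odot>\<^bsub>N\<^esub> y)"
  unfolding tensor_elem_def
proof (rule coset_eqI)
  show "frag_of (rsmult M x a, y) - frag_of (x, a \<odot>\<^bsub>N\<^esub> y) \<in> K"
    by (rule relator_coset) (use assms in \<open>force simp: tensor_relators_def\<close>)
qed (use assms in \<open>auto simp: rsmult_closed N.lsmult_closed\<close>)

text \<open>\<open>b\<close> extends to the free abelian group on pairs. The three laws say that the
  extension kills the three kinds of relators, with commutativity of \<open>H\<close> used to
  cancel, so it factors through the quotient.\<close>

lemma tensor_universal:
  assumes "comm_group H"
    and b: "\<And>x y. \<lbrakk>x \<in> carrier M; y \<in> carrier N\<rbrakk> \<Longrightarrow> b x y \<in> carrier H"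
    and bl: "\<And>x x' y. \<lbrakk>x \<in> carrier M; x' \<in> carrier M; y \<in> carrier N\<rbrakk> \<Longrightarrow>
      b (x \<oplus>\<^bsub>M\<^esub> x') y = b x y \<otimes>\<^bsub>H\<^esub> b x' y"
    and br: "\<And>x y y'. \<lbrakk>x \<in> carrier M; y \<in> carrier N; y' \<in> carrier N\<rbrakk> \<Longrightarrow>
      b x (y \<oplus>\<^bsub>N\<^esub> y') = b x y \<otimes>\<^bsub>H\<^esub> b x y'"
    and bb: "\<And>x a y. \<lbrakk>x \<in> carrier M; a \<in> carrier A; y \<in> carrier N\<rbrakk> \<Longrightarrow>
      b (rsmult M x a) y = b x (a \<odot>\<^bsub>N\<^esub> y)"
  shows "\<exists>h \<in> hom T H. \<forall>x \<in> carrier M. \<forall>y \<in> carrier N. h (\<tau> x y) = b x y"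
proof -
  interpret H: comm_group H by fact
  have "(\<lambda>(x, y). b x y) ` (carrier M \<times> carrier N) \<subseteq> carrier H" using b by auto
  then obtain g where g: "g \<in> hom F H"
    and gb: "\<And>p. p \<in> carrier M \<times> carrier N \<Longrightarrow> g (frag_of p) = (\<lambda>(x, y). b x y) p"
    by (rule H.free_Abelian_group_universal) blast
  interpret g: group_hom F H g using g by (simp add: group_hom_def group_hom_axioms_def)
  have gd: "g (p - q) = g p \<otimes>\<^bsub>H\<^esub> inv\<^bsub>H\<^esub> g q" if "p \<in> carrier F" "q \<in> carrier F" for p q
    using g.hom_mult[of p "- q"] g.hom_inv[of q] that by simp
  have "g r = \<one>\<^bsub>H\<^esub>" if r: "r \<in> tensor_relators A M N" for r
  proof -
    have k: "frag_of p - frag_of q \<in> carrier F"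
      if "p \<in> carrier M \<times> carrier N" "q \<in> carrier M \<times> carrier N" for p q
      using that keys_diff[of "frag_of p" "frag_of q"] by auto
    have *: "g (frag_of (x \<oplus>\<^bsub>M\<^esub> x', y) - frag_of (x, y) - frag_of (x', y)) = \<one>\<^bsub>H\<^esub>"
      if "x \<in> carrier M" "x' \<in> carrier M" "y \<in> carrier N" for x x' y
    proof -
      have "g (frag_of (x \<oplus>\<^bsub>M\<^esub> x', y) - frag_of (x, y) - frag_of (x', y)) =
        (b x y \<otimes>\<^bsub>H\<^esub> b x' y) \<otimes>\<^bsub>H\<^esub> inv\<^bsub>H\<^esub> b x y \<otimes>\<^bsub>H\<^esub> inv\<^bsub>H\<^esub> b x' y"
        using that by (subst gd[OF k]; (subst gd)?) (auto simp: gb bl add_closed)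
      then show ?thesis using that b by (simp add: H.m_comm[of "b x y"] H.m_assoc)
    qed
    have **: "g (frag_of (x, y \<oplus>\<^bsub>N\<^esub> y') - frag_of (x, y) - frag_of (x, y')) = \<one>\<^bsub>H\<^esub>"
      if "x \<in> carrier M" "y \<in> carrier N" "y' \<in> carrier N" for x y y'
    proof -
      have "g (frag_of (x, y \<oplus>\<^bsub>N\<^esub> y') - frag_of (x, y) - frag_of (x, y')) =
        (b x y \<otimes>\<^bsub>H\<^esub> b x y') \<otimes>\<^bsub>H\<^esub> inv\<^bsub>H\<^esub> b x y \<otimes>\<^bsub>H\<^esub> inv\<^bsub>H\<^esub> b x y'"
        using that by (subst gd[OF k]; (subst gd)?) (auto simp: gb br)
      then show ?thesis using that b by (simp add: H.m_comm[of "b x y"] H.m_assoc)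
    qed
    have ***: "g (frag_of (rsmult M x a, y) - frag_of (x, a \<odot>\<^bsub>N\<^esub> y)) = \<one>\<^bsub>H\<^esub>"
      if "x \<in> carrier M" "a \<in> carrier A" "y \<in> carrier N" for x a y
      using that b by (subst gd) (auto simp: gb bb rsmult_closed N.lsmult_closed)
    show ?thesis
      using r unfolding tensor_relators_def
      by (elim UnE CollectE exE conjE) (simp_all only: * ** ***)
  qed
  then have "K \<subseteq> kernel F H g"
    using tensor_subgroup_kernel[OF H.is_group g] subgroup.subset[OF tensor_subgroup_subgroup]
    unfolding kernel_def by blast
  then obtain h where h: "h \<in> hom (F Mod K) H" "\<And>p. p \<in> carrier F \<Longrightarrow> h (K #>\<^bsub>F\<^esub> p) = g p"
    using g.FactGroup_universal_kernel[OF tensor_subgroup_normal] by blast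
  show ?thesis
    by (rule bexI[of _ h]) (use h gb in \<open>simp_all add: tensor_product_def tensor_elem_def\<close>)
qed

end

text \<open>\<open>tensor_map\<close> is defined by \<open>the_elem\<close> on representatives and
  is meaningful only once the value is known to be unique. A homomorphism \<open>h\<close> with the
  right values on pure tensors comes from the universal property, and the formula on representatives
  is then shown to give \<open>h\<close>.\<close>

lemma tensor_map:
  assumes "right_action_left_module A M N" "right_action_left_module A M N'"
    and f: "f \<in> linear_maps A N N'"
  shows tensor_map_hom: "tensor_map A M N' f \<in> hom (tensor_product A M N) (tensor_product A M N')"
    and tensor_map_elem: "\<lbrakk>x \<in> carrier M; y \<in> carrier N\<rbrakk> \<Longrightarrow>
      tensor_map A M N' f (tensor_elem A M N x y) = tensor_elem A M N' x (f y)"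
proof -
  interpret T: right_action_left_module A M N by fact
  interpret T': right_action_left_module A M N' by fact
  let ?fe = "frag_extend (\<lambda>(x, y). frag_of (x, f y))"
  have "\<exists>h \<in> hom T.T T'.T. \<forall>x \<in> carrier M. \<forall>y \<in> carrier N. h (T.\<tau> x y) = T'.\<tau> x (f y)"
    by (rule T.tensor_universal[OF T'.comm_group_tensor_product])
      (simp_all add: linear_mapsD[OF f] T'.tensor_elem_closed T'.tensor_elem_add_left
        T'.tensor_elem_add_right T'.tensor_elem_balanced)
  then obtain h where h: "h \<in> hom T.T T'.T"
    and h\<tau>: "\<And>x y. \<lbrakk>x \<in> carrier M; y \<in> carrier N\<rbrakk> \<Longrightarrow> h (T.\<tau> x y) = T'.\<tau> x (f y)" by blast
  have fe: "?fe p \<in> carrier T'.F" if "p \<in> carrier T.F" for p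
  proof -
    have "Poly_Mapping.keys (?fe p) \<subseteq>
        (\<Union>s \<in> Poly_Mapping.keys p. Poly_Mapping.keys ((\<lambda>(x, y). frag_of (x, f y)) s))"
      by (rule keys_frag_extend)
    also have "\<dots> \<subseteq> carrier M \<times> carrier N'"
      using that linear_mapsD(1)[OF f] by (auto split: prod.splits)
    finally show ?thesis by simp
  qed
  have "?fe \<in> hom T.F T'.F" using fe by (intro homI) (auto simp: frag_extend_add)
  from hom_compose[OF this T'.coset_hom]
  have "(\<lambda>p. T'.K #>\<^bsub>T'.F\<^esub> p) \<circ> ?fe \<in> hom T.F T'.T" .
  moreover have "h \<circ> (\<lambda>p. T.K #>\<^bsub>T.F\<^esub> p) \<in> hom T.F T'.T" by (rule hom_compose[OF T.coset_hom h])
  \<comment> \<open>As functions of \<open>p\<close>, both sides are homomorphisms on the free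
    abelian group that agree on its generators.\<close>
  ultimately have eq: "T'.K #>\<^bsub>T'.F\<^esub> ?fe p = h (T.K #>\<^bsub>T.F\<^esub> p)" if "p \<in> carrier T.F" for p
    using free_Abelian_group_hom_eq[OF T'.group_tensor_product,
        of "(\<lambda>p. T'.K #>\<^bsub>T'.F\<^esub> p) \<circ> ?fe" "carrier M \<times> carrier N" "h \<circ> (\<lambda>p. T.K #>\<^bsub>T.F\<^esub> p)" p] that h\<tau>
    by (auto simp: tensor_elem_def)
  have map: "tensor_map A M N' f Z = h Z" if Z: "Z \<in> carrier T.T" for Z
  proof -
    obtain p where p: "Poly_Mapping.keys p \<subseteq> carrier M \<times> carrier N" "Z = T.K #>\<^bsub>T.F\<^esub> p"
      using Z by (rule T.tensor_product_carrierE)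
    have pF: "p \<in> carrier T.F" using p by simp
    \<comment> \<open>Every member \<open>q\<close> of a coset represents it, so all of them yield
      the value \<open>h Z\<close> and the image in the definition is a singleton.\<close>
    have "T'.K #>\<^bsub>T'.F\<^esub> ?fe q = h Z" if q: "q \<in> Z" for q
    proof -
      have "Z = T.K #>\<^bsub>T.F\<^esub> q"
        using group.repr_independence[OF group_free_Abelian_group _ _ T.tensor_subgroup_subgroup] q p
        by simp
      moreover have "Z \<subseteq> carrier T.F"
        unfolding p(2)
        by (rule monoid.r_coset_subset_G[OF group.is_monoid[OF group_free_Abelian_group]
            subgroup.subset[OF T.tensor_subgroup_subgroup] pF])
      then have "q \<in> carrier T.F" using q by (rule subsetD)
      ultimately show ?thesis using eq by simp
    qed
    moreover have "p \<in> Z"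
      using group.rcos_self[OF group_free_Abelian_group _ T.tensor_subgroup_subgroup] p by simp
    ultimately have "(\<lambda>p. T'.K #>\<^bsub>T'.F\<^esub> ?fe p) ` Z = {h Z}" by auto
    then show ?thesis by (simp add: tensor_map_def)
  qed
  show "tensor_map A M N' f \<in> hom T.T T'.T"
    using h map by (auto simp: hom_def Pi_iff group.subgroup_self monoid.m_closed
        group.is_monoid[OF T.group_tensor_product])
  show "tensor_map A M N' f (T.\<tau> x y) = T'.\<tau> x (f y)" if "x \<in> carrier M" "y \<in> carrier N"
    using that by (simp add: map T.tensor_elem_closed h\<tau>)
qed

text \<open>The left action is a parameter and not a record field: the twisted module comes as a
  right module record, and its left action is obtained by transport. Commutation of the two actions,
  \<open>lact_rsmult\<close>, lets the left action pass to the tensor product.\<close>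

locale bimodule_action = right_action A M
  for A :: "('a, 'k) ring_scheme" and M :: "('a, 'b, 'l) right_module_scheme" +
  fixes lact :: "'a \<Rightarrow> 'b \<Rightarrow> 'b"
  assumes lact_closed: "\<lbrakk>a \<in> carrier A; x \<in> carrier M\<rbrakk> \<Longrightarrow> lact a x \<in> carrier M"
    and lact_l_distr: "\<lbrakk>a \<in> carrier A; b \<in> carrier A; x \<in> carrier M\<rbrakk> \<Longrightarrow>
      lact (a \<oplus>\<^bsub>A\<^esub> b) x = lact a x \<oplus>\<^bsub>M\<^esub> lact b x"
    and lact_r_distr: "\<lbrakk>a \<in> carrier A; x \<in> carrier M; y \<in> carrier M\<rbrakk> \<Longrightarrow>
      lact a (x \<oplus>\<^bsub>M\<^esub> y) = lact a x \<oplus>\<^bsub>M\<^esub> lact a y"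
    and lact_assoc: "\<lbrakk>a \<in> carrier A; b \<in> carrier A; x \<in> carrier M\<rbrakk> \<Longrightarrow>
      lact (a \<otimes>\<^bsub>A\<^esub> b) x = lact a (lact b x)"
    and lact_one: "x \<in> carrier M \<Longrightarrow> lact \<one>\<^bsub>A\<^esub> x = x"
    and lact_rsmult: "\<lbrakk>a \<in> carrier A; b \<in> carrier A; x \<in> carrier M\<rbrakk> \<Longrightarrow>
      lact a (rsmult M x b) = rsmult M (lact a x) b"

locale bimodule_action_left_module = right_action_left_module A M N + bimodule_action A M lact
  for A :: "('a, 'k) ring_scheme" and M :: "('a, 'b, 'l) right_module_scheme"
    and N :: "('a, 'c, 'm) module_scheme" and lact :: "'a \<Rightarrow> 'b \<Rightarrow> 'b"
begin

text \<open>\<open>tensor_universal\<close> gives existence only, hence the choice; by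
  \<open>tensor_hom_eq\<close> the values on pure tensors determine the map on the whole tensor
  product.\<close>

definition tensor_act :: "'a \<Rightarrow> ('b \<times> 'c \<Rightarrow>\<^sub>0 int) set \<Rightarrow> ('b \<times> 'c \<Rightarrow>\<^sub>0 int) set"
  where "tensor_act a = (SOME h. h \<in> hom T T \<and>
    (\<forall>x \<in> carrier M. \<forall>y \<in> carrier N. h (\<tau> x y) = \<tau> (lact a x) y))"

lemma tensor_act:
  assumes "a \<in> carrier A"
  shows tensor_act_hom: "tensor_act a \<in> hom T T"
    and tensor_act_elem: "\<lbrakk>x \<in> carrier M; y \<in> carrier N\<rbrakk> \<Longrightarrow> tensor_act a (\<tau> x y) = \<tau> (lact a x) y"
proof -
  have "\<exists>h \<in> hom T T. \<forall>x \<in> carrier M. \<forall>y \<in> carrier N. h (\<tau> x y) = \<tau> (lact a x) y"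
    by (rule tensor_universal[OF comm_group_tensor_product])
      (use assms in \<open>simp_all add: tensor_elem_closed tensor_elem_add_left tensor_elem_add_right
        tensor_elem_balanced lact_closed lact_r_distr lact_rsmult\<close>)
  then have "\<exists>h. h \<in> hom T T \<and> (\<forall>x \<in> carrier M. \<forall>y \<in> carrier N. h (\<tau> x y) = \<tau> (lact a x) y)" by blast
  from someI_ex[OF this]
  have *: "tensor_act a \<in> hom T T \<and>
      (\<forall>x \<in> carrier M. \<forall>y \<in> carrier N. tensor_act a (\<tau> x y) = \<tau> (lact a x) y)"
    unfolding tensor_act_def .
  from * show "tensor_act a \<in> hom T T" ..
  from * show "\<lbrakk>x \<in> carrier M; y \<in> carrier N\<rbrakk> \<Longrightarrow> tensor_act a (\<tau> x y) = \<tau> (lact a x) y" by blast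
qed

definition tensor_module :: "('a, ('b \<times> 'c \<Rightarrow>\<^sub>0 int) set) module"
  where "tensor_module =
    \<lparr>carrier = carrier T, monoid.mult = (\<lambda>_ _. undefined), one = undefined,
     ring.zero = \<one>\<^bsub>T\<^esub>, add = monoid.mult T, smult = tensor_act\<rparr>"

lemma tensor_module_simps [simp]:
  "carrier tensor_module = carrier T" "\<zero>\<^bsub>tensor_module\<^esub> = \<one>\<^bsub>T\<^esub>"
  "x \<oplus>\<^bsub>tensor_module\<^esub> y = x \<otimes>\<^bsub>T\<^esub> y" "a \<odot>\<^bsub>tensor_module\<^esub> x = tensor_act a x"
  by (simp_all add: tensor_module_def)

text \<open>Additivity in the tensor holds because each \<open>tensor_act a\<close> is a
  homomorphism; the laws that vary the scalar compare two homomorphisms on pure tensors.\<close>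

lemma left_module_tensor: "left_module A tensor_module"
proof -
  interpret T: comm_group T by (rule comm_group_tensor_product)
  have id: "(\<lambda>Z. Z) \<in> hom T T" by (simp add: hom_def)
  show ?thesis
  proof (intro left_module.intro left_module_axioms.intro)
    show "ring A" by (rule N.A.ring_axioms)
    show "abelian_group tensor_module"
    proof (rule abelian_groupI)
      show "\<exists>y\<in>carrier tensor_module. y \<oplus>\<^bsub>tensor_module\<^esub> x = \<zero>\<^bsub>tensor_module\<^esub>"
        if "x \<in> carrier tensor_module" for x
        using that T.l_inv_ex by auto
    qed (simp_all add: T.m_ac)
    show "a \<odot>\<^bsub>tensor_module\<^esub> x \<in> carrier tensor_module"
      if "a \<in> carrier A" "x \<in> carrier tensor_module" for a x
      using hom_in_carrier[OF tensor_act_hom] that by simp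
    show "a \<odot>\<^bsub>tensor_module\<^esub> (x \<oplus>\<^bsub>tensor_module\<^esub> y) =
        a \<odot>\<^bsub>tensor_module\<^esub> x \<oplus>\<^bsub>tensor_module\<^esub> a \<odot>\<^bsub>tensor_module\<^esub> y"
      if "a \<in> carrier A" "x \<in> carrier tensor_module" "y \<in> carrier tensor_module" for a x y
      using hom_mult[OF tensor_act_hom] that by simp
    show "(a \<oplus>\<^bsub>A\<^esub> b) \<odot>\<^bsub>tensor_module\<^esub> x =
        a \<odot>\<^bsub>tensor_module\<^esub> x \<oplus>\<^bsub>tensor_module\<^esub> b \<odot>\<^bsub>tensor_module\<^esub> x"
      if "a \<in> carrier A" "b \<in> carrier A" "x \<in> carrier tensor_module" for a b x
      unfolding tensor_module_simps
      by (rule tensor_hom_eq[OF group_tensor_product tensor_act_hom T.hom_group_mult[OF tensor_act_hom tensor_act_hom]])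
        (use that in \<open>simp_all add: tensor_act_elem lact_l_distr tensor_elem_add_left lact_closed\<close>)
    show "(a \<otimes>\<^bsub>A\<^esub> b) \<odot>\<^bsub>tensor_module\<^esub> x = a \<odot>\<^bsub>tensor_module\<^esub> (b \<odot>\<^bsub>tensor_module\<^esub> x)"
      if "a \<in> carrier A" "b \<in> carrier A" "x \<in> carrier tensor_module" for a b x
    proof -
      have "tensor_act (a \<otimes>\<^bsub>A\<^esub> b) x = (tensor_act a \<circ> tensor_act b) x"
        by (rule tensor_hom_eq[OF group_tensor_product tensor_act_hom hom_compose[OF tensor_act_hom tensor_act_hom]])
          (use that in \<open>simp_all add: tensor_act_elem lact_assoc lact_closed\<close>)
      then show ?thesis by simp
    qed
    show "\<one>\<^bsub>A\<^esub> \<odot>\<^bsub>tensor_module\<^esub> x = x" if "x \<in> carrier tensor_module" for x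
      unfolding tensor_module_simps
      by (rule tensor_hom_eq[OF group_tensor_product tensor_act_hom id])
        (use that in \<open>simp_all add: tensor_act_elem lact_one\<close>)
  qed
qed

text \<open>The chain \<open>a (u \<otimes> y) = (a u) \<otimes> y = (u a) \<otimes> y = u \<otimes>
  (a y)\<close>. With \<open>u\<close> the unit this is the map that embeds the resolution into the
  tensor complex up to homotopy questions, and the map that is to be contracted.\<close>

lemma tensor_elem_linear:
  assumes u: "u \<in> carrier M" and ua: "\<And>a. a \<in> carrier A \<Longrightarrow> rsmult M u a = lact a u"
  shows "\<tau> u \<in> linear_maps A N tensor_module"
proof (rule linear_mapsI)
  fix a y assume "a \<in> carrier A" "y \<in> carrier N"
  then show "\<tau> u (a \<odot>\<^bsub>N\<^esub> y) = a \<odot>\<^bsub>tensor_module\<^esub> \<tau> u y"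
    using tensor_elem_balanced[OF u] u by (simp add: tensor_act_elem ua)
qed (use u in \<open>simp_all add: tensor_elem_closed tensor_elem_add_right\<close>)

text \<open>A homomorphism to the additive group of \<open>V\<close> comes from
  \<open>tensor_universal\<close>; its linearity is checked on pure tensors, where it is the law
  \<open>ba\<close>.\<close>

lemma tensor_linear_universal:
  assumes V: "left_module A V"
    and b: "\<And>x y. \<lbrakk>x \<in> carrier M; y \<in> carrier N\<rbrakk> \<Longrightarrow> b x y \<in> carrier V"
    and bl: "\<And>x x' y. \<lbrakk>x \<in> carrier M; x' \<in> carrier M; y \<in> carrier N\<rbrakk> \<Longrightarrow>
      b (x \<oplus>\<^bsub>M\<^esub> x') y = b x y \<oplus>\<^bsub>V\<^esub> b x' y"
    and br: "\<And>x y y'. \<lbrakk>x \<in> carrier M; y \<in> carrier N; y' \<in> carrier N\<rbrakk> \<Longrightarrow>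
      b x (y \<oplus>\<^bsub>N\<^esub> y') = b x y \<oplus>\<^bsub>V\<^esub> b x y'"
    and bb: "\<And>x a y. \<lbrakk>x \<in> carrier M; a \<in> carrier A; y \<in> carrier N\<rbrakk> \<Longrightarrow>
      b (rsmult M x a) y = b x (a \<odot>\<^bsub>N\<^esub> y)"
    and ba: "\<And>x a y. \<lbrakk>x \<in> carrier M; a \<in> carrier A; y \<in> carrier N\<rbrakk> \<Longrightarrow>
      b (lact a x) y = a \<odot>\<^bsub>V\<^esub> b x y"
  shows "\<exists>h \<in> linear_maps A tensor_module V. \<forall>x \<in> carrier M. \<forall>y \<in> carrier N. h (\<tau> x y) = b x y"
proof -
  interpret V: left_module A V by (rule V)
  have "\<exists>h \<in> hom T (add_monoid V). \<forall>x \<in> carrier M. \<forall>y \<in> carrier N. h (\<tau> x y) = b x y"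
    by (rule tensor_universal[OF V.a_comm_group]) (simp_all add: b bl br bb)
  then obtain h where h: "h \<in> hom T (add_monoid V)"
    and hb: "\<And>x y. \<lbrakk>x \<in> carrier M; y \<in> carrier N\<rbrakk> \<Longrightarrow> h (\<tau> x y) = b x y" by blast
  have "h \<in> linear_maps A tensor_module V"
  proof (rule linear_mapsI)
    fix a Z assume a: "a \<in> carrier A" and Z: "Z \<in> carrier tensor_module"
    have "(h \<circ> tensor_act a) Z = ((\<lambda>v. a \<odot>\<^bsub>V\<^esub> v) \<circ> h) Z"
    proof (rule tensor_hom_eq[OF V.a_group hom_compose[OF tensor_act_hom h] hom_compose[OF h]])
      show "(\<lambda>v. a \<odot>\<^bsub>V\<^esub> v) \<in> hom (add_monoid V) (add_monoid V)"
        using a by (simp add: hom_def V.lsmult_closed V.lsmult_r_distr)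
    qed (use a Z in \<open>simp_all add: tensor_act_elem hb ba lact_closed\<close>)
    then show "h (a \<odot>\<^bsub>tensor_module\<^esub> Z) = a \<odot>\<^bsub>V\<^esub> h Z" by simp
  qed (use hom_in_carrier[OF h] hom_mult[OF h] in simp_all)
  then show ?thesis using hb by blast
qed

end

text \<open>Scalars act on the first factor and \<open>f\<close> on the second, so the two
  operations commute on pure tensors.\<close>

lemma tensor_map_linear:
  assumes "bimodule_action_left_module A M N lact" "bimodule_action_left_module A M N' lact"
    and f: "f \<in> linear_maps A N N'"
  shows "tensor_map A M N' f \<in> linear_maps A
    (bimodule_action_left_module.tensor_module A M N lact)
    (bimodule_action_left_module.tensor_module A M N' lact)"
proof -
  interpret T: bimodule_action_left_module A M N lact by fact
  interpret T': bimodule_action_left_module A M N' lact by fact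
  note h = tensor_map_hom[OF T.right_action_left_module_axioms T'.right_action_left_module_axioms f]
    and e = tensor_map_elem[OF T.right_action_left_module_axioms T'.right_action_left_module_axioms f]
  show ?thesis
  proof (rule linear_mapsI)
    fix a Z assume a: "a \<in> carrier A" and Z: "Z \<in> carrier T.tensor_module"
    have "(tensor_map A M N' f \<circ> T.tensor_act a) Z = (T'.tensor_act a \<circ> tensor_map A M N' f) Z"
      by (rule T.tensor_hom_eq[OF T'.group_tensor_product hom_compose[OF T.tensor_act_hom h]
            hom_compose[OF h T'.tensor_act_hom]])
        (use a Z in \<open>simp_all add: T.tensor_act_elem T'.tensor_act_elem e T.lact_closed linear_mapsD(1)[OF f]\<close>)
    then show "tensor_map A M N' f (a \<odot>\<^bsub>T.tensor_module\<^esub> Z) =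
        a \<odot>\<^bsub>T'.tensor_module\<^esub> tensor_map A M N' f Z" by simp
  qed (use hom_in_carrier[OF h] hom_mult[OF h] in simp_all)
qed

section \<open>Vanishing of homology and cohomology\<close>

text \<open>In a trivial quotient the coset of \<open>x\<close> is the unit \<open>B\<close>, and it
  contains \<open>x\<close> because \<open>B\<close> contains the unit of \<open>H\<close>.\<close>

lemma trivial_FactGroup_imp_mem:
  assumes "trivial_group (H\<lparr>carrier := Z\<rparr> Mod B)" "monoid H" "x \<in> Z" "Z \<subseteq> carrier H" "\<one>\<^bsub>H\<^esub> \<in> B"
  shows "x \<in> B"
proof -
  have "B #>\<^bsub>H\<lparr>carrier := Z\<rparr>\<^esub> x = B"
    using assms(1,3) by (auto simp: trivial_group_def carrier_FactGroup)
  moreover have "\<one>\<^bsub>H\<^esub> \<otimes>\<^bsub>H\<^esub> x \<in> B #>\<^bsub>H\<lparr>carrier := Z\<rparr>\<^esub> x"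
    using assms(5) by (auto simp: r_coset_def)
  ultimately show ?thesis using assms by (simp add: monoid.l_one subset_iff)
qed

lemma trivial_group_Mod_self:
  assumes "comm_group H" "subgroup Z H"
  shows "trivial_group (H\<lparr>carrier := Z\<rparr> Mod Z)"
proof -
  interpret H: comm_group H by fact
  interpret Z: comm_group "H\<lparr>carrier := Z\<rparr>" 
    using group.group_comm_groupI[OF H.subgroup_imp_group[OF assms(2)]] H.m_comm
      subgroup.subset[OF assms(2)] by (simp add: subset_iff)
  have Z: "subgroup Z (H\<lparr>carrier := Z\<rparr>)" using Z.subgroup_self by simp
  interpret Q: comm_group "H\<lparr>carrier := Z\<rparr> Mod Z" by (rule Z.abelian_FactGroup[OF Z])
  have "Z #>\<^bsub>H\<lparr>carrier := Z\<rparr>\<^esub> x = Z" if "x \<in> Z" for x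
    using Z.coset_join2[OF _ Z] that by simp
  then have "carrier (H\<lparr>carrier := Z\<rparr> Mod Z) \<subseteq> {Z}" by (auto simp: carrier_FactGroup)
  then show ?thesis using Q.trivial_group_subset by simp
qed

text \<open>Converts a vanishing homology group into exactness. The condition \<open>z\<close> is
  empty for \<open>i = 0\<close>, where all of \<open>T 0\<close> counts as cycles.\<close>

lemma chain_homology_trivialD:
  assumes T: "\<And>i. group (T i)" and d: "\<And>i. d i \<in> hom (T (Suc i)) (T i)"
    and triv: "trivial_group (chain_homology T d i)"
    and x: "x \<in> carrier (T i)" and z: "\<And>j. i = Suc j \<Longrightarrow> d j x = \<one>\<^bsub>T j\<^esub>"
  shows "x \<in> d i ` carrier (T (Suc i))"
proof (rule trivial_FactGroup_imp_mem[OF triv[unfolded chain_homology_def] group.is_monoid[OF T]])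
  show "\<one>\<^bsub>T i\<^esub> \<in> d i ` carrier (T (Suc i))"
    using hom_one[OF d T T] group.is_monoid[OF T] monoid.one_closed by (metis image_eqI)
qed (use x z in \<open>auto simp: kernel_def split: nat.splits\<close>)

section \<open>Cochains: groups of linear maps and precomposition with differentials\<close>

lemma comm_group_Hom_group:
  assumes M: "left_module A M" and N: "left_module A N"
  shows "comm_group (Hom_group A M N)"
proof -
  interpret M: left_module A M by (rule M)
  interpret N: left_module A N by (rule N)
  let ?H = "Hom_group A M N"
  have memI: "(\<lambda>x\<in>carrier M. f x) \<in> carrier ?H" if "f \<in> linear_maps A M N" for f
    using that M.lsmult_closed by (auto simp: Hom_group_def linear_maps_def)
  have zero: "(\<lambda>_. \<zero>\<^bsub>N\<^esub>) \<in> linear_maps A M N"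
    by (rule linear_mapsI) (simp_all add: N.lsmult_zero_right)
  have add: "(\<lambda>x. f x \<oplus>\<^bsub>N\<^esub> g x) \<in> linear_maps A M N" if "f \<in> carrier ?H" "g \<in> carrier ?H" for f g
    using that by (auto simp: Hom_group_def intro!: linear_maps_add_fun[OF M N])
  have minus: "(\<lambda>x. \<ominus>\<^bsub>N\<^esub> f x) \<in> linear_maps A M N" if "f \<in> carrier ?H" for f
  proof -
    have f: "f \<in> linear_maps A M N" using that by (simp add: Hom_group_def)
    then show ?thesis
      by (intro linear_mapsI) (simp_all add: linear_mapsD[OF f] N.minus_add N.lsmult_minus)
  qed
  have val: "f x \<in> carrier N" if "f \<in> carrier ?H" "x \<in> carrier M" for f x
    using that by (auto simp: Hom_group_def linear_mapsD)
  have ext: "f \<in> extensional (carrier M)" if "f \<in> carrier ?H" for f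
    using that by (auto simp: Hom_group_def)
  have mult: "f \<otimes>\<^bsub>?H\<^esub> g = (\<lambda>x\<in>carrier M. f x \<oplus>\<^bsub>N\<^esub> g x)" for f g by (simp add: Hom_group_def)
  have one: "\<one>\<^bsub>?H\<^esub> = (\<lambda>x\<in>carrier M. \<zero>\<^bsub>N\<^esub>)" by (simp add: Hom_group_def)
  show ?thesis
  proof (rule comm_groupI)
    show "\<one>\<^bsub>?H\<^esub> \<otimes>\<^bsub>?H\<^esub> f = f" if "f \<in> carrier ?H" for f
      by (rule extensionalityI[of _ "carrier M"]) (use that ext in \<open>auto simp: mult one val\<close>)
    show "\<exists>g\<in>carrier ?H. g \<otimes>\<^bsub>?H\<^esub> f = \<one>\<^bsub>?H\<^esub>" if f: "f \<in> carrier ?H" for f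
      by (rule bexI[OF _ memI[OF minus[OF f]]])
        (use val[OF f] in \<open>auto simp: mult one N.l_neg intro!: restrict_ext\<close>)
    show "f \<otimes>\<^bsub>?H\<^esub> g \<in> carrier ?H" if "f \<in> carrier ?H" "g \<in> carrier ?H" for f g
      unfolding mult by (rule memI[OF add[OF that]])
    show "f \<otimes>\<^bsub>?H\<^esub> g \<otimes>\<^bsub>?H\<^esub> h = f \<otimes>\<^bsub>?H\<^esub> (g \<otimes>\<^bsub>?H\<^esub> h)"
      if "f \<in> carrier ?H" "g \<in> carrier ?H" "h \<in> carrier ?H" for f g h
      unfolding mult by (rule restrict_ext) (use that in \<open>simp add: val N.a_assoc\<close>)
    show "f \<otimes>\<^bsub>?H\<^esub> g = g \<otimes>\<^bsub>?H\<^esub> f" if "f \<in> carrier ?H" "g \<in> carrier ?H" for f g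
      unfolding mult by (rule restrict_ext) (use that in \<open>simp add: val N.a_comm\<close>)
    show "\<one>\<^bsub>?H\<^esub> \<in> carrier ?H" unfolding one by (rule memI[OF zero])
  qed
qed

lemma Hom_group_precomp_hom:
  assumes M: "left_module A M" and d: "d \<in> linear_maps A M M'"
  shows "(\<lambda>f. \<lambda>c\<in>carrier M. f (d c)) \<in> hom (Hom_group A M' N) (Hom_group A M N)"
proof -
  interpret M: left_module A M by (rule M)
  show ?thesis
  proof (rule homI)
    show "(\<lambda>c\<in>carrier M. f (d c)) \<in> carrier (Hom_group A M N)"
      if "f \<in> carrier (Hom_group A M' N)" for f
      using that linear_maps_comp[OF d, of f N] M.lsmult_closed
      by (auto simp: Hom_group_def linear_maps_def)
  qed (auto simp: Hom_group_def linear_mapsD[OF d] intro!: restrict_ext)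
qed

text \<open>Cochains are extensional functions, while the criterion \<open>ex\<close> speaks of
  arbitrary linear maps, so that maps built by composition can be fed in directly. It makes the
  cocycles equal to the subgroup divided out, and a group modulo itself is trivial. For
  \<open>i = 0\<close> this subgroup is trivial, so a cocycle has to vanish.\<close>

lemma cochain_cohomology_Hom_trivialI:
  assumes C: "\<And>i. left_module A (C i)" and N: "left_module A N"
    and d: "\<And>i. d i \<in> linear_maps A (C (Suc i)) (C i)"
    and dd: "\<And>i c. c \<in> carrier (C (Suc (Suc i))) \<Longrightarrow> d i (d (Suc i) c) = \<zero>\<^bsub>C i\<^esub>"
    and ex: "\<And>f. \<lbrakk>f \<in> linear_maps A (C i) N; \<And>c. c \<in> carrier (C (Suc i)) \<Longrightarrow> f (d i c) = \<zero>\<^bsub>N\<^esub>\<rbrakk> \<Longrightarrow>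
      (case i of 0 \<Rightarrow> \<forall>c \<in> carrier (C 0). f c = \<zero>\<^bsub>N\<^esub>
       | Suc j \<Rightarrow> \<exists>k \<in> linear_maps A (C j) N. \<forall>c \<in> carrier (C i). f c = k (d j c))"
  shows "trivial_group (cochain_cohomology (\<lambda>j. Hom_group A (C j) N)
    (\<lambda>j f. \<lambda>c\<in>carrier (C (Suc j)). f (d j c)) i)"
proof -
  let ?T = "\<lambda>j. Hom_group A (C j) N" and ?d = "\<lambda>j f. \<lambda>c\<in>carrier (C (Suc j)). f (d j c)"
  let ?Z = "kernel (?T i) (?T (Suc i)) (?d i)"
  let ?B = "case i of 0 \<Rightarrow> {\<one>\<^bsub>?T 0\<^esub>} | Suc j \<Rightarrow> ?d j ` carrier (?T j)"
  have comm: "comm_group (?T j)" for j by (rule comm_group_Hom_group[OF C N])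
  interpret h: group_hom "?T i" "?T (Suc i)" "?d i"
    using Hom_group_precomp_hom[OF C d] comm
    by (simp add: group_hom_def group_hom_axioms_def comm_group.axioms)
  have "?B = ?Z"
  proof (rule equalityI; rule subsetI)
    fix f assume f: "f \<in> ?B"
    show "f \<in> ?Z"
    proof (cases i)
      case 0
      then show ?thesis using f h.hom_one h.G.one_closed by (auto simp: kernel_def)
    next
      case (Suc j)
      then obtain k where k: "k \<in> carrier (?T j)" "f = ?d j k" using f by auto
      then have kl: "k \<in> linear_maps A (C j) N" by (simp add: Hom_group_def)
      have "?d (Suc j) f = \<one>\<^bsub>?T (Suc (Suc j))\<^esub>"
        using linear_maps_zero[OF C N kl] dd linear_mapsD(1)[OF d] unfolding k(2)
        by (auto simp: Hom_group_def intro!: restrict_ext)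
      moreover have "f \<in> carrier (?T (Suc j))"
        unfolding k(2) using hom_in_carrier[OF Hom_group_precomp_hom[OF C d] k(1)] .
      ultimately show ?thesis using Suc by (simp add: kernel_def)
    qed
  next
    fix f assume f: "f \<in> ?Z"
    then have fl: "f \<in> linear_maps A (C i) N" and fe: "f \<in> extensional (carrier (C i))"
      by (auto simp: kernel_def Hom_group_def)
    have "?d i f = (\<lambda>x\<in>carrier (C (Suc i)). \<zero>\<^bsub>N\<^esub>)" using f by (simp add: kernel_def Hom_group_def)
    then have "f (d i c) = \<zero>\<^bsub>N\<^esub>" if "c \<in> carrier (C (Suc i))" for c
      using that by (metis restrict_apply')
    note ex = ex[OF fl this]
    show "f \<in> ?B"
    proof (cases i)
      case 0
      then have "f = (\<lambda>x\<in>carrier (C 0). \<zero>\<^bsub>N\<^esub>)"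
        using ex fe by (intro extensionalityI[of _ "carrier (C 0)"]) auto
      then show ?thesis using 0 by (simp add: Hom_group_def)
    next
      case (Suc j)
      then obtain k where k: "k \<in> linear_maps A (C j) N" "\<forall>c \<in> carrier (C (Suc j)). f c = k (d j c)"
        using ex by auto
      \<comment> \<open>\<open>k\<close> is made undefined outside \<open>C j\<close> to become a
        cochain; composition with \<open>d j\<close> does not see the change, as \<open>d j\<close>
        takes values in \<open>C j\<close>.\<close>
      let ?k = "\<lambda>c\<in>carrier (C j). k c"
      interpret Cj: left_module A "C j" by (rule C)
      have "?k \<in> carrier (?T j)"
        using k(1) Cj.lsmult_closed by (auto simp: Hom_group_def linear_maps_def)
      moreover have "f = ?d j ?k"
        using k(2) fe Suc linear_mapsD(1)[OF d, of _ j]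
        by (intro extensionalityI[of _ "carrier (C (Suc j))"]) auto
      ultimately have "f \<in> ?d j ` carrier (?T j)" by (rule rev_image_eqI[where f = "?d j"])
      then show ?thesis using Suc by simp
    qed
  qed
  then show ?thesis
    unfolding cochain_cohomology_def
    using trivial_group_Mod_self[OF comm h.subgroup_kernel] by simp
qed

text \<open>In the application \<open>M\<close> is the twisted Novikov module, \<open>V\<close> the
  Novikov ring of \<open>-\<phi>\<close>, \<open>pairing\<close> the product in that ring after
  inversion in the first argument, and \<open>u\<close> the unit. \<open>u_central\<close> makes
  \<open>c \<mapsto> u \<otimes> c\<close> linear, and \<open>pairing_u\<close> recovers
  \<open>f c\<close> from \<open>u \<otimes> c\<close>.\<close>

locale bimodule_pairing = bimodule_action A M lact + V: left_module A V
  for A :: "('a, 'k) ring_scheme" and M :: "('a, 'b, 'l) right_module_scheme"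
    and lact :: "'a \<Rightarrow> 'b \<Rightarrow> 'b" and V :: "('a, 'v, 'n) module_scheme" +
  fixes pairing :: "'b \<Rightarrow> 'v \<Rightarrow> 'v" and u :: 'b
  assumes pairing_closed: "\<lbrakk>x \<in> carrier M; v \<in> carrier V\<rbrakk> \<Longrightarrow> pairing x v \<in> carrier V"
    and pairing_add_left: "\<lbrakk>x \<in> carrier M; x' \<in> carrier M; v \<in> carrier V\<rbrakk> \<Longrightarrow>
      pairing (x \<oplus>\<^bsub>M\<^esub> x') v = pairing x v \<oplus>\<^bsub>V\<^esub> pairing x' v"
    and pairing_add_right: "\<lbrakk>x \<in> carrier M; v \<in> carrier V; v' \<in> carrier V\<rbrakk> \<Longrightarrow>
      pairing x (v \<oplus>\<^bsub>V\<^esub> v') = pairing x v \<oplus>\<^bsub>V\<^esub> pairing x v'"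
    and pairing_balanced: "\<lbrakk>x \<in> carrier M; a \<in> carrier A; v \<in> carrier V\<rbrakk> \<Longrightarrow>
      pairing (rsmult M x a) v = pairing x (a \<odot>\<^bsub>V\<^esub> v)"
    and pairing_lact: "\<lbrakk>x \<in> carrier M; a \<in> carrier A; v \<in> carrier V\<rbrakk> \<Longrightarrow>
      pairing (lact a x) v = a \<odot>\<^bsub>V\<^esub> pairing x v"
    and u_closed: "u \<in> carrier M"
    and u_central: "a \<in> carrier A \<Longrightarrow> rsmult M u a = lact a u"
    and pairing_u: "v \<in> carrier V \<Longrightarrow> pairing u v = v"
begin

lemma cocycle_imp_coboundary:
  assumes C: "projective_resolution A B C d \<epsilon>"
    and triv: "\<And>i. i \<le> n \<Longrightarrow>
      trivial_group (chain_homology (\<lambda>j. tensor_product A M (C j)) (\<lambda>j. tensor_map A M (C j) (d j)) i)"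
    and i: "i \<le> n" and f: "f \<in> linear_maps A (C i) V"
    and fd: "\<And>c. c \<in> carrier (C (Suc i)) \<Longrightarrow> f (d i c) = \<zero>\<^bsub>V\<^esub>"
  shows "case i of 0 \<Rightarrow> \<forall>c \<in> carrier (C 0). f c = \<zero>\<^bsub>V\<^esub>
    | Suc j \<Rightarrow> \<exists>k \<in> linear_maps A (C j) V. \<forall>c \<in> carrier (C i). f c = k (d j c)"
proof -
  note C' = projective_resolutionD[OF C]
  have T: "bimodule_action_left_module A M (C j) lact" for j
    by (intro bimodule_action_left_module.intro right_action_left_module.intro
        right_action_axioms bimodule_action_axioms C')
  interpret T: bimodule_action_left_module A M "C j" lact for j by (rule T)
  let ?e = "\<lambda>j. tensor_map A M (C j) (d j)"
  have e: "?e j \<in> linear_maps A (T.tensor_module (Suc j)) (T.tensor_module j)" for j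
    by (rule tensor_map_linear[OF T T C'(3)])
  have ehom: "?e j \<in> hom (T.T (Suc j)) (T.T j)" for j
    by (rule tensor_map_hom[OF T.right_action_left_module_axioms T.right_action_left_module_axioms C'(3)])
  have eelem: "?e j (T.\<tau> (Suc j) x y) = T.\<tau> j x (d j y)"
    if "x \<in> carrier M" "y \<in> carrier (C (Suc j))" for j x y
    by (rule tensor_map_elem[OF T.right_action_left_module_axioms T.right_action_left_module_axioms C'(3) that])
  have ex: "x \<in> ?e j ` carrier (T.T (Suc j))"
    if "j \<le> n" "x \<in> carrier (T.T j)" "\<And>k. j = Suc k \<Longrightarrow> ?e k x = \<one>\<^bsub>T.T k\<^esub>" for j x
    using chain_homology_trivialD[of T.T ?e, OF T.group_tensor_product ehom triv] that by blast
  interpret H: homotopy_setup A C d T.tensor_module ?e "\<lambda>j. T.\<tau> j u" n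
  proof (rule homotopy_setup.intro)
    \<comment> \<open>In degree zero every element is a cycle, so this is exactness there.\<close>
    show "(\<lambda>j. T.\<tau> j u) 0 ` carrier (C 0) \<subseteq> ?e 0 ` carrier (T.tensor_module (Suc 0))"
      using ex[of 0] T.tensor_elem_closed[OF u_closed] by auto
    show "T.\<tau> j u \<in> linear_maps A (C j) (T.tensor_module j)" for j
      by (rule T.tensor_elem_linear[OF u_closed u_central])
    show "?e j (T.\<tau> (Suc j) u c) = T.\<tau> j u (d j c)" if "c \<in> carrier (C (Suc j))" for j c
      by (rule eelem[OF u_closed that])
    show "x \<in> ?e (Suc j) ` carrier (T.tensor_module (Suc (Suc j)))"
      if "Suc j \<le> n" "x \<in> carrier (T.tensor_module (Suc j))" "?e j x = \<zero>\<^bsub>T.tensor_module j\<^esub>" for j x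
      using ex[of "Suc j" x] that by simp
  qed (rule C' e T.left_module_tensor, (assumption)?)+
  have "\<exists>g \<in> linear_maps A (T.tensor_module i) V. \<forall>x \<in> carrier M. \<forall>y \<in> carrier (C i).
      g (T.\<tau> i x y) = pairing x (f y)"
    by (rule T.tensor_linear_universal[OF V.left_module_axioms])
      (simp_all add: linear_mapsD[OF f] pairing_closed pairing_add_left pairing_add_right
        pairing_balanced pairing_lact)
  then obtain g where g: "g \<in> linear_maps A (T.tensor_module i) V"
    and g\<tau>: "\<And>x y. \<lbrakk>x \<in> carrier M; y \<in> carrier (C i)\<rbrakk> \<Longrightarrow> g (T.\<tau> i x y) = pairing x (f y)" by blast
  have gu: "g (T.\<tau> i u c) = f c" if "c \<in> carrier (C i)" for c
    using that u_closed by (simp add: g\<tau> pairing_u linear_mapsD(1)[OF f])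
  \<comment> \<open>Additivity gives \<open>pairing x 0 + pairing x 0 = pairing x 0\<close>, and one
    summand is cancelled.\<close>
  have p0: "pairing x \<zero>\<^bsub>V\<^esub> = \<zero>\<^bsub>V\<^esub>" if "x \<in> carrier M" for x
    using pairing_add_right[of x "\<zero>\<^bsub>V\<^esub>" "\<zero>\<^bsub>V\<^esub>"] pairing_closed[of x "\<zero>\<^bsub>V\<^esub>"] that
      V.M.add.l_cancel_one[of "pairing x \<zero>\<^bsub>V\<^esub>" "pairing x \<zero>\<^bsub>V\<^esub>"] by simp
  have ge: "g (?e i Z) = \<zero>\<^bsub>V\<^esub>" if Z: "Z \<in> carrier (T.T (Suc i))" for Z
  proof -
    have ghom: "g \<in> hom (T.T i) (add_monoid V)"
      using linear_mapsD[OF g] by (simp add: hom_def)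
    \<comment> \<open>On a pure tensor
      \<open>g (x \<otimes> d c) = pairing x (f (d c)) = pairing x 0 = 0\<close>, because
      \<open>f\<close> is a cocycle.\<close>
    have "(g \<circ> ?e i) Z = (\<lambda>_. \<zero>\<^bsub>V\<^esub>) Z"
      by (rule T.tensor_hom_eq[OF V.a_group hom_compose[OF ehom ghom] _ _ Z])
        (use fd p0 in \<open>simp_all add: hom_def eelem g\<tau> linear_mapsD(1)[OF C'(3)]\<close>)
    then show ?thesis by simp
  qed
  show ?thesis
  proof (cases i)
    case 0
    obtain h where h: "h \<in> linear_maps A (C 0) (T.tensor_module (Suc 0))"
      "\<And>c. c \<in> carrier (C 0) \<Longrightarrow> ?e 0 (h c) = T.\<tau> 0 u c"
      using H.homotopy_zero by blast
    \<comment> \<open>The chain \<open>f c = g (u \<otimes> c) = g (?e 0 (h c)) = 0\<close>.\<close>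
    have "f c = \<zero>\<^bsub>V\<^esub>" if "c \<in> carrier (C 0)" for c
      using gu[of c] ge[of "h c"] h(2)[of c] linear_mapsD(1)[OF h(1), of c] that 0 by simp
    then show ?thesis using 0 by simp
  next
    case (Suc j)
    with i have "Suc j \<le> n" by simp
    then obtain h h' where h: "h \<in> linear_maps A (C j) (T.tensor_module (Suc j))"
      and h': "h' \<in> linear_maps A (C (Suc j)) (T.tensor_module (Suc (Suc j)))"
      and hh: "\<And>c. c \<in> carrier (C (Suc j)) \<Longrightarrow>
        T.\<tau> (Suc j) u c = ?e (Suc j) (h' c) \<oplus>\<^bsub>T.tensor_module (Suc j)\<^esub> h (d j c)"
      by (rule H.homotopy_Suc) blast
    have "f c = g (h (d j c))" if c: "c \<in> carrier (C (Suc j))" for c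
    proof -
      have 1: "?e (Suc j) (h' c) \<in> carrier (T.tensor_module (Suc j))"
        by (rule linear_mapsD(1)[OF e linear_mapsD(1)[OF h' c]])
      have 2: "h (d j c) \<in> carrier (T.tensor_module (Suc j))"
        by (rule linear_mapsD(1)[OF h linear_mapsD(1)[OF C'(3) c]])
      have "f c = g (?e (Suc j) (h' c)) \<oplus>\<^bsub>V\<^esub> g (h (d j c))"
        using gu[of c] hh[OF c] linear_mapsD(2)[OF g[unfolded Suc] 1 2] c Suc by simp
      then show ?thesis
        using ge[of "h' c"] linear_mapsD(1)[OF h' c] linear_mapsD(1)[OF g[unfolded Suc] 2] Suc by simp
    qed
    then show ?thesis using linear_maps_comp[OF h g[unfolded Suc]] Suc by auto
  qed
qed

end

text \<open>Let \<open>p\<close> and \<open>q\<close> be comparison maps from \<open>D\<close> to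
  \<open>C\<close> and back. The pullback of \<open>f\<close> along \<open>q\<close> is a cocycle on
  \<open>C\<close>, to which \<open>vanish\<close> applies, and \<open>q \<circ> p\<close> is
  homotopic to the identity of \<open>D\<close>. The splitting
  \<open>f c = f (c - q (p c)) + f (q (p c))\<close> treats the two parts separately.\<close>

lemma cocycle_imp_coboundary_resolution:
  assumes C: "projective_resolution A B C dC \<epsilon>C" and D: "projective_resolution A B D dD \<epsilon>D"
    and B: "left_module A B" and V: "left_module A V"
    and vanish: "\<And>f. \<lbrakk>f \<in> linear_maps A (C i) V; \<And>c. c \<in> carrier (C (Suc i)) \<Longrightarrow> f (dC i c) = \<zero>\<^bsub>V\<^esub>\<rbrakk> \<Longrightarrow>
      (case i of 0 \<Rightarrow> \<forall>c \<in> carrier (C 0). f c = \<zero>\<^bsub>V\<^esub>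
       | Suc j \<Rightarrow> \<exists>k \<in> linear_maps A (C j) V. \<forall>c \<in> carrier (C i). f c = k (dC j c))"
    and f: "f \<in> linear_maps A (D i) V"
    and fd: "\<And>c. c \<in> carrier (D (Suc i)) \<Longrightarrow> f (dD i c) = \<zero>\<^bsub>V\<^esub>"
  shows "case i of 0 \<Rightarrow> \<forall>c \<in> carrier (D 0). f c = \<zero>\<^bsub>V\<^esub>
    | Suc j \<Rightarrow> \<exists>k \<in> linear_maps A (D j) V. \<forall>c \<in> carrier (D i). f c = k (dD j c)"
proof -
  interpret V: left_module A V by (rule V)
  interpret B: left_module A B by (rule B)
  note C' = projective_resolutionD[OF C] and D' = projective_resolutionD[OF D]
  interpret D: left_module A "D j" for j by (rule D')
  obtain p where p: "\<And>j. p j \<in> linear_maps A (D j) (C j)"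
    and pd: "\<And>j c. c \<in> carrier (D (Suc j)) \<Longrightarrow> dC j (p (Suc j) c) = p j (dD j c)"
    and p0: "\<And>c. c \<in> carrier (D 0) \<Longrightarrow> \<epsilon>C (p 0 c) = \<epsilon>D c"
    using resolution_chain_map[OF D C B] by blast
  obtain q where q: "\<And>j. q j \<in> linear_maps A (C j) (D j)"
    and qd: "\<And>j c. c \<in> carrier (C (Suc j)) \<Longrightarrow> dD j (q (Suc j) c) = q j (dC j c)"
    and q0: "\<And>c. c \<in> carrier (C 0) \<Longrightarrow> \<epsilon>D (q 0 c) = \<epsilon>C c"
    using resolution_chain_map[OF C D B] by blast
  let ?t = "\<lambda>j c. c \<ominus>\<^bsub>D j\<^esub> q j (p j c)"
  have id: "(\<lambda>c. c) \<in> linear_maps A (D j) (D j)" for j by (rule linear_mapsI) auto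
  have pc: "p j c \<in> carrier (C j)" if "c \<in> carrier (D j)" for j c
    using linear_mapsD(1)[OF p that] .
  have qc: "q j c \<in> carrier (D j)" if "c \<in> carrier (C j)" for j c
    using linear_mapsD(1)[OF q that] .
  have dc: "dD j c \<in> carrier (D j)" if "c \<in> carrier (D (Suc j))" for j c
    using linear_mapsD(1)[OF D'(3) that] .
  \<comment> \<open>\<open>D\<close> serves both as the projective source and as the exact target;
    exactness is requested up to \<open>i\<close>, the degree of the cocycle.\<close>
  interpret H: homotopy_setup A D dD D dD ?t i
  proof (rule homotopy_setup.intro)
    show "?t j \<in> linear_maps A (D j) (D j)" for j
      by (rule linear_maps_diff_fun[OF D'(2) D'(2) id linear_maps_comp[OF p q]])
    show "dD j (?t (Suc j) c) = ?t j (dD j c)" if c: "c \<in> carrier (D (Suc j))" for j c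
      using c linear_maps_diff[OF D'(2) D'(2) D'(3) c qc[OF pc[OF c]]] by (simp add: qd pc pd)
    \<comment> \<open>Both chain maps preserve the augmentation, so \<open>c - q (p c)\<close> lies
      in the kernel of \<open>\<epsilon>D\<close>, which is the image of
      \<open>dD 0\<close>.\<close>
    show "?t 0 ` carrier (D 0) \<subseteq> dD 0 ` carrier (D (Suc 0))"
    proof (rule image_subsetI)
      fix c assume c: "c \<in> carrier (D 0)"
      have "\<epsilon>D (?t 0 c) = \<epsilon>D c \<ominus>\<^bsub>B\<^esub> \<epsilon>D (q 0 (p 0 c))"
        by (rule linear_maps_diff[OF D'(2) B D'(4) c qc[OF pc[OF c]]])
      also have "\<dots> = \<zero>\<^bsub>B\<^esub>"
        using c linear_mapsD(1)[OF D'(4) c] by (simp add: q0 pc p0 B.M.r_neg B.minus_eq)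
      finally show "?t 0 c \<in> dD 0 ` carrier (D (Suc 0))"
        using c qc[OF pc[OF c]] unfolding D'(6) by simp
    qed
    show "x \<in> dD (Suc j) ` carrier (D (Suc (Suc j)))"
      if "x \<in> carrier (D (Suc j))" "dD j x = \<zero>\<^bsub>D j\<^esub>" for j x
      unfolding D'(7) using that by simp
  qed (rule D', (assumption)?)+
  have fq: "(\<lambda>c. f (q i c)) \<in> linear_maps A (C i) V" by (rule linear_maps_comp[OF q f])
  have "f (q i (dC i c)) = \<zero>\<^bsub>V\<^esub>" if c: "c \<in> carrier (C (Suc i))" for c
    using fd[OF qc[OF c]] by (simp add: qd[OF c, symmetric])
  note v = vanish[OF fq this]
  have split: "f c = f (?t i c) \<oplus>\<^bsub>V\<^esub> f (q i (p i c))" if c: "c \<in> carrier (D i)" for c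
    using linear_maps_diff[OF D'(2) V f c qc[OF pc[OF c]]] c qc[OF pc[OF c]]
    by (simp add: V.minus_eq V.a_assoc V.M.l_neg linear_mapsD(1)[OF f])
  show ?thesis
  proof (cases i)
    case 0
    obtain h where h: "h \<in> linear_maps A (D 0) (D (Suc 0))"
      "\<And>c. c \<in> carrier (D 0) \<Longrightarrow> dD 0 (h c) = ?t 0 c"
      using H.homotopy_zero by blast
    have "f c = \<zero>\<^bsub>V\<^esub>" if c: "c \<in> carrier (D 0)" for c
      using split v fd[of "h c"] h(2)[OF c, symmetric] linear_mapsD(1)[OF h(1) c] c 0 pc[of c 0] by simp
    then show ?thesis using 0 by simp
  next
    case (Suc j)
    obtain h h' where h: "h \<in> linear_maps A (D j) (D (Suc j))"
      and h': "h' \<in> linear_maps A (D (Suc j)) (D (Suc (Suc j)))"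
      and hh: "\<And>c. c \<in> carrier (D (Suc j)) \<Longrightarrow>
        ?t (Suc j) c = dD (Suc j) (h' c) \<oplus>\<^bsub>D (Suc j)\<^esub> h (dD j c)"
      by (rule H.homotopy_Suc[of j]) (use Suc in auto)
    obtain k where k: "k \<in> linear_maps A (C j) V" "\<And>c. c \<in> carrier (C i) \<Longrightarrow> f (q i c) = k (dC j c)"
      using v Suc by auto
    \<comment> \<open>The first summand comes from the homotopy: \<open>f\<close> kills boundaries,
      so \<open>f (?t (Suc j) c) = f (h (dD j c))\<close>. The second comes from \<open>C\<close>:
      \<open>f (q i (p i c)) = k (dC j (p i c)) = k (p j (dD j c))\<close>.\<close>
    let ?k = "\<lambda>c. f (h c) \<oplus>\<^bsub>V\<^esub> k (p j c)"
    have "?k \<in> linear_maps A (D j) V"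
      by (rule linear_maps_add_fun[OF D'(2) V linear_maps_comp[OF h f[unfolded Suc]] linear_maps_comp[OF p k(1)]])
    moreover have "f c = ?k (dD j c)" if c: "c \<in> carrier (D (Suc j))" for c
    proof -
      have "f (?t (Suc j) c) = f (dD (Suc j) (h' c)) \<oplus>\<^bsub>V\<^esub> f (h (dD j c))"
        unfolding hh[OF c]
        by (rule linear_mapsD(2)[OF f[unfolded Suc] dc[OF linear_mapsD(1)[OF h' c]]
              linear_mapsD(1)[OF h dc[OF c]]])
      also have "\<dots> = f (h (dD j c))"
        using fd[of "h' c"] linear_mapsD(1)[OF h' c] Suc
          linear_mapsD(1)[OF f[unfolded Suc] linear_mapsD(1)[OF h dc[OF c]]] by simp
      finally show ?thesis
        using split[of c] k(2)[of "p i c"] c pc[OF c] pd[OF c] Suc by simp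
    qed
    ultimately show ?thesis using Suc by auto
  qed
qed

section \<open>Novikov rings\<close>

lemma (in abelian_monoid) finsum_swap:
  assumes "finite A" "finite B" and f: "\<And>i j. \<lbrakk>i \<in> A; j \<in> B\<rbrakk> \<Longrightarrow> f i j \<in> carrier G"
  shows "(\<Oplus>i\<in>A. \<Oplus>j\<in>B. f i j) = (\<Oplus>j\<in>B. \<Oplus>i\<in>A. f i j)"
  using assms(1) f
proof (induction A)
  case empty
  then show ?case using assms(2) by simp
next
  case (insert a A)
  have "(\<Oplus>i\<in>insert a A. \<Oplus>j\<in>B. f i j) = (\<Oplus>j\<in>B. f a j) \<oplus> (\<Oplus>i\<in>A. \<Oplus>j\<in>B. f i j)"
    using insert by (intro finsum_insert) (auto intro!: finsum_closed)
  also have "\<dots> = (\<Oplus>j\<in>B. f a j \<oplus> (\<Oplus>i\<in>A. f i j))"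
    using insert by (subst finsum_addf) (auto intro!: finsum_closed)
  also have "\<dots> = (\<Oplus>j\<in>B. \<Oplus>i\<in>insert a A. f i j)"
    using insert by (intro finsum_cong') (auto simp: finsum_insert Pi_iff intro!: finsum_closed)
  finally show ?case .
qed

section \<open>Supports, their lower bounds, and convolution\<close>

locale novikov = R: ring R + G: group G
  for R :: "('r, 'k) ring_scheme" and G :: "('g, 'l) monoid_scheme" +
  fixes \<phi> :: "'g \<Rightarrow> real"
  assumes \<phi>_hom: "\<phi> \<in> hom G real_group"
begin

abbreviation "N \<equiv> novikov_ring R G \<phi>"
abbreviation "conv \<equiv> convolution R G"
abbreviation "S \<equiv> supp R G"

lemma \<phi>_mult: "\<lbrakk>g \<in> carrier G; h \<in> carrier G\<rbrakk> \<Longrightarrow> \<phi> (g \<otimes>\<^bsub>G\<^esub> h) = \<phi> g + \<phi> h"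
  using \<phi>_hom by (simp add: hom_def real_group_def)

lemma \<phi>_inv: "g \<in> carrier G \<Longrightarrow> \<phi> (inv\<^bsub>G\<^esub> g) = - \<phi> g"
  using \<phi>_mult[of g "inv\<^bsub>G\<^esub> g"] \<phi>_mult[of "\<one>\<^bsub>G\<^esub>" "\<one>\<^bsub>G\<^esub>"] by simp

lemma novikov_ring_simps [simp]:
  "x \<otimes>\<^bsub>N\<^esub> y = conv x y" "\<one>\<^bsub>N\<^esub> = monomial R G \<one>\<^bsub>G\<^esub> \<one>\<^bsub>R\<^esub>"
  "\<zero>\<^bsub>N\<^esub> = (\<lambda>g\<in>carrier G. \<zero>\<^bsub>R\<^esub>)" "x \<oplus>\<^bsub>N\<^esub> y = (\<lambda>g\<in>carrier G. x g \<oplus>\<^bsub>R\<^esub> y g)"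
  by (simp_all add: novikov_ring_def group_ring_def)

lemma novikov_carrier_iff:
  "x \<in> carrier N \<longleftrightarrow> x \<in> carrier G \<rightarrow>\<^sub>E carrier R \<and> (\<forall>\<kappa>. finite {g \<in> S x. \<phi> g \<le> \<kappa>})"
  by (simp add: novikov_ring_def supp_def conj_assoc)

lemma novikov_finite: "x \<in> carrier N \<Longrightarrow> finite {g \<in> S x. \<phi> g \<le> \<kappa>}"
  by (simp add: novikov_carrier_iff)

lemma novikov_val: "\<lbrakk>x \<in> carrier N; g \<in> carrier G\<rbrakk> \<Longrightarrow> x g \<in> carrier R"
  by (auto simp: novikov_carrier_iff)

lemma novikov_carrierI:
  assumes "\<And>g. g \<in> carrier G \<Longrightarrow> x g \<in> carrier R" "x \<in> extensional (carrier G)"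
    and "\<And>\<kappa>. finite {g \<in> S x. \<phi> g \<le> \<kappa>}"
  shows "x \<in> carrier N"
  using assms by (auto simp: novikov_carrier_iff PiE_def)

lemma novikov_eqI:
  assumes "x \<in> extensional (carrier G)" "y \<in> extensional (carrier G)"
    and "\<And>g. g \<in> carrier G \<Longrightarrow> x g = y g"
  shows "x = y"
  using assms by (rule extensionalityI)

lemma novikov_ext: "x \<in> carrier N \<Longrightarrow> x \<in> extensional (carrier G)"
  by (auto simp: novikov_carrier_iff PiE_def)

lemma group_ring_subset: "carrier (group_ring R G) \<subseteq> carrier N"
  by (auto simp: novikov_carrier_iff group_ring_def)

text \<open>Only finitely many support elements have \<open>\<phi> g \<le> 0\<close>, so their
  values have a minimum. Inserting 0 covers the remaining elements and an empty set.\<close>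

lemma supp_bounded_below:
  assumes "x \<in> carrier N"
  obtains c where "\<And>g. g \<in> S x \<Longrightarrow> c \<le> \<phi> g"
proof
  let ?S = "{g \<in> S x. \<phi> g \<le> 0}"
  fix g assume g: "g \<in> S x"
  have fin: "finite ?S" by (rule novikov_finite[OF assms])
  show "Min (insert 0 (\<phi> ` ?S)) \<le> \<phi> g"
  proof (cases "\<phi> g \<le> 0")
    case True
    then show ?thesis using fin g by (intro Min_le) auto
  next
    case False
    have "Min (insert 0 (\<phi> ` ?S)) \<le> 0" using fin by (intro Min_le) auto
    then show ?thesis using False by simp
  qed
qed

lemma supp_closed: "g \<in> S x \<Longrightarrow> g \<in> carrier G"
  by (simp add: supp_def)

lemma not_supp: "\<lbrakk>g \<in> carrier G; g \<notin> S x\<rbrakk> \<Longrightarrow> x g = \<zero>\<^bsub>R\<^esub>"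
  by (simp add: supp_def)

text \<open>The index set in the definition depends on both supports; terms outside it are zero, so
  any finite superset may replace it. This gives sums from different products a common index
  set.\<close>

lemma convolution_eq:
  assumes x: "x \<in> carrier N" and y: "y \<in> carrier N" and g: "g \<in> carrier G"
    and F: "finite F" "F \<subseteq> carrier G"
    and sub: "\<And>h. \<lbrakk>h \<in> S x; inv\<^bsub>G\<^esub> h \<otimes>\<^bsub>G\<^esub> g \<in> S y\<rbrakk> \<Longrightarrow> h \<in> F"
  shows "conv x y g = (\<Oplus>\<^bsub>R\<^esub>h\<in>F. x h \<otimes>\<^bsub>R\<^esub> y (inv\<^bsub>G\<^esub> h \<otimes>\<^bsub>G\<^esub> g))"
proof -
  have "(\<Oplus>\<^bsub>R\<^esub>h\<in>{h \<in> S x. inv\<^bsub>G\<^esub> h \<otimes>\<^bsub>G\<^esub> g \<in> S y}. x h \<otimes>\<^bsub>R\<^esub> y (inv\<^bsub>G\<^esub> h \<otimes>\<^bsub>G\<^esub> g)) =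
    (\<Oplus>\<^bsub>R\<^esub>h\<in>F. x h \<otimes>\<^bsub>R\<^esub> y (inv\<^bsub>G\<^esub> h \<otimes>\<^bsub>G\<^esub> g))"
  proof (rule R.add.finprod_mono_neutral_cong_left)
    fix h assume h: "h \<in> F - {h \<in> S x. inv\<^bsub>G\<^esub> h \<otimes>\<^bsub>G\<^esub> g \<in> S y}"
    then have hG: "h \<in> carrier G" using F by auto
    then have k: "inv\<^bsub>G\<^esub> h \<otimes>\<^bsub>G\<^esub> g \<in> carrier G" using g by simp
    from h consider "h \<notin> S x" | "inv\<^bsub>G\<^esub> h \<otimes>\<^bsub>G\<^esub> g \<notin> S y" by auto
    then show "x h \<otimes>\<^bsub>R\<^esub> y (inv\<^bsub>G\<^esub> h \<otimes>\<^bsub>G\<^esub> g) = \<zero>\<^bsub>R\<^esub>"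
      using not_supp[OF hG, of x] not_supp[OF k, of y] novikov_val[OF x hG] novikov_val[OF y k]
      by cases auto
  qed (use F sub g novikov_val[OF x] novikov_val[OF y] in auto)
  then show ?thesis using g by (simp add: convolution_def)
qed

lemma convolution_ext: "conv x y \<in> extensional (carrier G)"
  by (simp add: convolution_def)

text \<open>If \<open>b\<close> bounds \<open>\<phi>\<close> from below on the support of
  \<open>y\<close>, an index \<open>h\<close> satisfies \<open>\<phi> h \<le> \<phi> g - b\<close>,
  which leaves finitely many elements in the support of \<open>x\<close>.\<close>

lemma convolution_set_finite:
  assumes x: "x \<in> carrier N" and y: "y \<in> carrier N" and g: "g \<in> carrier G"
  shows "finite {h \<in> S x. inv\<^bsub>G\<^esub> h \<otimes>\<^bsub>G\<^esub> g \<in> S y}"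
proof -
  obtain b where b: "\<And>g. g \<in> S y \<Longrightarrow> b \<le> \<phi> g" using supp_bounded_below[OF y] by blast
  have "h \<in> {h \<in> S x. \<phi> h \<le> \<phi> g - b}" if h: "h \<in> S x" "inv\<^bsub>G\<^esub> h \<otimes>\<^bsub>G\<^esub> g \<in> S y" for h
    using b[OF h(2)] supp_closed[OF h(1)] g h(1) by (simp add: \<phi>_mult \<phi>_inv)
  then show ?thesis by (intro finite_subset[OF _ novikov_finite[OF x, of "\<phi> g - b"]]) blast
qed

lemma convolution_nonzeroE:
  assumes "g \<in> S (conv x y)"
  obtains h where "h \<in> S x" "inv\<^bsub>G\<^esub> h \<otimes>\<^bsub>G\<^esub> g \<in> S y"
proof -
  have g: "g \<in> carrier G" "conv x y g \<noteq> \<zero>\<^bsub>R\<^esub>" using assms by (auto simp: supp_def)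
  have "{h \<in> S x. inv\<^bsub>G\<^esub> h \<otimes>\<^bsub>G\<^esub> g \<in> S y} \<noteq> {}"
  proof
    assume e: "{h \<in> S x. inv\<^bsub>G\<^esub> h \<otimes>\<^bsub>G\<^esub> g \<in> S y} = {}"
    have "conv x y g = \<zero>\<^bsub>R\<^esub>" using g(1) unfolding convolution_def by (simp add: e)
    then show False using g(2) by simp
  qed
  then show thesis using that by blast
qed

lemma convolution_closed:
  assumes x: "x \<in> carrier N" and y: "y \<in> carrier N"
  shows "conv x y \<in> carrier N"
proof (rule novikov_carrierI)
  show "conv x y g \<in> carrier R" if g: "g \<in> carrier G" for g
    using g novikov_val[OF x] novikov_val[OF y] supp_closed
    by (auto simp: convolution_def intro!: R.finsum_closed)
  show "conv x y \<in> extensional (carrier G)" by (rule convolution_ext)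
  fix \<kappa>
  obtain a where a: "\<And>g. g \<in> S x \<Longrightarrow> a \<le> \<phi> g" using supp_bounded_below[OF x] by blast
  obtain b where b: "\<And>g. g \<in> S y \<Longrightarrow> b \<le> \<phi> g" using supp_bounded_below[OF y] by blast
  \<comment> \<open>An element of the support with \<open>\<phi> g \<le> \<kappa>\<close> is a
    product \<open>h k\<close> with \<open>\<phi> h + \<phi> k \<le> \<kappa>\<close>; the lower
    bound on either factor bounds the other from above.\<close>
  let ?X = "{h \<in> S x. \<phi> h \<le> \<kappa> - b}" and ?Y = "{k \<in> S y. \<phi> k \<le> \<kappa> - a}"
  have "g \<in> (\<lambda>(h, k). h \<otimes>\<^bsub>G\<^esub> k) ` (?X \<times> ?Y)" if g: "g \<in> S (conv x y)" "\<phi> g \<le> \<kappa>" for g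
  proof -
    obtain h where h: "h \<in> S x" "inv\<^bsub>G\<^esub> h \<otimes>\<^bsub>G\<^esub> g \<in> S y" by (rule convolution_nonzeroE[OF g(1)])
    have gh: "g \<in> carrier G" "h \<in> carrier G" using h g supp_closed by auto
    then have "\<phi> (inv\<^bsub>G\<^esub> h \<otimes>\<^bsub>G\<^esub> g) = \<phi> g - \<phi> h" by (simp add: \<phi>_mult \<phi>_inv)
    then have "(h, inv\<^bsub>G\<^esub> h \<otimes>\<^bsub>G\<^esub> g) \<in> ?X \<times> ?Y" using a[OF h(1)] b[OF h(2)] h g(2) by simp
    moreover have "g = (\<lambda>(h, k). h \<otimes>\<^bsub>G\<^esub> k) (h, inv\<^bsub>G\<^esub> h \<otimes>\<^bsub>G\<^esub> g)"
      using gh by (simp add: G.m_assoc[symmetric])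
    ultimately show ?thesis by (rule rev_image_eqI)
  qed
  then have "{g \<in> S (conv x y). \<phi> g \<le> \<kappa>} \<subseteq> (\<lambda>(h, k). h \<otimes>\<^bsub>G\<^esub> k) ` (?X \<times> ?Y)" by blast
  then show "finite {g \<in> S (conv x y). \<phi> g \<le> \<kappa>}"
    by (rule finite_subset) (intro finite_imageI finite_cartesian_product novikov_finite x y)
qed

text \<open>Both sides expand to one double sum of \<open>x h \<otimes> y (h\<^sup>-\<^sup>1 w)
  \<otimes> z (w\<^sup>-\<^sup>1 g)\<close>. The sums may be interchanged once \<open>h\<close> and
  \<open>w\<close> range over fixed finite sets, which the lower bounds on the supports
  provide.\<close>

lemma convolution_assoc:
  assumes x: "x \<in> carrier N" and y: "y \<in> carrier N" and z: "z \<in> carrier N"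
  shows "conv (conv x y) z = conv x (conv y z)"
proof (rule novikov_eqI)
  fix g assume g: "g \<in> carrier G"
  obtain a where a: "\<And>g. g \<in> S x \<Longrightarrow> a \<le> \<phi> g" using supp_bounded_below[OF x] by blast
  obtain b where b: "\<And>g. g \<in> S y \<Longrightarrow> b \<le> \<phi> g" using supp_bounded_below[OF y] by blast
  obtain c where c: "\<And>g. g \<in> S z \<Longrightarrow> c \<le> \<phi> g" using supp_bounded_below[OF z] by blast
  \<comment> \<open>Contributions at \<open>g\<close> come from factorisations
    \<open>g = h k l\<close> over the three supports. As \<open>\<phi>\<close> is additive, lower
    bounds on two factors bound the third from above. \<open>W\<close> collects the partial products
    \<open>w = h k\<close>.\<close>
  define X where "X = {h \<in> S x. \<phi> h \<le> \<phi> g - b - c}"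
  define Y where "Y = {k \<in> S y. \<phi> k \<le> \<phi> g - a - c}"
  define W where "W = (\<lambda>(h, k). h \<otimes>\<^bsub>G\<^esub> k) ` (X \<times> Y)"
  have fin: "finite X" "finite Y" "finite W"
    unfolding X_def Y_def W_def
    by (intro finite_imageI finite_cartesian_product novikov_finite x y)+
  have sub: "X \<subseteq> carrier G" "Y \<subseteq> carrier G" using supp_closed by (auto simp: X_def Y_def)
  then have subW: "W \<subseteq> carrier G" by (auto simp: W_def)
  have XY: "h \<in> X \<and> k \<in> Y" if "h \<in> S x" "k \<in> S y" "inv\<^bsub>G\<^esub> (h \<otimes>\<^bsub>G\<^esub> k) \<otimes>\<^bsub>G\<^esub> g \<in> S z" for h k
  proof -
    have "h \<in> carrier G" "k \<in> carrier G" using that supp_closed by auto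
    then have "\<phi> (inv\<^bsub>G\<^esub> (h \<otimes>\<^bsub>G\<^esub> k) \<otimes>\<^bsub>G\<^esub> g) = \<phi> g - \<phi> h - \<phi> k" using g by (simp add: \<phi>_mult \<phi>_inv)
    then show ?thesis using a[OF that(1)] b[OF that(2)] c[OF that(3)] that by (simp add: X_def Y_def)
  qed
  have XW: "h \<in> X \<and> inv\<^bsub>G\<^esub> h \<otimes>\<^bsub>G\<^esub> w \<in> Y \<and> w \<in> W"
    if "h \<in> S x" "inv\<^bsub>G\<^esub> h \<otimes>\<^bsub>G\<^esub> w \<in> S y" "inv\<^bsub>G\<^esub> w \<otimes>\<^bsub>G\<^esub> g \<in> S z" "w \<in> carrier G" for h w
  proof -
    have h: "h \<in> carrier G" using that supp_closed by auto
    have w: "w = h \<otimes>\<^bsub>G\<^esub> (inv\<^bsub>G\<^esub> h \<otimes>\<^bsub>G\<^esub> w)" using h that(4) by (simp add: G.m_assoc[symmetric])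
    then have *: "h \<in> X \<and> inv\<^bsub>G\<^esub> h \<otimes>\<^bsub>G\<^esub> w \<in> Y" using XY[of h "inv\<^bsub>G\<^esub> h \<otimes>\<^bsub>G\<^esub> w"] that by simp
    have "w \<in> W"
      unfolding W_def by (rule rev_image_eqI[of "(h, inv\<^bsub>G\<^esub> h \<otimes>\<^bsub>G\<^esub> w)"]) (use * w in simp_all)
    with * show ?thesis by simp
  qed
  let ?f = "\<lambda>h w. x h \<otimes>\<^bsub>R\<^esub> y (inv\<^bsub>G\<^esub> h \<otimes>\<^bsub>G\<^esub> w) \<otimes>\<^bsub>R\<^esub> z (inv\<^bsub>G\<^esub> w \<otimes>\<^bsub>G\<^esub> g)"
  have xv: "x h \<in> carrier R" and yv: "y h \<in> carrier R" and zv: "z h \<in> carrier R"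
    if "h \<in> carrier G" for h
    using novikov_val that x y z by auto
  have "conv (conv x y) z g = (\<Oplus>\<^bsub>R\<^esub>w\<in>W. conv x y w \<otimes>\<^bsub>R\<^esub> z (inv\<^bsub>G\<^esub> w \<otimes>\<^bsub>G\<^esub> g))"
  proof (rule convolution_eq[OF convolution_closed[OF x y] z g fin(3) subW])
    fix w assume w: "w \<in> S (conv x y)" "inv\<^bsub>G\<^esub> w \<otimes>\<^bsub>G\<^esub> g \<in> S z"
    obtain h where "h \<in> S x" "inv\<^bsub>G\<^esub> h \<otimes>\<^bsub>G\<^esub> w \<in> S y" by (rule convolution_nonzeroE[OF w(1)])
    then show "w \<in> W" using XW w(2) supp_closed[OF w(1)] by blast
  qed
  also have "\<dots> = (\<Oplus>\<^bsub>R\<^esub>w\<in>W. \<Oplus>\<^bsub>R\<^esub>h\<in>X. ?f h w)"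
  proof (rule R.finsum_cong')
    show "(\<lambda>w. \<Oplus>\<^bsub>R\<^esub>h\<in>X. ?f h w) \<in> W \<rightarrow> carrier R"
      using xv yv zv sub subW g by (auto intro!: R.finsum_closed simp: subset_iff)
    fix w assume "w \<in> W"
    then have w: "w \<in> carrier G" using subW by auto
    then have k: "inv\<^bsub>G\<^esub> w \<otimes>\<^bsub>G\<^esub> g \<in> carrier G" using g by simp
    have xy: "(\<lambda>h. x h \<otimes>\<^bsub>R\<^esub> y (inv\<^bsub>G\<^esub> h \<otimes>\<^bsub>G\<^esub> w)) \<in> X \<rightarrow> carrier R"
      using xv yv sub w by (auto simp: subset_iff)
    have "(\<Oplus>\<^bsub>R\<^esub>h\<in>X. ?f h w) = (\<Oplus>\<^bsub>R\<^esub>h\<in>X. x h \<otimes>\<^bsub>R\<^esub> y (inv\<^bsub>G\<^esub> h \<otimes>\<^bsub>G\<^esub> w)) \<otimes>\<^bsub>R\<^esub> z (inv\<^bsub>G\<^esub> w \<otimes>\<^bsub>G\<^esub> g)"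
      by (rule R.finsum_ldistr[OF fin(1) zv[OF k] xy, symmetric])
    also have "\<dots> = conv x y w \<otimes>\<^bsub>R\<^esub> z (inv\<^bsub>G\<^esub> w \<otimes>\<^bsub>G\<^esub> g)"
    \<comment> \<open>\<open>X\<close> is sure to contain every contributing \<open>h\<close> only
      when the factor from \<open>z\<close> is nonzero; otherwise that factor makes both sides
      vanish.\<close>
    proof (cases "inv\<^bsub>G\<^esub> w \<otimes>\<^bsub>G\<^esub> g \<in> S z")
      case True
      then show ?thesis using convolution_eq[OF x y w fin(1) sub(1)] XW w by simp
    next
      case False
      then show ?thesis
        using not_supp[OF k False] novikov_val[OF convolution_closed[OF x y] w] R.finsum_closed[OF xy]
        by simp
    qed
    finally show "conv x y w \<otimes>\<^bsub>R\<^esub> z (inv\<^bsub>G\<^esub> w \<otimes>\<^bsub>G\<^esub> g) = (\<Oplus>\<^bsub>R\<^esub>h\<in>X. ?f h w)" by simp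
  qed simp
  also have "\<dots> = (\<Oplus>\<^bsub>R\<^esub>h\<in>X. \<Oplus>\<^bsub>R\<^esub>w\<in>W. ?f h w)"
    by (rule R.finsum_swap[OF fin(3) fin(1)]) (use xv yv zv sub subW g in \<open>auto simp: subset_iff\<close>)
  also have "\<dots> = (\<Oplus>\<^bsub>R\<^esub>h\<in>X. x h \<otimes>\<^bsub>R\<^esub> conv y z (inv\<^bsub>G\<^esub> h \<otimes>\<^bsub>G\<^esub> g))"
  proof (rule R.finsum_cong')
    show "(\<lambda>h. x h \<otimes>\<^bsub>R\<^esub> conv y z (inv\<^bsub>G\<^esub> h \<otimes>\<^bsub>G\<^esub> g)) \<in> X \<rightarrow> carrier R"
      using xv novikov_val[OF convolution_closed[OF y z]] sub g by (auto simp: subset_iff)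
    fix h assume "h \<in> X"
    then have h: "h \<in> carrier G" and hX: "h \<in> S x" using sub by (auto simp: X_def)
    have inj: "inj_on (\<lambda>w. inv\<^bsub>G\<^esub> h \<otimes>\<^bsub>G\<^esub> w) W"
      using subW h by (intro inj_onI) (auto simp: subset_iff)
    have e: "inv\<^bsub>G\<^esub> (inv\<^bsub>G\<^esub> h \<otimes>\<^bsub>G\<^esub> w) \<otimes>\<^bsub>G\<^esub> (inv\<^bsub>G\<^esub> h \<otimes>\<^bsub>G\<^esub> g) = inv\<^bsub>G\<^esub> w \<otimes>\<^bsub>G\<^esub> g"
      if "w \<in> carrier G" for w
    proof -
      have "inv\<^bsub>G\<^esub> (inv\<^bsub>G\<^esub> h \<otimes>\<^bsub>G\<^esub> w) \<otimes>\<^bsub>G\<^esub> (inv\<^bsub>G\<^esub> h \<otimes>\<^bsub>G\<^esub> g) =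
          inv\<^bsub>G\<^esub> w \<otimes>\<^bsub>G\<^esub> (h \<otimes>\<^bsub>G\<^esub> (inv\<^bsub>G\<^esub> h \<otimes>\<^bsub>G\<^esub> g))"
        using h g that by (simp add: G.inv_mult_group G.m_assoc)
      also have "h \<otimes>\<^bsub>G\<^esub> (inv\<^bsub>G\<^esub> h \<otimes>\<^bsub>G\<^esub> g) = g" using h g by (simp add: G.m_assoc[symmetric])
      finally show ?thesis .
    qed
    \<comment> \<open>The substitution \<open>k = h\<^sup>-\<^sup>1 w\<close> makes a translate of
      \<open>W\<close> the index set; it contains every contributing \<open>k\<close> because then
      \<open>h k\<close> lies in \<open>W\<close>.\<close>
    have "conv y z (inv\<^bsub>G\<^esub> h \<otimes>\<^bsub>G\<^esub> g) = (\<Oplus>\<^bsub>R\<^esub>k\<in>(\<lambda>w. inv\<^bsub>G\<^esub> h \<otimes>\<^bsub>G\<^esub> w) ` W.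
        y k \<otimes>\<^bsub>R\<^esub> z (inv\<^bsub>G\<^esub> k \<otimes>\<^bsub>G\<^esub> (inv\<^bsub>G\<^esub> h \<otimes>\<^bsub>G\<^esub> g)))"
    proof (rule convolution_eq[OF y z])
      fix k assume k: "k \<in> S y" "inv\<^bsub>G\<^esub> k \<otimes>\<^bsub>G\<^esub> (inv\<^bsub>G\<^esub> h \<otimes>\<^bsub>G\<^esub> g) \<in> S z"
      have kG: "k \<in> carrier G" by (rule supp_closed[OF k(1)])
      have "inv\<^bsub>G\<^esub> (h \<otimes>\<^bsub>G\<^esub> k) \<otimes>\<^bsub>G\<^esub> g \<in> S z"
        using k(2) kG h g by (simp add: G.inv_mult_group G.m_assoc)
      then have "h \<in> X \<and> k \<in> Y" using XY hX k(1) by blast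
      then have "h \<otimes>\<^bsub>G\<^esub> k \<in> W" unfolding W_def by (auto intro!: rev_image_eqI[of "(h, k)"])
      then show "k \<in> (\<lambda>w. inv\<^bsub>G\<^esub> h \<otimes>\<^bsub>G\<^esub> w) ` W"
        by (rule rev_image_eqI) (use h kG in \<open>simp add: G.m_assoc[symmetric]\<close>)
    qed (use h g fin(3) subW in auto)
    also have "\<dots> = (\<Oplus>\<^bsub>R\<^esub>w\<in>W. y (inv\<^bsub>G\<^esub> h \<otimes>\<^bsub>G\<^esub> w) \<otimes>\<^bsub>R\<^esub>
        z (inv\<^bsub>G\<^esub> (inv\<^bsub>G\<^esub> h \<otimes>\<^bsub>G\<^esub> w) \<otimes>\<^bsub>G\<^esub> (inv\<^bsub>G\<^esub> h \<otimes>\<^bsub>G\<^esub> g)))"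
      using inj yv zv subW h g by (intro R.finsum_reindex) (auto simp: subset_iff)
    also have "\<dots> = (\<Oplus>\<^bsub>R\<^esub>w\<in>W. y (inv\<^bsub>G\<^esub> h \<otimes>\<^bsub>G\<^esub> w) \<otimes>\<^bsub>R\<^esub> z (inv\<^bsub>G\<^esub> w \<otimes>\<^bsub>G\<^esub> g))"
      using yv zv subW h g e by (intro R.finsum_cong') (auto simp: subset_iff)
    finally have "x h \<otimes>\<^bsub>R\<^esub> conv y z (inv\<^bsub>G\<^esub> h \<otimes>\<^bsub>G\<^esub> g) =
        (\<Oplus>\<^bsub>R\<^esub>w\<in>W. x h \<otimes>\<^bsub>R\<^esub> (y (inv\<^bsub>G\<^esub> h \<otimes>\<^bsub>G\<^esub> w) \<otimes>\<^bsub>R\<^esub> z (inv\<^bsub>G\<^esub> w \<otimes>\<^bsub>G\<^esub> g)))"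
      using fin(3) xv yv zv subW h g by (simp add: R.finsum_rdistr subset_iff Pi_iff)
    also have "\<dots> = (\<Oplus>\<^bsub>R\<^esub>w\<in>W. ?f h w)"
      using xv yv zv subW h g by (intro R.finsum_cong') (auto simp: subset_iff R.m_assoc)
    finally show "(\<Oplus>\<^bsub>R\<^esub>w\<in>W. ?f h w) = x h \<otimes>\<^bsub>R\<^esub> conv y z (inv\<^bsub>G\<^esub> h \<otimes>\<^bsub>G\<^esub> g)" by simp
  qed simp
  also have "\<dots> = conv x (conv y z) g"
  proof (rule convolution_eq[OF x convolution_closed[OF y z] g fin(1) sub(1), symmetric])
    fix h assume h: "h \<in> S x" "inv\<^bsub>G\<^esub> h \<otimes>\<^bsub>G\<^esub> g \<in> S (conv y z)"
    obtain k where k: "k \<in> S y" "inv\<^bsub>G\<^esub> k \<otimes>\<^bsub>G\<^esub> (inv\<^bsub>G\<^esub> h \<otimes>\<^bsub>G\<^esub> g) \<in> S z"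
      by (rule convolution_nonzeroE[OF h(2)])
    have "inv\<^bsub>G\<^esub> (h \<otimes>\<^bsub>G\<^esub> k) \<otimes>\<^bsub>G\<^esub> g \<in> S z"
      using k supp_closed[OF k(1)] supp_closed[OF h(1)] g by (simp add: G.inv_mult_group G.m_assoc)
    then show "h \<in> X" using XY h(1) k(1) by blast
  qed
  finally show "conv (conv x y) z g = conv x (conv y z) g" .
qed (simp_all add: convolution_ext)

section \<open>Addition, monomials and the ring axioms\<close>

lemma novikov_add_closed:
  assumes x: "x \<in> carrier N" and y: "y \<in> carrier N"
  shows "x \<oplus>\<^bsub>N\<^esub> y \<in> carrier N"
proof (rule novikov_carrierI)
  fix \<kappa>
  have "g \<in> S x \<or> g \<in> S y" if "g \<in> S (x \<oplus>\<^bsub>N\<^esub> y)" for g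
    using that by (auto simp: supp_def)
  then have "{g \<in> S (x \<oplus>\<^bsub>N\<^esub> y). \<phi> g \<le> \<kappa>} \<subseteq> {g \<in> S x. \<phi> g \<le> \<kappa>} \<union> {g \<in> S y. \<phi> g \<le> \<kappa>}"
    by blast
  then show "finite {g \<in> S (x \<oplus>\<^bsub>N\<^esub> y). \<phi> g \<le> \<kappa>}"
    by (rule finite_subset) (intro finite_UnI novikov_finite x y)
qed (use novikov_val x y in auto)

lemma novikov_uminus_closed:
  assumes x: "x \<in> carrier N" shows "(\<lambda>g\<in>carrier G. \<ominus>\<^bsub>R\<^esub> x g) \<in> carrier N"
proof (rule novikov_carrierI)
  fix \<kappa>
  have "{g \<in> S (\<lambda>g\<in>carrier G. \<ominus>\<^bsub>R\<^esub> x g). \<phi> g \<le> \<kappa>} \<subseteq> {g \<in> S x. \<phi> g \<le> \<kappa>}"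
    by (auto simp: supp_def)
  then show "finite {g \<in> S (\<lambda>g\<in>carrier G. \<ominus>\<^bsub>R\<^esub> x g). \<phi> g \<le> \<kappa>}"
    by (rule finite_subset) (rule novikov_finite[OF x])
qed (use novikov_val x in auto)

lemma monomial_closed:
  assumes "r \<in> carrier R" shows "monomial R G g r \<in> carrier N"
proof (rule novikov_carrierI)
  fix \<kappa>
  show "finite {h \<in> S (monomial R G g r). \<phi> h \<le> \<kappa>}"
    by (rule finite_subset[of _ "{g}"]) (auto simp: supp_def monomial_def)
qed (use assms in \<open>auto simp: monomial_def\<close>)

lemma convolution_monomial_left:
  assumes x: "x \<in> carrier N" and r: "r \<in> carrier R" and k: "k \<in> carrier G" and g: "g \<in> carrier G"
  shows "conv (monomial R G k r) x g = r \<otimes>\<^bsub>R\<^esub> x (inv\<^bsub>G\<^esub> k \<otimes>\<^bsub>G\<^esub> g)"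
proof -
  have "conv (monomial R G k r) x g =
      (\<Oplus>\<^bsub>R\<^esub>h\<in>{k}. monomial R G k r h \<otimes>\<^bsub>R\<^esub> x (inv\<^bsub>G\<^esub> h \<otimes>\<^bsub>G\<^esub> g))"
    by (rule convolution_eq[OF monomial_closed[OF r] x g])
      (use k in \<open>auto simp: supp_def monomial_def split: if_splits\<close>)
  then show ?thesis
    using r k g novikov_val[OF x, of "inv\<^bsub>G\<^esub> k \<otimes>\<^bsub>G\<^esub> g"] by (simp add: R.finsum_insert monomial_def)
qed

lemma convolution_monomial_one_right:
  assumes x: "x \<in> carrier N" and r: "r \<in> carrier R" and g: "g \<in> carrier G"
  shows "conv x (monomial R G \<one>\<^bsub>G\<^esub> r) g = x g \<otimes>\<^bsub>R\<^esub> r"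
proof -
  have "conv x (monomial R G \<one>\<^bsub>G\<^esub> r) g =
      (\<Oplus>\<^bsub>R\<^esub>h\<in>{g}. x h \<otimes>\<^bsub>R\<^esub> monomial R G \<one>\<^bsub>G\<^esub> r (inv\<^bsub>G\<^esub> h \<otimes>\<^bsub>G\<^esub> g))"
  proof (rule convolution_eq[OF x monomial_closed[OF r] g])
    fix h assume h: "h \<in> S x" "inv\<^bsub>G\<^esub> h \<otimes>\<^bsub>G\<^esub> g \<in> S (monomial R G \<one>\<^bsub>G\<^esub> r)"
    then have "h \<in> carrier G" "inv\<^bsub>G\<^esub> h \<otimes>\<^bsub>G\<^esub> g = \<one>\<^bsub>G\<^esub>"
      by (auto simp: supp_def monomial_def split: if_splits)
    then have "g = h" using g by (metis G.inv_closed G.inv_equality G.inv_inv)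
    then show "h \<in> {g}" by simp
  qed (use g in auto)
  then show ?thesis
    using r g novikov_val[OF x g] by (simp add: R.finsum_insert monomial_def)
qed

lemma convolution_distrib_left:
  assumes x: "x \<in> carrier N" and y: "y \<in> carrier N" and z: "z \<in> carrier N"
  shows "conv x (y \<oplus>\<^bsub>N\<^esub> z) = conv x y \<oplus>\<^bsub>N\<^esub> conv x z"
proof (rule novikov_eqI)
  fix g assume g: "g \<in> carrier G"
  let ?yz = "y \<oplus>\<^bsub>N\<^esub> z"
  let ?X = "\<lambda>y. {h \<in> S x. inv\<^bsub>G\<^esub> h \<otimes>\<^bsub>G\<^esub> g \<in> S y}"
  \<comment> \<open>Including the index set for \<open>?yz\<close> makes
    \<open>convolution_eq\<close> applicable to all three products at once, without comparing
    supports.\<close>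
  let ?F = "?X y \<union> ?X z \<union> ?X ?yz"
  have yz: "?yz \<in> carrier N" by (rule novikov_add_closed[OF y z])
  have F: "finite ?F" "?F \<subseteq> carrier G"
    using convolution_set_finite[OF x _ g] y z yz supp_closed by blast+
  have v: "x h \<in> carrier R" "y (inv\<^bsub>G\<^esub> h \<otimes>\<^bsub>G\<^esub> g) \<in> carrier R" "z (inv\<^bsub>G\<^esub> h \<otimes>\<^bsub>G\<^esub> g) \<in> carrier R"
    if "h \<in> ?F" for h
  proof -
    have "h \<in> carrier G" using that F by blast
    then show "x h \<in> carrier R" "y (inv\<^bsub>G\<^esub> h \<otimes>\<^bsub>G\<^esub> g) \<in> carrier R" "z (inv\<^bsub>G\<^esub> h \<otimes>\<^bsub>G\<^esub> g) \<in> carrier R"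
      using g by (auto intro!: novikov_val x y z)
  qed
  have "conv x ?yz g = (\<Oplus>\<^bsub>R\<^esub>h\<in>?F. x h \<otimes>\<^bsub>R\<^esub> ?yz (inv\<^bsub>G\<^esub> h \<otimes>\<^bsub>G\<^esub> g))"
    by (rule convolution_eq[OF x yz g F]) blast
  also have "\<dots> = (\<Oplus>\<^bsub>R\<^esub>h\<in>?F. x h \<otimes>\<^bsub>R\<^esub> y (inv\<^bsub>G\<^esub> h \<otimes>\<^bsub>G\<^esub> g) \<oplus>\<^bsub>R\<^esub> x h \<otimes>\<^bsub>R\<^esub> z (inv\<^bsub>G\<^esub> h \<otimes>\<^bsub>G\<^esub> g))"
  proof (rule R.finsum_cong')
    fix h assume h: "h \<in> ?F"
    then have "inv\<^bsub>G\<^esub> h \<otimes>\<^bsub>G\<^esub> g \<in> carrier G" using F g by blast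
    then show "x h \<otimes>\<^bsub>R\<^esub> ?yz (inv\<^bsub>G\<^esub> h \<otimes>\<^bsub>G\<^esub> g) =
        x h \<otimes>\<^bsub>R\<^esub> y (inv\<^bsub>G\<^esub> h \<otimes>\<^bsub>G\<^esub> g) \<oplus>\<^bsub>R\<^esub> x h \<otimes>\<^bsub>R\<^esub> z (inv\<^bsub>G\<^esub> h \<otimes>\<^bsub>G\<^esub> g)"
      using v[OF h] by (simp add: R.r_distr)
  qed (use v in blast)+
  also have "\<dots> = (\<Oplus>\<^bsub>R\<^esub>h\<in>?F. x h \<otimes>\<^bsub>R\<^esub> y (inv\<^bsub>G\<^esub> h \<otimes>\<^bsub>G\<^esub> g)) \<oplus>\<^bsub>R\<^esub>
      (\<Oplus>\<^bsub>R\<^esub>h\<in>?F. x h \<otimes>\<^bsub>R\<^esub> z (inv\<^bsub>G\<^esub> h \<otimes>\<^bsub>G\<^esub> g))"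
    by (rule R.finsum_addf) (use v in blast)+
  also have "\<dots> = conv x y g \<oplus>\<^bsub>R\<^esub> conv x z g"
    using convolution_eq[OF x y g F] convolution_eq[OF x z g F] by simp
  finally show "conv x ?yz g = (conv x y \<oplus>\<^bsub>N\<^esub> conv x z) g" using g by simp
qed (simp_all add: convolution_ext)

lemma convolution_distrib_right:
  assumes x: "x \<in> carrier N" and y: "y \<in> carrier N" and z: "z \<in> carrier N"
  shows "conv (y \<oplus>\<^bsub>N\<^esub> z) x = conv y x \<oplus>\<^bsub>N\<^esub> conv z x"
proof (rule novikov_eqI)
  fix g assume g: "g \<in> carrier G"
  let ?yz = "y \<oplus>\<^bsub>N\<^esub> z"
  let ?X = "\<lambda>y. {h \<in> S y. inv\<^bsub>G\<^esub> h \<otimes>\<^bsub>G\<^esub> g \<in> S x}"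
  let ?F = "?X y \<union> ?X z \<union> ?X ?yz"
  have yz: "?yz \<in> carrier N" by (rule novikov_add_closed[OF y z])
  have F: "finite ?F" "?F \<subseteq> carrier G"
    using convolution_set_finite[OF _ x g] y z yz supp_closed by blast+
  have v: "x (inv\<^bsub>G\<^esub> h \<otimes>\<^bsub>G\<^esub> g) \<in> carrier R" "y h \<in> carrier R" "z h \<in> carrier R"
    if "h \<in> ?F" for h
  proof -
    have "h \<in> carrier G" using that F by blast
    then show "x (inv\<^bsub>G\<^esub> h \<otimes>\<^bsub>G\<^esub> g) \<in> carrier R" "y h \<in> carrier R" "z h \<in> carrier R"
      using g by (auto intro!: novikov_val x y z)
  qed
  have "conv ?yz x g = (\<Oplus>\<^bsub>R\<^esub>h\<in>?F. ?yz h \<otimes>\<^bsub>R\<^esub> x (inv\<^bsub>G\<^esub> h \<otimes>\<^bsub>G\<^esub> g))"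
    by (rule convolution_eq[OF yz x g F]) blast
  also have "\<dots> = (\<Oplus>\<^bsub>R\<^esub>h\<in>?F. y h \<otimes>\<^bsub>R\<^esub> x (inv\<^bsub>G\<^esub> h \<otimes>\<^bsub>G\<^esub> g) \<oplus>\<^bsub>R\<^esub> z h \<otimes>\<^bsub>R\<^esub> x (inv\<^bsub>G\<^esub> h \<otimes>\<^bsub>G\<^esub> g))"
  proof (rule R.finsum_cong')
    fix h assume h: "h \<in> ?F"
    then have "h \<in> carrier G" using F g by blast
    then show "?yz h \<otimes>\<^bsub>R\<^esub> x (inv\<^bsub>G\<^esub> h \<otimes>\<^bsub>G\<^esub> g) =
        y h \<otimes>\<^bsub>R\<^esub> x (inv\<^bsub>G\<^esub> h \<otimes>\<^bsub>G\<^esub> g) \<oplus>\<^bsub>R\<^esub> z h \<otimes>\<^bsub>R\<^esub> x (inv\<^bsub>G\<^esub> h \<otimes>\<^bsub>G\<^esub> g)"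
      using v[OF h] by (simp add: R.l_distr)
  qed (use v in blast)+
  also have "\<dots> = (\<Oplus>\<^bsub>R\<^esub>h\<in>?F. y h \<otimes>\<^bsub>R\<^esub> x (inv\<^bsub>G\<^esub> h \<otimes>\<^bsub>G\<^esub> g)) \<oplus>\<^bsub>R\<^esub>
      (\<Oplus>\<^bsub>R\<^esub>h\<in>?F. z h \<otimes>\<^bsub>R\<^esub> x (inv\<^bsub>G\<^esub> h \<otimes>\<^bsub>G\<^esub> g))"
    by (rule R.finsum_addf) (use v in blast)+
  also have "\<dots> = conv y x g \<oplus>\<^bsub>R\<^esub> conv z x g"
    using convolution_eq[OF y x g F] convolution_eq[OF z x g F] by simp
  finally show "conv ?yz x g = (conv y x \<oplus>\<^bsub>N\<^esub> conv z x) g" using g by simp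
qed (simp_all add: convolution_ext)

lemma ring_novikov: "ring N"
proof (rule ringI)
  have zero: "\<zero>\<^bsub>N\<^esub> \<in> carrier N"
    by (rule novikov_carrierI) (auto simp: supp_def)
  show "abelian_group N"
  proof (rule abelian_groupI)
    show "x \<oplus>\<^bsub>N\<^esub> y \<in> carrier N" if "x \<in> carrier N" "y \<in> carrier N" for x y
      by (rule novikov_add_closed[OF that])
    show "\<zero>\<^bsub>N\<^esub> \<in> carrier N" by (rule zero)
    show "\<exists>y\<in>carrier N. y \<oplus>\<^bsub>N\<^esub> x = \<zero>\<^bsub>N\<^esub>" if x: "x \<in> carrier N" for x
      by (rule bexI[OF _ novikov_uminus_closed[OF x]])
        (use novikov_val[OF x] in \<open>auto simp: R.l_neg intro!: restrict_ext\<close>)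
    show "\<zero>\<^bsub>N\<^esub> \<oplus>\<^bsub>N\<^esub> x = x" if x: "x \<in> carrier N" for x
      by (rule novikov_eqI) (use novikov_val[OF x] novikov_ext[OF x] in auto)
  qed (auto intro!: restrict_ext simp: novikov_val R.a_ac)
  show "monoid N"
  proof (rule monoidI)
    show "x \<otimes>\<^bsub>N\<^esub> y \<in> carrier N" if "x \<in> carrier N" "y \<in> carrier N" for x y
      using convolution_closed[OF that] by simp
    show "\<one>\<^bsub>N\<^esub> \<in> carrier N" using monomial_closed[of "\<one>\<^bsub>R\<^esub>"] by simp
    show "\<one>\<^bsub>N\<^esub> \<otimes>\<^bsub>N\<^esub> x = x" if x: "x \<in> carrier N" for x
      unfolding novikov_ring_simps
      by (rule novikov_eqI)
        (use novikov_val[OF x] novikov_ext[OF x] x in \<open>simp_all add: convolution_monomial_left convolution_ext\<close>)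
    show "x \<otimes>\<^bsub>N\<^esub> \<one>\<^bsub>N\<^esub> = x" if x: "x \<in> carrier N" for x
      unfolding novikov_ring_simps
      by (rule novikov_eqI)
        (use novikov_val[OF x] novikov_ext[OF x] x in
          \<open>simp_all add: convolution_monomial_one_right convolution_ext\<close>)
  qed (simp add: convolution_assoc)
qed (simp_all only: novikov_ring_simps(1) convolution_distrib_left convolution_distrib_right)

end

section \<open>Twisting and the change of sign\<close>

text \<open>The coefficients stay as they are. Over a noncommutative \<open>R\<close> this need not
  reverse products, so it is used as an additive bijection that interacts with multiplication only
  through the twisted action.\<close>

definition inv_reindex :: "('g, 'l) monoid_scheme \<Rightarrow> ('g \<Rightarrow> 'r) \<Rightarrow> 'g \<Rightarrow> 'r"
  where "inv_reindex G x = (\<lambda>g\<in>carrier G. x (inv\<^bsub>G\<^esub> g))"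

context novikov
begin

lemma novikov_neg: "novikov R G (\<lambda>g. - \<phi> g)"
  using \<phi>_hom by unfold_locales (simp add: hom_def real_group_def)

interpretation N: ring N by (rule ring_novikov)

abbreviation "star \<equiv> inv_reindex G"
abbreviation "BM \<equiv> novikov_bimodule R G \<phi>"

text \<open>Inversion in \<open>G\<close> changes the sign of \<open>\<phi>\<close>, so the two
  finiteness conditions correspond.\<close>

lemma star_closed:
  assumes x: "x \<in> carrier N" shows "star x \<in> carrier (novikov_ring R G (\<lambda>g. - \<phi> g))"
proof (rule novikov.novikov_carrierI[OF novikov_neg])
  fix \<kappa>
  have "{g \<in> S (star x). - \<phi> g \<le> \<kappa>} \<subseteq> (\<lambda>g. inv\<^bsub>G\<^esub> g) ` {g \<in> S x. \<phi> g \<le> \<kappa>}"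
  proof
    fix g assume g: "g \<in> {g \<in> S (star x). - \<phi> g \<le> \<kappa>}"
    then have "inv\<^bsub>G\<^esub> g \<in> {g \<in> S x. \<phi> g \<le> \<kappa>}"
      by (auto simp: supp_def inv_reindex_def \<phi>_inv)
    then show "g \<in> (\<lambda>g. inv\<^bsub>G\<^esub> g) ` {g \<in> S x. \<phi> g \<le> \<kappa>}"
      by (rule rev_image_eqI) (use g in \<open>auto simp: supp_def\<close>)
  qed
  then show "finite {g \<in> S (star x). - \<phi> g \<le> \<kappa>}"
    by (rule finite_subset) (intro finite_imageI novikov_finite x)
qed (use novikov_val[OF x] in \<open>auto simp: inv_reindex_def\<close>)

lemma star_star: "x \<in> carrier N \<Longrightarrow> star (star x) = x"
  by (rule extensionalityI[of _ "carrier G"]) (auto simp: inv_reindex_def novikov_ext)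

text \<open>Addition is pointwise and does not involve \<open>\<phi>\<close>, so the addition of
  \<open>N\<close> also serves on the right, where the elements belong to the ring of
  \<open>-\<phi>\<close>.\<close>

lemma star_add: "star (x \<oplus>\<^bsub>N\<^esub> y) = star x \<oplus>\<^bsub>N\<^esub> star y"
  by (auto simp: inv_reindex_def intro!: restrict_ext)

lemma star_one: "star (monomial R G \<one>\<^bsub>G\<^esub> \<one>\<^bsub>R\<^esub>) = monomial R G \<one>\<^bsub>G\<^esub> \<one>\<^bsub>R\<^esub>"
  by (auto simp: inv_reindex_def monomial_def intro!: restrict_ext)

lemma novikov_bimodule_simps [simp]:
  "carrier BM = carrier N" "x \<oplus>\<^bsub>BM\<^esub> y = x \<oplus>\<^bsub>N\<^esub> y" "\<zero>\<^bsub>BM\<^esub> = \<zero>\<^bsub>N\<^esub>"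
  "x \<odot>\<^bsub>BM\<^esub> y = conv x y" "bi_rsmult BM x y = conv x y"
  by (simp_all add: novikov_bimodule_def Let_def novikov_ring_def group_ring_def)

lemma abelian_group_novikov_bimodule: "abelian_group BM"
proof (rule abelian_groupI)
  show "\<exists>y\<in>carrier BM. y \<oplus>\<^bsub>BM\<^esub> x = \<zero>\<^bsub>BM\<^esub>" if "x \<in> carrier BM" for x
    using that N.add.l_inv_ex unfolding novikov_bimodule_simps by blast
qed (simp_all only: novikov_bimodule_simps N.a_closed N.zero_closed N.a_ac N.l_zero N.r_zero)

text \<open>The module axioms are ring axioms of the Novikov ring with some arguments restricted to
  the group ring. The premise is supplied by a resolution, whose terms are modules over the group
  ring.\<close>

lemma left_module_novikov_bimodule:
  assumes "ring (group_ring R G)" shows "left_module (group_ring R G) BM"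
proof (intro left_module.intro left_module_axioms.intro assms abelian_group_novikov_bimodule)
  let ?A = "group_ring R G"
  have aN: "a \<in> carrier N" if "a \<in> carrier ?A" for a
    using that group_ring_subset by auto
  show "a \<odot>\<^bsub>BM\<^esub> x \<in> carrier BM" if "a \<in> carrier ?A" "x \<in> carrier BM" for a x
    using convolution_closed[OF aN] that by simp
  show "(a \<oplus>\<^bsub>?A\<^esub> b) \<odot>\<^bsub>BM\<^esub> x = a \<odot>\<^bsub>BM\<^esub> x \<oplus>\<^bsub>BM\<^esub> b \<odot>\<^bsub>BM\<^esub> x"
    if "a \<in> carrier ?A" "b \<in> carrier ?A" "x \<in> carrier BM" for a b x
    using convolution_distrib_right[OF _ aN aN, of x a b] that by (simp add: group_ring_def)
  show "a \<odot>\<^bsub>BM\<^esub> (x \<oplus>\<^bsub>BM\<^esub> y) = a \<odot>\<^bsub>BM\<^esub> x \<oplus>\<^bsub>BM\<^esub> a \<odot>\<^bsub>BM\<^esub> y"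
    if "a \<in> carrier ?A" "x \<in> carrier BM" "y \<in> carrier BM" for a x y
    using convolution_distrib_left[OF aN] that by simp
  show "(a \<otimes>\<^bsub>?A\<^esub> b) \<odot>\<^bsub>BM\<^esub> x = a \<odot>\<^bsub>BM\<^esub> (b \<odot>\<^bsub>BM\<^esub> x)"
    if "a \<in> carrier ?A" "b \<in> carrier ?A" "x \<in> carrier BM" for a b x
    using convolution_assoc[OF aN aN, of a b x] that by (simp add: group_ring_def)
  show "\<one>\<^bsub>?A\<^esub> \<odot>\<^bsub>BM\<^esub> x = x" if "x \<in> carrier BM" for x
    using N.l_one that by (simp add: group_ring_def)
qed

text \<open>Evaluation at \<open>g\<close> is additive. This lets the sum in the definition of
  \<open>twist\<close> be computed in \<open>R\<close>.\<close>

lemma finsum_novikov_bimodule: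
  assumes "finite F" "f \<in> F \<rightarrow> carrier N" "g \<in> carrier G"
  shows "finsum BM f F g = (\<Oplus>\<^bsub>R\<^esub>h\<in>F. f h g)"
proof -
  interpret B: abelian_group BM by (rule abelian_group_novikov_bimodule)
  show ?thesis
    using assms(1,2)
  proof (induction F)
    case empty
    then show ?case using assms(3) by simp
  next
    case (insert h F)
    then have "f h \<in> carrier N" "f \<in> F \<rightarrow> carrier N" by auto
    then show ?case
      using insert assms(3) novikov_val
      by (subst B.finsum_insert; (subst R.finsum_insert)?) (auto simp: Pi_iff)
  qed
qed

end

section \<open>The twisted module seen inside the Novikov ring of -\<phi>\<close>

context novikov
begin

interpretation neg: novikov R G "\<lambda>g. - \<phi> g" by (rule novikov_neg)

interpretation nN: ring neg.N by (rule neg.ring_novikov)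

text \<open>Evaluated at \<open>g\<close>, both sides are the sum of
  \<open>m (h g) \<otimes> a h\<close> over \<open>h\<close> in the support of \<open>a\<close>.
  Thus \<open>star\<close> carries the twisted action to right multiplication in the ring of
  \<open>-\<phi>\<close>, which is where the sign changes.\<close>

lemma twist_rsmult:
  assumes m: "m \<in> carrier N" and a: "a \<in> carrier (group_ring R G)"
  shows "rsmult (twist R G BM) m a = star (conv (star m) a)"
proof -
  interpret B: abelian_group BM by (rule abelian_group_novikov_bimodule)
  have aN: "a \<in> carrier neg.N" using a neg.group_ring_subset by auto
  have fin: "finite (S a)" using a by (simp add: group_ring_def)
  have av: "a h \<in> carrier R" if "h \<in> carrier G" for h using neg.novikov_val[OF aN that] .
  let ?f = "\<lambda>h. conv (monomial R G (inv\<^bsub>G\<^esub> h) \<one>\<^bsub>R\<^esub>) (conv m (monomial R G \<one>\<^bsub>G\<^esub> (a h)))"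
  have cm: "conv m (monomial R G \<one>\<^bsub>G\<^esub> (a h)) \<in> carrier N" if "h \<in> carrier G" for h
    by (intro convolution_closed m monomial_closed av that)
  have fN: "?f \<in> S a \<rightarrow> carrier N"
    by (intro Pi_I convolution_closed cm monomial_closed) (auto simp: supp_closed)
  have "rsmult (twist R G BM) m a = finsum BM ?f (S a)" by (simp add: twist_def)
  also have "\<dots> = star (conv (star m) a)"
  proof (rule novikov_eqI)
    have "finsum BM ?f (S a) \<in> carrier BM" using fN by (intro B.finsum_closed) simp
    then show "finsum BM ?f (S a) \<in> extensional (carrier G)" by (simp add: novikov_ext)
    show "star (conv (star m) a) \<in> extensional (carrier G)" by (simp add: inv_reindex_def)
    fix g assume g: "g \<in> carrier G"
    \<comment> \<open>\<open>?k h\<close> is the inverse of \<open>h g\<close>. It turns the sum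
      into a convolution at \<open>g\<^sup>-\<^sup>1\<close>, since
      \<open>star m (?k h) = m (h g)\<close> and
      \<open>(?k h)\<^sup>-\<^sup>1 g\<^sup>-\<^sup>1 = h\<close>.\<close>
    let ?k = "\<lambda>h. inv\<^bsub>G\<^esub> g \<otimes>\<^bsub>G\<^esub> inv\<^bsub>G\<^esub> h"
    have Sa: "h \<in> carrier G" if "h \<in> S a" for h using that by (rule supp_closed)
    have inj: "inj_on ?k (S a)"
      using g Sa by (intro inj_onI) auto
    have ik: "inv\<^bsub>G\<^esub> (?k h) = h \<otimes>\<^bsub>G\<^esub> g" if "h \<in> carrier G" for h
      using g that by (simp add: G.inv_mult_group)
    have "finsum BM ?f (S a) g = (\<Oplus>\<^bsub>R\<^esub>h\<in>S a. ?f h g)"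
      by (rule finsum_novikov_bimodule[OF fin fN g])
    also have "\<dots> = (\<Oplus>\<^bsub>R\<^esub>h\<in>S a. star m (?k h) \<otimes>\<^bsub>R\<^esub> a (inv\<^bsub>G\<^esub> (?k h) \<otimes>\<^bsub>G\<^esub> inv\<^bsub>G\<^esub> g))"
    proof (rule R.finsum_cong')
      show "(\<lambda>h. star m (?k h) \<otimes>\<^bsub>R\<^esub> a (inv\<^bsub>G\<^esub> (?k h) \<otimes>\<^bsub>G\<^esub> inv\<^bsub>G\<^esub> g)) \<in> S a \<rightarrow> carrier R"
        using g Sa av neg.novikov_val[OF star_closed[OF m]] by auto
      fix h assume "h \<in> S a"
      then have h: "h \<in> carrier G" by (rule Sa)
      have "?f h g = m (h \<otimes>\<^bsub>G\<^esub> g) \<otimes>\<^bsub>R\<^esub> a h"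
        using h g av[OF h] m cm[OF h] novikov_val[OF m]
        by (simp add: convolution_monomial_left convolution_monomial_one_right)
      also have "\<dots> = star m (?k h) \<otimes>\<^bsub>R\<^esub> a (inv\<^bsub>G\<^esub> (?k h) \<otimes>\<^bsub>G\<^esub> inv\<^bsub>G\<^esub> g)"
        using h g ik[OF h] by (simp add: inv_reindex_def G.m_assoc)
      finally show "?f h g = star m (?k h) \<otimes>\<^bsub>R\<^esub> a (inv\<^bsub>G\<^esub> (?k h) \<otimes>\<^bsub>G\<^esub> inv\<^bsub>G\<^esub> g)" .
    qed simp
    also have "\<dots> = (\<Oplus>\<^bsub>R\<^esub>k\<in>?k ` S a. star m k \<otimes>\<^bsub>R\<^esub> a (inv\<^bsub>G\<^esub> k \<otimes>\<^bsub>G\<^esub> inv\<^bsub>G\<^esub> g))"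
      using inj g Sa av neg.novikov_val[OF star_closed[OF m]]
      by (intro R.finsum_reindex[symmetric]) auto
    also have "\<dots> = conv (star m) a (inv\<^bsub>G\<^esub> g)"
    proof (rule neg.convolution_eq[OF star_closed[OF m] aN, symmetric])
      fix k assume k: "k \<in> S (star m)" "inv\<^bsub>G\<^esub> k \<otimes>\<^bsub>G\<^esub> inv\<^bsub>G\<^esub> g \<in> S a"
      have kG: "k \<in> carrier G" using k(1) by (rule supp_closed)
      have "k = ?k (inv\<^bsub>G\<^esub> k \<otimes>\<^bsub>G\<^esub> inv\<^bsub>G\<^esub> g)"
        using kG g by (simp add: G.inv_mult_group G.m_assoc[symmetric])
      then show "k \<in> ?k ` S a" using k(2) by (rule rev_image_eqI[rotated])
    qed (use g fin Sa in auto)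
    also have "\<dots> = star (conv (star m) a) g" using g by (simp add: inv_reindex_def)
    finally show "finsum BM ?f (S a) g = star (conv (star m) a) g" .
  qed
  finally show ?thesis .
qed

text \<open>Left action and pairing are products in the ring of \<open>-\<phi>\<close>, with
  \<open>star\<close> passing between it and the twisted module. Once \<open>star\<close> is
  cancelled against itself, the multiplicative and additive laws become associativity,
  distributivity and the unit laws of that ring.\<close>

lemma twist_bimodule_pairing:
  assumes A: "ring (group_ring R G)"
  shows "bimodule_pairing (group_ring R G) (twist R G BM) (\<lambda>a m. star (conv a (star m)))
    (novikov_bimodule R G (\<lambda>g. - \<phi> g)) (\<lambda>m. conv (star m)) (monomial R G \<one>\<^bsub>G\<^esub> \<one>\<^bsub>R\<^esub>)"
proof -
  interpret nn: novikov R G "\<lambda>g. - (- \<phi> g)" by (rule neg.novikov_neg)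
  let ?A = "group_ring R G" and ?M = "twist R G BM"
  have c: "carrier ?M = carrier N" "x \<oplus>\<^bsub>?M\<^esub> y = x \<oplus>\<^bsub>N\<^esub> y" for x y
    by (simp_all add: twist_def)
  \<comment> \<open>Reindexing the ring of \<open>-\<phi>\<close> lands in the ring of
    \<open>-(-\<phi>)\<close>, which is \<open>N\<close> again.\<close>
  have sc: "star x \<in> carrier N" if "x \<in> carrier neg.N" for x
    using neg.star_closed[OF that] by simp
  have ss: "star (star x) = x" if "x \<in> carrier neg.N" for x
    using neg.star_star[OF that] .
  have Aop: "x \<oplus>\<^bsub>?A\<^esub> y = x \<oplus>\<^bsub>neg.N\<^esub> y" "x \<otimes>\<^bsub>?A\<^esub> y = conv x y"
    "\<one>\<^bsub>?A\<^esub> = monomial R G \<one>\<^bsub>G\<^esub> \<one>\<^bsub>R\<^esub>" for x y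
    by (simp_all add: group_ring_def)
  have aN: "a \<in> carrier neg.N" if "a \<in> carrier ?A" for a
    using that neg.group_ring_subset by auto
  have u: "monomial R G \<one>\<^bsub>G\<^esub> \<one>\<^bsub>R\<^esub> \<in> carrier N" by (rule monomial_closed) simp
  have one: "conv (monomial R G \<one>\<^bsub>G\<^esub> \<one>\<^bsub>R\<^esub>) x = x" "conv x (monomial R G \<one>\<^bsub>G\<^esub> \<one>\<^bsub>R\<^esub>) = x"
    if "x \<in> carrier neg.N" for x
    using nN.l_one[OF that] nN.r_one[OF that] by simp_all
  note rules = c aN star_closed star_star sc ss neg.convolution_closed twist_rsmult
    neg.convolution_assoc u star_one one Aop(2,3) neg.novikov_bimodule_simps(1,4)
  show ?thesis
  proof (intro bimodule_pairing.intro bimodule_action.intro right_action.intro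
      bimodule_action_axioms.intro bimodule_pairing_axioms.intro
      neg.left_module_novikov_bimodule A)
    show "x \<oplus>\<^bsub>?M\<^esub> x' \<in> carrier ?M" if "x \<in> carrier ?M" "x' \<in> carrier ?M" for x x'
      using that novikov_add_closed[of x x'] unfolding c by simp
    show "star (conv (a \<oplus>\<^bsub>?A\<^esub> b) (star x)) = star (conv a (star x)) \<oplus>\<^bsub>?M\<^esub> star (conv b (star x))"
      if "a \<in> carrier ?A" "b \<in> carrier ?A" "x \<in> carrier ?M" for a b x
      using that neg.convolution_distrib_right[OF star_closed aN aN, of x a b]
        star_add[of "conv a (star x)" "conv b (star x)"]
      unfolding c Aop by simp
    show "star (conv a (star (x \<oplus>\<^bsub>?M\<^esub> y))) = star (conv a (star x)) \<oplus>\<^bsub>?M\<^esub> star (conv a (star y))"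
      if "a \<in> carrier ?A" "x \<in> carrier ?M" "y \<in> carrier ?M" for a x y
      using that neg.convolution_distrib_left[OF aN star_closed star_closed, of a x y]
        star_add[of x y] star_add[of "conv a (star x)" "conv a (star y)"]
      unfolding c by simp
    show "conv (star (x \<oplus>\<^bsub>?M\<^esub> x')) v =
        conv (star x) v \<oplus>\<^bsub>novikov_bimodule R G (\<lambda>g. - \<phi> g)\<^esub> conv (star x') v"
      if "x \<in> carrier ?M" "x' \<in> carrier ?M" "v \<in> carrier (novikov_bimodule R G (\<lambda>g. - \<phi> g))" for x x' v
      using that neg.convolution_distrib_right[OF _ star_closed star_closed, of v x x'] star_add[of x x']
      unfolding c by simp
    show "conv (star x) (v \<oplus>\<^bsub>novikov_bimodule R G (\<lambda>g. - \<phi> g)\<^esub> v') =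
        conv (star x) v \<oplus>\<^bsub>novikov_bimodule R G (\<lambda>g. - \<phi> g)\<^esub> conv (star x) v'"
      if "x \<in> carrier ?M" "v \<in> carrier (novikov_bimodule R G (\<lambda>g. - \<phi> g))"
        "v' \<in> carrier (novikov_bimodule R G (\<lambda>g. - \<phi> g))" for x v v'
      using that neg.convolution_distrib_left[OF star_closed, of x v v'] unfolding c by simp
  qed (simp_all only: rules)
qed

end

theorem corollary3p2:
  fixes R :: "('r, 'k) ring_scheme" and G :: "('g, 'l) monoid_scheme"
    and \<phi> :: "'g \<Rightarrow> real" and n :: nat
    and C :: "nat \<Rightarrow> ('g \<Rightarrow> 'r, 'c) module" and dC :: "nat \<Rightarrow> 'c \<Rightarrow> 'c" and \<epsilon>C :: "'c \<Rightarrow> 'r"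
    and D :: "nat \<Rightarrow> ('g \<Rightarrow> 'r, 'd) module" and dD :: "nat \<Rightarrow> 'd \<Rightarrow> 'd" and \<epsilon>D :: "'d \<Rightarrow> 'r"
  assumes "ring R" and "\<one>\<^bsub>R\<^esub> \<noteq> \<zero>\<^bsub>R\<^esub>"
    and "group G"
    and "\<phi> \<in> hom G real_group"
    and "projective_resolution (group_ring R G) (trivial_module R G) C dC \<epsilon>C"
    and "projective_resolution (group_ring R G) (trivial_module R G) D dD \<epsilon>D"
    and "\<forall>i\<le>n. trivial_group (group_homology R G C dC (novikov_bimodule R G \<phi>) i)"
  shows "\<forall>i\<le>n. trivial_group (group_cohomology R G D dD (novikov_bimodule R G (\<lambda>g. - \<phi> g)) i)"
proof (intro allI impI)
  fix i assume i: "i \<le> n"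
  note C = assms(5) and D = assms(6)
  note C' = projective_resolutionD[OF C] and D' = projective_resolutionD[OF D]
  let ?V = "novikov_bimodule R G (\<lambda>g. - \<phi> g)"
  interpret novikov R G \<phi>
    using assms by (intro novikov.intro novikov_axioms.intro)
  interpret R: ring R by fact
  \<comment> \<open>The ring axioms of the group ring are part of the module structure of
    \<open>C 0\<close>.\<close>
  have A: "ring (group_ring R G)" using C'(2)[of 0] by (simp add: left_module_def)
  interpret P: bimodule_pairing "group_ring R G" "twist R G (novikov_bimodule R G \<phi>)"
    "\<lambda>a m. inv_reindex G (convolution R G a (inv_reindex G m))" ?V
    "\<lambda>m. convolution R G (inv_reindex G m)" "monomial R G \<one>\<^bsub>G\<^esub> \<one>\<^bsub>R\<^esub>"
    by (rule twist_bimodule_pairing[OF A])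
  have "abelian_group (trivial_module R G)"
  proof (rule abelian_groupI)
    show "\<exists>y\<in>carrier (trivial_module R G). y \<oplus>\<^bsub>trivial_module R G\<^esub> x = \<zero>\<^bsub>trivial_module R G\<^esub>"
      if "x \<in> carrier (trivial_module R G)" for x
      using that R.add.l_inv_ex by (simp add: trivial_module_def)
  qed (simp_all add: trivial_module_def R.a_ac)
  \<comment> \<open>inherited along the augmentation, which spares a proof that it is multiplicative\<close>
  then have B: "left_module (group_ring R G) (trivial_module R G)"
    by (rule left_module_linear_image[OF C'(2) _ C'(4,5)])
  show "trivial_group (group_cohomology R G D dD ?V i)"
    unfolding group_cohomology_def
  proof (rule cochain_cohomology_Hom_trivialI[where C = D and d = dD,
        OF D'(2) P.V.left_module_axioms D'(3,8)])
    fix f assume f: "f \<in> linear_maps (group_ring R G) (D i) ?V"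
      "\<And>c. c \<in> carrier (D (Suc i)) \<Longrightarrow> f (dD i c) = \<zero>\<^bsub>?V\<^esub>"
    show "case i of 0 \<Rightarrow> \<forall>c \<in> carrier (D 0). f c = \<zero>\<^bsub>?V\<^esub>
      | Suc j \<Rightarrow> \<exists>k \<in> linear_maps (group_ring R G) (D j) ?V. \<forall>c \<in> carrier (D i). f c = k (dD j c)"
    \<comment> \<open>Cocycles on \<open>D\<close> are traded for cocycles on \<open>C\<close>, the
      resolution that the hypothesis on homology is about.\<close>
    proof (rule cocycle_imp_coboundary_resolution[OF C D B P.V.left_module_axioms _ f])
      fix f assume f: "f \<in> linear_maps (group_ring R G) (C i) ?V"
        "\<And>c. c \<in> carrier (C (Suc i)) \<Longrightarrow> f (dC i c) = \<zero>\<^bsub>?V\<^esub>"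
      show "case i of 0 \<Rightarrow> \<forall>c \<in> carrier (C 0). f c = \<zero>\<^bsub>?V\<^esub>
        | Suc j \<Rightarrow> \<exists>k \<in> linear_maps (group_ring R G) (C j) ?V. \<forall>c \<in> carrier (C i). f c = k (dC j c)"
        by (rule P.cocycle_imp_coboundary[OF C _ i f])
          (use assms(7) in \<open>simp add: group_homology_def\<close>)
    qed
  qed
qed

end
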